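(* Let $n\ge 2$. The category $\mathbf{MOY}$ is a rigid braided and untwisted monoidal category, with the braidings $\sigma^+,\sigma^-:\uparrow^1\otimes\uparrow^1\to\uparrow^1\otimes\uparrow^1$ given by $$\sigma^+=q^{n-1}\,\mathrm{id}_{\uparrow^1\uparrow^1}-q^{n}S,\qquad \sigma^-=q^{1-n}\,\mathrm{id}_{\uparrow^1\uparrow^1}-q^{-n}S .$$
   Context: Coefficient ring: $\mathbb Q[q,q^{-1},(q-q^{-1})^{-1}]$. Diagrams are read bottom to top, up to plane isotopy; $\circ$ is stacking (left factor on top), $\otimes$ juxtaposition. $[j]_q=\frac{q^j-q^{-j}}{q-q^{-1}}$. $\mathbf{TrPD}$: objects are finite sequences of $\uparrow^1,\downarrow^1$; morphisms are linear combinations of oriented plane trivalent graphs with edges labelled in $\{1,2\}$, boundary edges labelled 1, such that at each vertex the sum of incoming labels equals the sum of outgoing labels (two incoming and one outgoing edge, or vice versa). It is a balanced rigid monoidal category; morphisms are generated by identities, caps $\overrightarrow{ev}:\uparrow^1\downarrow^1\to\emptyset$, $\overleftarrow{ev}:\downarrow^1\uparrow^1\to\emptyset$, cups $\overrightarrow{coev}:\emptyset\to\uparrow^1\downarrow^1$, $\overleftarrow{coev}:\emptyset\to\downarrow^1\uparrow^1$, the graph $S:\uparrow^1\uparrow^1\to\uparrow^1\uparrow^1$ (two 1-edges merge into a 2-edge which splits into two 1-edges) and its dual $S^\vee$ (reversed orientations). Write $\mathrm{id}=\mathrm{id}_{\uparrow^1}$, $\mathrm{id}^\vee=\mathrm{id}_{\downarrow^1}$.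 $\mathbf{MOY}$ is the quotient of $\mathbf{TrPD}$ by the tensor ideal generated by the following relations and their duals (same diagrams with all orientations reversed): (1) the circle labelled 1 equals $[n]_q\,\emptyset$; (2) $S\circ S=(q+q^{-1})S$; (3) $(\overleftarrow{ev}\otimes\mathrm{id})\circ(\mathrm{id}^\vee\otimes S)\circ(\overleftarrow{coev}\otimes\mathrm{id})=[n-1]_q\,\mathrm{id}$; (4) $(\mathrm{id}\otimes\overrightarrow{ev}\otimes\mathrm{id}^\vee)\circ(S\otimes S^\vee)\circ(\mathrm{id}\otimes\overrightarrow{coev}\otimes\mathrm{id}^\vee)=\overrightarrow{coev}\circ\overrightarrow{ev}+[n-2]_q\,\mathrm{id}\otimes\mathrm{id}^\vee$; (5) $(S\otimes\mathrm{id})(\mathrm{id}\otimes S)(S\otimes\mathrm{id})+\mathrm{id}\otimes S=(\mathrm{id}\otimes S)(S\otimes\mathrm{id})(\mathrm{id}\otimes S)+S\otimes\mathrm{id}$. A balanced rigid monoidal category monoidally generated by $\uparrow^1$ and its dual is said to be rigid braided untwisted with braidings $\sigma^\pm$ if (R1) $(\overleftarrow{ev}\otimes\mathrm{id})\circ(\mathrm{id}^\vee\otimes\sigma^\pm)\circ(\overleftarrow{coev}\otimes\mathrm{id})=\mathrm{id}$; (R2a) $\sigma^+\circ\sigma^-=\sigma^-\circ\sigma^+=\mathrm{id}_{\uparrow^1\uparrow^1}$; (R2b) $(\mathrm{id}\otimes\overrightarrow{ev}\otimes\mathrm{id}^\vee)\circ(\sigma^+\otimes(\sigma^-)^\vee)\circ(\mathrm{id}\otimes\overrightarrow{coev}\otimes\mathrm{id}^\vee)=\overrightarrow{coev}\circ\overrightarrow{ev}$;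 (R3) $(\sigma^+\otimes\mathrm{id})(\mathrm{id}\otimes\sigma^+)(\sigma^+\otimes\mathrm{id})=(\mathrm{id}\otimes\sigma^+)(\sigma^+\otimes\mathrm{id})(\mathrm{id}\otimes\sigma^+)$; together with the variants of these obtained by exchanging $\sigma^+$ and $\sigma^-$ or reversing orientations of the strands or of the plane (i.e. all oriented Reidemeister moves). *)

theory Defs
  imports
    "HOL-Library.Poly_Mapping"
    "HOL-Computational_Algebra.Polynomial"
    "HOL-Computational_Algebra.Fraction_Field"
begin

section \<open>The ring of coefficients\<close>

abbreviation qvar :: "rat poly fract"
  where "qvar \<equiv> Fract [:0, 1:] 1"

text \<open>The subring \<open>\<rat>[q, q\<^sup>-\<^sup>1, (q - q\<^sup>-\<^sup>1)\<^sup>-\<^sup>1]\<close> of the field \<open>\<rat>(q)\<close>.\<close>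

inductive_set qring_carrier :: "rat poly fract set" where
  const: "Fract [:c:] 1 \<in> qring_carrier"
| q: "qvar \<in> qring_carrier"
| q_inv: "inverse qvar \<in> qring_carrier"
| diff_inv: "inverse (qvar - inverse qvar) \<in> qring_carrier"
| add: "x \<in> qring_carrier \<Longrightarrow> y \<in> qring_carrier \<Longrightarrow> x + y \<in> qring_carrier"
| mult: "x \<in> qring_carrier \<Longrightarrow> y \<in> qring_carrier \<Longrightarrow> x * y \<in> qring_carrier"

lemma qring_carrier_0: "0 \<in> qring_carrier"
  using qring_carrier.const[of 0] by (simp add: fract_collapse)

lemma qring_carrier_1: "1 \<in> qring_carrier"
  using qring_carrier.const[of 1] by (simp add: fract_collapse flip: one_pCons)

lemma qring_carrier_uminus:
  assumes "x \<in> qring_carrier" shows "- x \<in> qring_carrier"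
proof -
  have "Fract [:-1:] 1 = (- 1 :: rat poly fract)"
    by (metis One_fract_def minus_fract minus_pCons neg_equal_zero one_pCons minus_zero)
  then have "- 1 \<in> qring_carrier"
    using qring_carrier.const[of "- 1"] by simp
  from qring_carrier.mult[OF this assms] show ?thesis by simp
qed

lemma qring_carrier_power:
  "x \<in> qring_carrier \<Longrightarrow> x ^ k \<in> qring_carrier"
  by (induction k) (auto intro: qring_carrier_1 qring_carrier.mult)

lemma qring_carrier_powi: "qvar powi k \<in> qring_carrier"
  unfolding power_int_def
  using qring_carrier_power[OF qring_carrier.q] qring_carrier_power[OF qring_carrier.q_inv]
  by simp

typedef qring = qring_carrier
  using qring_carrier_0 by blast

setup_lifting type_definition_qring

instantiation qring :: comm_ring_1
begin

lift_definition zero_qring :: qring is 0 by (rule qring_carrier_0)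
lift_definition one_qring :: qring is 1 by (rule qring_carrier_1)
lift_definition plus_qring :: "qring \<Rightarrow> qring \<Rightarrow> qring" is "(+)"
  by (rule qring_carrier.add)
lift_definition times_qring :: "qring \<Rightarrow> qring \<Rightarrow> qring" is "(*)"
  by (rule qring_carrier.mult)
lift_definition uminus_qring :: "qring \<Rightarrow> qring" is uminus
  by (rule qring_carrier_uminus)
lift_definition minus_qring :: "qring \<Rightarrow> qring \<Rightarrow> qring" is "(-)"
  unfolding diff_conv_add_uminus by (intro qring_carrier.add qring_carrier_uminus)

instance
  by standard (transfer; simp add: algebra_simps)+

end

lift_definition qpow :: "int \<Rightarrow> qring" is "\<lambda>k. qvar powi k"
  by (rule qring_carrier_powi)

lift_definition qint :: "int \<Rightarrow> qring"
  is "\<lambda>j. (qvar powi j - qvar powi (- j)) / (qvar - inverse qvar)"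
  unfolding divide_inverse diff_conv_add_uminus[of "qvar powi _"]
  by (intro qring_carrier.mult qring_carrier.add qring_carrier_uminus
      qring_carrier_powi qring_carrier.diff_inv)


section \<open>Linear monoidal categories with duals\<close>

text \<open>
  Monoidal categories are strict, and every element of the type \<open>'o\<close> is an object.
  \<open>g \<cdot> f\<close> is ``\<open>g\<close> after \<open>f\<close>''.  Each object \<open>a\<close> has one object \<open>a\<^sup>\<or>\<close> that is both a
  left and a right dual of it:
    \<open>EvR a : a \<otimes> a\<^sup>\<or> \<rightarrow> 1\<close>,  \<open>EvL a : a\<^sup>\<or> \<otimes> a \<rightarrow> 1\<close>,
    \<open>CoevR a : 1 \<rightarrow> a \<otimes> a\<^sup>\<or>\<close>,  \<open>CoevL a : 1 \<rightarrow> a\<^sup>\<or> \<otimes> a\<close>.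
  For \<open>a = \<up>\<close> the maps with suffix R are those written with an arrow pointing to the
  right, and the maps with suffix L are those written with an arrow pointing to the left.
\<close>

record ('o, 'm, 'r) moncat =
  Arr :: "'m set"
  Dom :: "'m \<Rightarrow> 'o"
  Cod :: "'m \<Rightarrow> 'o"
  Ide :: "'o \<Rightarrow> 'm"
  Cmp :: "'m \<Rightarrow> 'm \<Rightarrow> 'm" (infixr "\<cdot>\<index>" 70)
  Unit :: 'o
  OTensor :: "'o \<Rightarrow> 'o \<Rightarrow> 'o" (infixr "\<boxtimes>\<index>" 80)
  Tensor :: "'m \<Rightarrow> 'm \<Rightarrow> 'm" (infixr "\<otimes>\<index>" 80)
  Zero :: "'o \<Rightarrow> 'o \<Rightarrow> 'm"
  Plus :: "'m \<Rightarrow> 'm \<Rightarrow> 'm" (infixl "\<oplus>\<index>" 60)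
  Scale :: "'r \<Rightarrow> 'm \<Rightarrow> 'm" (infixr "\<odot>\<index>" 75)
  Dual :: "'o \<Rightarrow> 'o"
  EvR :: "'o \<Rightarrow> 'm"
  EvL :: "'o \<Rightarrow> 'm"
  CoevR :: "'o \<Rightarrow> 'm"
  CoevL :: "'o \<Rightarrow> 'm"

definition Hom :: "('o, 'm, 'r, 'z) moncat_scheme \<Rightarrow> 'o \<Rightarrow> 'o \<Rightarrow> 'm set"
  where "Hom C a b = {f \<in> Arr C. Dom C f = a \<and> Cod C f = b}"

definition Minus :: "('o, 'm, 'r::ring_1, 'z) moncat_scheme \<Rightarrow> 'm \<Rightarrow> 'm \<Rightarrow> 'm"
    (infixl "\<ominus>\<index>" 60)
  where "f \<ominus>\<^bsub>C\<^esub> g = f \<oplus>\<^bsub>C\<^esub> ((- 1) \<odot>\<^bsub>C\<^esub> g)"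

text \<open>For \<open>f : a \<rightarrow> b\<close>, both of the following are morphisms \<open>b\<^sup>\<or> \<rightarrow> a\<^sup>\<or>\<close>.\<close>

definition LDual :: "('o, 'm, 'r, 'z) moncat_scheme \<Rightarrow> 'm \<Rightarrow> 'm"
  where "LDual C f = (let a' = Ide C (Dual C (Dom C f)); b' = Ide C (Dual C (Cod C f)) in
    (EvL C (Cod C f) \<otimes>\<^bsub>C\<^esub> a') \<cdot>\<^bsub>C\<^esub> (b' \<otimes>\<^bsub>C\<^esub> f \<otimes>\<^bsub>C\<^esub> a') \<cdot>\<^bsub>C\<^esub> (b' \<otimes>\<^bsub>C\<^esub> CoevR C (Dom C f)))"

definition RDual :: "('o, 'm, 'r, 'z) moncat_scheme \<Rightarrow> 'm \<Rightarrow> 'm"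
  where "RDual C f = (let a' = Ide C (Dual C (Dom C f)); b' = Ide C (Dual C (Cod C f)) in
    (a' \<otimes>\<^bsub>C\<^esub> EvR C (Cod C f)) \<cdot>\<^bsub>C\<^esub> (a' \<otimes>\<^bsub>C\<^esub> f \<otimes>\<^bsub>C\<^esub> b') \<cdot>\<^bsub>C\<^esub> (CoevL C (Dom C f) \<otimes>\<^bsub>C\<^esub> b'))"

locale linear_monoidal_category =
  fixes C :: "('o, 'm, 'r::comm_ring_1) moncat" (structure)
  assumes ide_hom: "Ide C a \<in> Hom C a a"
    and cmp_hom: "f \<in> Hom C a b \<Longrightarrow> g \<in> Hom C b c \<Longrightarrow> g \<cdot> f \<in> Hom C a c"
    and cmp_ide_right: "f \<in> Hom C a b \<Longrightarrow> f \<cdot> Ide C a = f"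
    and cmp_ide_left: "f \<in> Hom C a b \<Longrightarrow> Ide C b \<cdot> f = f"
    and cmp_assoc: "f \<in> Hom C a b \<Longrightarrow> g \<in> Hom C b c \<Longrightarrow> h \<in> Hom C c d \<Longrightarrow>
      (h \<cdot> g) \<cdot> f = h \<cdot> (g \<cdot> f)"
    and zero_hom: "Zero C a b \<in> Hom C a b"
    and plus_hom: "f \<in> Hom C a b \<Longrightarrow> g \<in> Hom C a b \<Longrightarrow> f \<oplus> g \<in> Hom C a b"
    and scale_hom: "f \<in> Hom C a b \<Longrightarrow> r \<odot> f \<in> Hom C a b"
    and plus_assoc: "f \<in> Hom C a b \<Longrightarrow> g \<in> Hom C a b \<Longrightarrow> h \<in> Hom C a b \<Longrightarrow>
      (f \<oplus> g) \<oplus> h = f \<oplus> (g \<oplus> h)"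
    and plus_comm: "f \<in> Hom C a b \<Longrightarrow> g \<in> Hom C a b \<Longrightarrow> f \<oplus> g = g \<oplus> f"
    and plus_zero: "f \<in> Hom C a b \<Longrightarrow> f \<oplus> Zero C a b = f"
    and minus_self: "f \<in> Hom C a b \<Longrightarrow> f \<ominus> f = Zero C a b"
    and scale_plus: "f \<in> Hom C a b \<Longrightarrow> g \<in> Hom C a b \<Longrightarrow> r \<odot> (f \<oplus> g) = (r \<odot> f) \<oplus> (r \<odot> g)"
    and plus_scale: "f \<in> Hom C a b \<Longrightarrow> (r + s) \<odot> f = (r \<odot> f) \<oplus> (s \<odot> f)"
    and scale_scale: "f \<in> Hom C a b \<Longrightarrow> r \<odot> (s \<odot> f) = (r * s) \<odot> f"
    and scale_one: "f \<in> Hom C a b \<Longrightarrow> 1 \<odot> f = f"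
    and cmp_plus_left: "f \<in> Hom C a b \<Longrightarrow> g \<in> Hom C b c \<Longrightarrow> g' \<in> Hom C b c \<Longrightarrow>
      (g \<oplus> g') \<cdot> f = (g \<cdot> f) \<oplus> (g' \<cdot> f)"
    and cmp_plus_right: "f \<in> Hom C a b \<Longrightarrow> f' \<in> Hom C a b \<Longrightarrow> g \<in> Hom C b c \<Longrightarrow>
      g \<cdot> (f \<oplus> f') = (g \<cdot> f) \<oplus> (g \<cdot> f')"
    and cmp_scale_left: "f \<in> Hom C a b \<Longrightarrow> g \<in> Hom C b c \<Longrightarrow> (r \<odot> g) \<cdot> f = r \<odot> (g \<cdot> f)"
    and cmp_scale_right: "f \<in> Hom C a b \<Longrightarrow> g \<in> Hom C b c \<Longrightarrow> g \<cdot> (r \<odot> f) = r \<odot> (g \<cdot> f)"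
    and otensor_assoc: "(a \<boxtimes> b) \<boxtimes> c = a \<boxtimes> (b \<boxtimes> c)"
    and otensor_unit_left: "Unit C \<boxtimes> a = a"
    and otensor_unit_right: "a \<boxtimes> Unit C = a"
    and tensor_hom: "f \<in> Hom C a b \<Longrightarrow> g \<in> Hom C c d \<Longrightarrow> f \<otimes> g \<in> Hom C (a \<boxtimes> c) (b \<boxtimes> d)"
    and tensor_ide: "Ide C a \<otimes> Ide C b = Ide C (a \<boxtimes> b)"
    and interchange: "f \<in> Hom C a b \<Longrightarrow> g \<in> Hom C b c \<Longrightarrow> f' \<in> Hom C a' b' \<Longrightarrow> g' \<in> Hom C b' c' \<Longrightarrow>
      (g \<cdot> f) \<otimes> (g' \<cdot> f') = (g \<otimes> g') \<cdot> (f \<otimes> f')"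
    and tensor_assoc: "f \<in> Hom C a a' \<Longrightarrow> g \<in> Hom C b b' \<Longrightarrow> h \<in> Hom C c c' \<Longrightarrow>
      (f \<otimes> g) \<otimes> h = f \<otimes> (g \<otimes> h)"
    and tensor_unit_left: "f \<in> Hom C a b \<Longrightarrow> Ide C (Unit C) \<otimes> f = f"
    and tensor_unit_right: "f \<in> Hom C a b \<Longrightarrow> f \<otimes> Ide C (Unit C) = f"
    and tensor_plus_left: "f \<in> Hom C a b \<Longrightarrow> f' \<in> Hom C a b \<Longrightarrow> g \<in> Hom C c d \<Longrightarrow>
      (f \<oplus> f') \<otimes> g = (f \<otimes> g) \<oplus> (f' \<otimes> g)"
    and tensor_plus_right: "f \<in> Hom C a b \<Longrightarrow> g \<in> Hom C c d \<Longrightarrow> g' \<in> Hom C c d \<Longrightarrow>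
      f \<otimes> (g \<oplus> g') = (f \<otimes> g) \<oplus> (f \<otimes> g')"
    and tensor_scale_left: "f \<in> Hom C a b \<Longrightarrow> g \<in> Hom C c d \<Longrightarrow> (r \<odot> f) \<otimes> g = r \<odot> (f \<otimes> g)"
    and tensor_scale_right: "f \<in> Hom C a b \<Longrightarrow> g \<in> Hom C c d \<Longrightarrow> f \<otimes> (r \<odot> g) = r \<odot> (f \<otimes> g)"

text \<open>
  ``Balanced'' means that left and right duality coincide, as monoidal functors.
\<close>

locale balanced_rigid_category = linear_monoidal_category +
  assumes evr_hom: "EvR C a \<in> Hom C (a \<boxtimes> Dual C a) (Unit C)"
    and evl_hom: "EvL C a \<in> Hom C (Dual C a \<boxtimes> a) (Unit C)"
    and coevr_hom: "CoevR C a \<in> Hom C (Unit C) (a \<boxtimes> Dual C a)"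
    and coevl_hom: "CoevL C a \<in> Hom C (Unit C) (Dual C a \<boxtimes> a)"
    and zigzag_left: "(Ide C a \<otimes> EvL C a) \<cdot> (CoevR C a \<otimes> Ide C a) = Ide C a"
    and zigzag_left_dual:
      "(EvL C a \<otimes> Ide C (Dual C a)) \<cdot> (Ide C (Dual C a) \<otimes> CoevR C a) = Ide C (Dual C a)"
    and zigzag_right: "(EvR C a \<otimes> Ide C a) \<cdot> (Ide C a \<otimes> CoevL C a) = Ide C a"
    and zigzag_right_dual:
      "(Ide C (Dual C a) \<otimes> EvR C a) \<cdot> (CoevL C a \<otimes> Ide C (Dual C a)) = Ide C (Dual C a)"
    and dual_unit: "Dual C (Unit C) = Unit C"
    and evr_unit: "EvR C (Unit C) = Ide C (Unit C)"
    and evl_unit: "EvL C (Unit C) = Ide C (Unit C)"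
    and coevr_unit: "CoevR C (Unit C) = Ide C (Unit C)"
    and coevl_unit: "CoevL C (Unit C) = Ide C (Unit C)"
    and dual_otensor: "Dual C (a \<boxtimes> b) = Dual C b \<boxtimes> Dual C a"
    and evr_otensor: "EvR C (a \<boxtimes> b) = EvR C a \<cdot> (Ide C a \<otimes> EvR C b \<otimes> Ide C (Dual C a))"
    and evl_otensor: "EvL C (a \<boxtimes> b) = EvL C b \<cdot> (Ide C (Dual C b) \<otimes> EvL C a \<otimes> Ide C b)"
    and coevr_otensor: "CoevR C (a \<boxtimes> b) = (Ide C a \<otimes> CoevR C b \<otimes> Ide C (Dual C a)) \<cdot> CoevR C a"
    and coevl_otensor: "CoevL C (a \<boxtimes> b) = (Ide C (Dual C b) \<otimes> CoevL C a \<otimes> Ide C b) \<cdot> CoevL C b"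
    and balanced: "f \<in> Hom C a b \<Longrightarrow> LDual C f = RDual C f"


section \<open>Rigid braided untwisted categories\<close>

datatype ori = Up | Down

fun flip :: "ori \<Rightarrow> ori" where
  "flip Up = Down"
| "flip Down = Up"

text \<open>Oriented strands, caps and cups for a generating object \<open>u\<close> placed at \<open>Up\<close>.\<close>

fun strand :: "('o, 'm, 'r, 'z) moncat_scheme \<Rightarrow> 'o \<Rightarrow> ori \<Rightarrow> 'o" where
  "strand C u Up = u"
| "strand C u Down = Dual C u"

abbreviation ids :: "('o, 'm, 'r, 'z) moncat_scheme \<Rightarrow> 'o \<Rightarrow> ori \<Rightarrow> 'm"
  where "ids C u x \<equiv> Ide C (strand C u x)"

fun cap :: "('o, 'm, 'r, 'z) moncat_scheme \<Rightarrow> 'o \<Rightarrow> ori \<Rightarrow> 'm" where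
  "cap C u Up = EvR C u"
| "cap C u Down = EvL C u"

fun cup :: "('o, 'm, 'r, 'z) moncat_scheme \<Rightarrow> 'o \<Rightarrow> ori \<Rightarrow> 'm" where
  "cup C u Up = CoevR C u"
| "cup C u Down = CoevL C u"

text \<open>
  \<open>crossing C u \<sigma>p \<sigma>m s x y : x \<otimes> y \<rightarrow> y \<otimes> x\<close> for arbitrary orientations \<open>x\<close>, \<open>y\<close>.
  The sign \<open>s\<close> records which of the two strands is on top: it is the one which is on top
  in \<open>\<sigma>p\<close> (from bottom left to top right, say) if \<open>s\<close> holds, and the other one otherwise,
  independently of the orientations.  Turning a crossing by 180 degrees preserves this
  sign and turning it by 90 degrees changes it.
\<close>

fun crossing ::
  "('o, 'm, 'r, 'z) moncat_scheme \<Rightarrow> 'o \<Rightarrow> 'm \<Rightarrow> 'm \<Rightarrow> bool \<Rightarrow> ori \<Rightarrow> ori \<Rightarrow> 'm" where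
  "crossing C u \<sigma>p \<sigma>m s Up Up = (if s then \<sigma>p else \<sigma>m)"
| "crossing C u \<sigma>p \<sigma>m s Down Down = LDual C (if s then \<sigma>p else \<sigma>m)"
| "crossing C u \<sigma>p \<sigma>m s Up Down =
    (ids C u Down \<otimes>\<^bsub>C\<^esub> ids C u Up \<otimes>\<^bsub>C\<^esub> cap C u Up) \<cdot>\<^bsub>C\<^esub>
    (ids C u Down \<otimes>\<^bsub>C\<^esub> (if s then \<sigma>m else \<sigma>p) \<otimes>\<^bsub>C\<^esub> ids C u Down) \<cdot>\<^bsub>C\<^esub>
    (cup C u Down \<otimes>\<^bsub>C\<^esub> ids C u Up \<otimes>\<^bsub>C\<^esub> ids C u Down)"
| "crossing C u \<sigma>p \<sigma>m s Down Up =
    (cap C u Down \<otimes>\<^bsub>C\<^esub> ids C u Up \<otimes>\<^bsub>C\<^esub> ids C u Down) \<cdot>\<^bsub>C\<^esub>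
    (ids C u Down \<otimes>\<^bsub>C\<^esub> (if s then \<sigma>m else \<sigma>p) \<otimes>\<^bsub>C\<^esub> ids C u Down) \<cdot>\<^bsub>C\<^esub>
    (ids C u Down \<otimes>\<^bsub>C\<^esub> ids C u Up \<otimes>\<^bsub>C\<^esub> cup C u Up)"

inductive_set generated_objects :: "('o, 'm, 'r, 'z) moncat_scheme \<Rightarrow> 'o \<Rightarrow> 'o set"
  for C :: "('o, 'm, 'r, 'z) moncat_scheme" and u :: 'o where
  unit: "Unit C \<in> generated_objects C u"
| gen: "u \<in> generated_objects C u"
| gen_dual: "Dual C u \<in> generated_objects C u"
| otensor: "a \<in> generated_objects C u \<Longrightarrow> b \<in> generated_objects C u \<Longrightarrow>
    a \<boxtimes>\<^bsub>C\<^esub> b \<in> generated_objects C u"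

text \<open>
  The Reidemeister moves are required in all their oriented versions.  In the third move
  the strands with orientations \<open>x\<close>, \<open>y\<close>, \<open>z\<close> start from left to right; \<open>s12\<close>, \<open>s13\<close>,
  \<open>s23\<close> are the signs of their three crossings, and the condition on them says that the
  strands can be placed at three different heights.
\<close>

locale rigid_braided_untwisted = balanced_rigid_category C
  for C :: "('o, 'm, 'r::comm_ring_1) moncat" (structure) +
  fixes u :: 'o and \<sigma>p \<sigma>m :: 'm
  assumes generated: "a \<in> generated_objects C u"
    and sigma_plus_hom: "\<sigma>p \<in> Hom C (u \<boxtimes> u) (u \<boxtimes> u)"
    and sigma_minus_hom: "\<sigma>m \<in> Hom C (u \<boxtimes> u) (u \<boxtimes> u)"
    and R1_left:
      "(cap C u (flip x) \<otimes> ids C u x) \<cdot>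
       (ids C u (flip x) \<otimes> crossing C u \<sigma>p \<sigma>m s x x) \<cdot>
       (cup C u (flip x) \<otimes> ids C u x) = ids C u x"
    and R1_right:
      "(ids C u x \<otimes> cap C u x) \<cdot>
       (crossing C u \<sigma>p \<sigma>m s x x \<otimes> ids C u (flip x)) \<cdot>
       (ids C u x \<otimes> cup C u x) = ids C u x"
    and R2:
      "crossing C u \<sigma>p \<sigma>m (\<not> s) y x \<cdot> crossing C u \<sigma>p \<sigma>m s x y = ids C u x \<otimes> ids C u y"
    and R2b:
      "(ids C u x \<otimes> cap C u x \<otimes> ids C u (flip x)) \<cdot>
       (crossing C u \<sigma>p \<sigma>m s x x \<otimes> crossing C u \<sigma>p \<sigma>m (\<not> s) (flip x) (flip x)) \<cdot>
       (ids C u x \<otimes> cup C u x \<otimes> ids C u (flip x)) = cup C u x \<cdot> cap C u x"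
    and R3: "(s12 = s23 \<longrightarrow> s13 = s12) \<Longrightarrow>
      (crossing C u \<sigma>p \<sigma>m s23 y z \<otimes> ids C u x) \<cdot>
      (ids C u y \<otimes> crossing C u \<sigma>p \<sigma>m s13 x z) \<cdot>
      (crossing C u \<sigma>p \<sigma>m s12 x y \<otimes> ids C u z) =
      (ids C u z \<otimes> crossing C u \<sigma>p \<sigma>m s12 x y) \<cdot>
      (crossing C u \<sigma>p \<sigma>m s13 x z \<otimes> ids C u y) \<cdot>
      (ids C u x \<otimes> crossing C u \<sigma>p \<sigma>m s23 y z)"


section \<open>Oriented plane trivalent graphs up to isotopy\<close>

datatype label = One | Two

type_synonym edge = "ori \<times> label"

fun flip_edge :: "edge \<Rightarrow> edge" where
  "flip_edge (x, l) = (flip x, l)"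

definition dual_edges :: "edge list \<Rightarrow> edge list"
  where "dual_edges es = rev (map flip_edge es)"

text \<open>
  A word describes a plane graph in general position, read from bottom to top.
  \<open>WCap e\<close> and \<open>WCup e\<close> have \<open>e\<close> on the left and its opposite on the right.  Up to
  rotation the only vertices are \<open>1 + 1 \<rightarrow> 2\<close> and \<open>2 \<rightarrow> 1 + 1\<close>; a vertex which has, in the
  diagram, two 1-labelled legs below and the 2-labelled leg above is a \<open>Join\<close>, and a vertex
  with the 2-labelled leg below is a \<open>Fork\<close>.  Thus \<open>Join Up\<close> and \<open>Fork Down\<close> are the
  merge vertex, \<open>Fork Up\<close> and \<open>Join Down\<close> are the split vertex.
\<close>

datatype word =
    WId "edge list"
  | WCap edge
  | WCup edge
  | Join ori
  | Fork ori
  | WComp word word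
  | WTens word word

fun wsrc :: "word \<Rightarrow> edge list" where
  "wsrc (WId es) = es"
| "wsrc (WCap e) = [e, flip_edge e]"
| "wsrc (WCup e) = []"
| "wsrc (Join x) = [(x, One), (x, One)]"
| "wsrc (Fork x) = [(x, Two)]"
| "wsrc (WComp g f) = wsrc f"
| "wsrc (WTens f g) = wsrc f @ wsrc g"

fun wtgt :: "word \<Rightarrow> edge list" where
  "wtgt (WId es) = es"
| "wtgt (WCap e) = []"
| "wtgt (WCup e) = [e, flip_edge e]"
| "wtgt (Join x) = [(x, Two)]"
| "wtgt (Fork x) = [(x, One), (x, One)]"
| "wtgt (WComp g f) = wtgt g"
| "wtgt (WTens f g) = wtgt f @ wtgt g"

text \<open>Nested caps and cups.\<close>

fun wevr :: "edge list \<Rightarrow> word" where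
  "wevr [] = WId []"
| "wevr (e # es) = WComp (WCap e) (WTens (WId [e]) (WTens (wevr es) (WId [flip_edge e])))"

fun wevl :: "edge list \<Rightarrow> word" where
  "wevl [] = WId []"
| "wevl (e # es) =
    WComp (wevl es) (WTens (WId (dual_edges es)) (WTens (WCap (flip_edge e)) (WId es)))"

fun wcoevr :: "edge list \<Rightarrow> word" where
  "wcoevr [] = WId []"
| "wcoevr (e # es) = WComp (WTens (WId [e]) (WTens (wcoevr es) (WId [flip_edge e]))) (WCup e)"

fun wcoevl :: "edge list \<Rightarrow> word" where
  "wcoevl [] = WId []"
| "wcoevl (e # es) =
    WComp (WTens (WId (dual_edges es)) (WTens (WCup (flip_edge e)) (WId es))) (wcoevl es)"

text \<open>The two ways of turning a diagram by 180 degrees.\<close>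

definition wldual :: "word \<Rightarrow> word"
  where "wldual f =
    WComp (WTens (wevl (wtgt f)) (WId (dual_edges (wsrc f))))
      (WComp (WTens (WId (dual_edges (wtgt f))) (WTens f (WId (dual_edges (wsrc f)))))
        (WTens (WId (dual_edges (wtgt f))) (wcoevr (wsrc f))))"

definition wrdual :: "word \<Rightarrow> word"
  where "wrdual f =
    WComp (WTens (WId (dual_edges (wsrc f))) (wevr (wtgt f)))
      (WComp (WTens (WId (dual_edges (wsrc f))) (WTens f (WId (dual_edges (wtgt f)))))
        (WTens (wcoevl (wsrc f)) (WId (dual_edges (wtgt f)))))"

text \<open>
  Plane isotopy is generated by the laws of strict monoidal categories (isotopies which do
  not change the critical points of the height function), by the straightening of
  zigzags, and by the rotations of the vertices.  The rotations of \<open>Fork\<close> follow from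
  those of \<open>Join\<close>.
\<close>

inductive isotopic :: "word \<Rightarrow> word \<Rightarrow> bool" where
  refl: "isotopic f f"
| sym: "isotopic f g \<Longrightarrow> isotopic g f"
| trans: "isotopic f g \<Longrightarrow> isotopic g h \<Longrightarrow> isotopic f h"
| comp_cong: "isotopic g g' \<Longrightarrow> isotopic f f' \<Longrightarrow> isotopic (WComp g f) (WComp g' f')"
| tens_cong: "isotopic f f' \<Longrightarrow> isotopic g g' \<Longrightarrow> isotopic (WTens f g) (WTens f' g')"
| comp_id_left: "isotopic (WComp (WId (wtgt f)) f) f"
| comp_id_right: "isotopic (WComp f (WId (wsrc f))) f"
| comp_assoc: "isotopic (WComp (WComp h g) f) (WComp h (WComp g f))"
| tens_unit_left: "isotopic (WTens (WId []) f) f"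
| tens_unit_right: "isotopic (WTens f (WId [])) f"
| tens_assoc: "isotopic (WTens (WTens f g) h) (WTens f (WTens g h))"
| tens_id: "isotopic (WTens (WId a) (WId b)) (WId (a @ b))"
| interchange: "wsrc g = wtgt f \<Longrightarrow> wsrc g' = wtgt f' \<Longrightarrow>
    isotopic (WTens (WComp g f) (WComp g' f')) (WComp (WTens g g') (WTens f f'))"
| zigzag_right: "isotopic
    (WComp (WTens (WCap e) (WId [e])) (WTens (WId [e]) (WCup (flip_edge e)))) (WId [e])"
| zigzag_left: "isotopic
    (WComp (WTens (WId [e]) (WCap (flip_edge e))) (WTens (WCup e) (WId [e]))) (WId [e])"
| rotate_left: "isotopic (wldual (Join x)) (Fork (flip x))"
| rotate_right: "isotopic (wrdual (Join x)) (Fork (flip x))"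

lemma flip_flip [simp]: "flip (flip x) = x"
  by (cases x) simp_all

lemma flip_edge_flip_edge [simp]: "flip_edge (flip_edge e) = e"
  by (cases e) simp

lemma wsrc_wtgt_nested [simp]:
  "wsrc (wevr es) = es @ dual_edges es" "wtgt (wevr es) = []"
  "wsrc (wevl es) = dual_edges es @ es" "wtgt (wevl es) = []"
  "wsrc (wcoevr es) = []" "wtgt (wcoevr es) = es @ dual_edges es"
  "wsrc (wcoevl es) = []" "wtgt (wcoevl es) = dual_edges es @ es"
  by (induction es) (simp_all add: dual_edges_def)

lemma wsrc_wtgt_duals [simp]:
  "wsrc (wldual f) = dual_edges (wtgt f)" "wtgt (wldual f) = dual_edges (wsrc f)"
  "wsrc (wrdual f) = dual_edges (wtgt f)" "wtgt (wrdual f) = dual_edges (wsrc f)"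
  by (simp_all add: wldual_def wrdual_def)

lemma isotopic_boundary: "isotopic f g \<Longrightarrow> wsrc f = wsrc g \<and> wtgt f = wtgt g"
  by (induction rule: isotopic.induct) (auto simp: dual_edges_def)

quotient_type diagram = word / isotopic
  by (intro equivpI reflpI sympI transpI) (blast intro: isotopic.intros)+

lift_definition dsrc :: "diagram \<Rightarrow> edge list" is wsrc
  by (simp add: isotopic_boundary)
lift_definition dtgt :: "diagram \<Rightarrow> edge list" is wtgt
  by (simp add: isotopic_boundary)
lift_definition dcomp :: "diagram \<Rightarrow> diagram \<Rightarrow> diagram" is WComp
  by (rule isotopic.comp_cong)
lift_definition dtens :: "diagram \<Rightarrow> diagram \<Rightarrow> diagram" is WTens
  by (rule isotopic.tens_cong)


section \<open>The category TrPD\<close>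

definition strands :: "ori list \<Rightarrow> edge list"
  where "strands a = map (\<lambda>x. (x, One)) a"

definition dual_ori :: "ori list \<Rightarrow> ori list"
  where "dual_ori a = rev (map flip a)"

text \<open>Two 1-edges merge into a 2-edge which splits; \<open>S\<close> for \<open>Up\<close> and \<open>S\<^sup>\<or>\<close> for \<open>Down\<close>.\<close>

definition wS :: "ori \<Rightarrow> word"
  where "wS x = WComp (Fork x) (Join x)"

text \<open>
  The graphs with 1-labelled boundary generated by identities, caps, cups, \<open>S\<close> and
  \<open>S\<^sup>\<or>\<close>: since every 2-labelled edge leads from a merge vertex to a split vertex, the only
  diagrams with 1-labelled boundary left out are those with closed 2-labelled loops without
  vertices.  The words in the image of this set are well-formed.
\<close>

inductive_set graphs :: "diagram set" where
  ident: "abs_diagram (WId (strands a)) \<in> graphs"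
| cap: "abs_diagram (WCap (x, One)) \<in> graphs"
| cup: "abs_diagram (WCup (x, One)) \<in> graphs"
| S: "abs_diagram (wS x) \<in> graphs"
| comp: "f \<in> graphs \<Longrightarrow> g \<in> graphs \<Longrightarrow> dsrc g = dtgt f \<Longrightarrow> dcomp g f \<in> graphs"
| tens: "f \<in> graphs \<Longrightarrow> g \<in> graphs \<Longrightarrow> dtens f g \<in> graphs"

datatype lin_diagram =
  LinDiagram (lsrc: "ori list") (ltgt: "ori list") (coeffs: "diagram \<Rightarrow>\<^sub>0 qring")

definition bilinear_ext ::
  "('a \<Rightarrow> 'a \<Rightarrow> 'a) \<Rightarrow> ('a \<Rightarrow>\<^sub>0 'r::comm_ring_1) \<Rightarrow> ('a \<Rightarrow>\<^sub>0 'r) \<Rightarrow> ('a \<Rightarrow>\<^sub>0 'r)"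
  where "bilinear_ext h x y =
    (\<Sum>d\<in>Poly_Mapping.keys x. \<Sum>e\<in>Poly_Mapping.keys y.
      Poly_Mapping.single (h d e) (Poly_Mapping.lookup x d * Poly_Mapping.lookup y e))"

definition graph_mor :: "ori list \<Rightarrow> ori list \<Rightarrow> word \<Rightarrow> lin_diagram"
  where "graph_mor a b w = LinDiagram a b (Poly_Mapping.single (abs_diagram w) 1)"

definition TrPD :: "(ori list, lin_diagram, qring) moncat"
  where "TrPD = \<lparr>
    Arr = {f. \<forall>d \<in> Poly_Mapping.keys (coeffs f).
      d \<in> graphs \<and> dsrc d = strands (lsrc f) \<and> dtgt d = strands (ltgt f)},
    Dom = lsrc,
    Cod = ltgt,
    Ide = (\<lambda>a. graph_mor a a (WId (strands a))),
    Cmp = (\<lambda>g f. LinDiagram (lsrc f) (ltgt g) (bilinear_ext dcomp (coeffs g) (coeffs f))),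
    Unit = [],
    OTensor = (@),
    Tensor = (\<lambda>f g. LinDiagram (lsrc f @ lsrc g) (ltgt f @ ltgt g)
      (bilinear_ext dtens (coeffs f) (coeffs g))),
    Zero = (\<lambda>a b. LinDiagram a b 0),
    Plus = (\<lambda>f g. LinDiagram (lsrc f) (ltgt f) (coeffs f + coeffs g)),
    Scale = (\<lambda>r f. LinDiagram (lsrc f) (ltgt f) (Poly_Mapping.map ((*) r) (coeffs f))),
    Dual = dual_ori,
    EvR = (\<lambda>a. graph_mor (a @ dual_ori a) [] (wevr (strands a))),
    EvL = (\<lambda>a. graph_mor (dual_ori a @ a) [] (wevl (strands a))),
    CoevR = (\<lambda>a. graph_mor [] (a @ dual_ori a) (wcoevr (strands a))),
    CoevL = (\<lambda>a. graph_mor [] (dual_ori a @ a) (wcoevl (strands a)))\<rparr>"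


section \<open>Tensor ideals and quotients\<close>

inductive_set tensor_ideal ::
  "('o, 'm, 'r::ring_1, 'z) moncat_scheme \<Rightarrow> ('m \<times> 'm) set \<Rightarrow> 'm set"
  for C :: "('o, 'm, 'r::ring_1, 'z) moncat_scheme" and R :: "('m \<times> 'm) set" where
  gen: "(f, g) \<in> R \<Longrightarrow> f \<ominus>\<^bsub>C\<^esub> g \<in> tensor_ideal C R"
| zero: "Zero C a b \<in> tensor_ideal C R"
| plus: "f \<in> tensor_ideal C R \<Longrightarrow> g \<in> tensor_ideal C R \<Longrightarrow>
    Dom C f = Dom C g \<Longrightarrow> Cod C f = Cod C g \<Longrightarrow> f \<oplus>\<^bsub>C\<^esub> g \<in> tensor_ideal C R"
| scale: "f \<in> tensor_ideal C R \<Longrightarrow> r \<odot>\<^bsub>C\<^esub> f \<in> tensor_ideal C R"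
| cmp_left: "f \<in> tensor_ideal C R \<Longrightarrow> g \<in> Arr C \<Longrightarrow> Dom C g = Cod C f \<Longrightarrow>
    g \<cdot>\<^bsub>C\<^esub> f \<in> tensor_ideal C R"
| cmp_right: "f \<in> tensor_ideal C R \<Longrightarrow> g \<in> Arr C \<Longrightarrow> Dom C f = Cod C g \<Longrightarrow>
    f \<cdot>\<^bsub>C\<^esub> g \<in> tensor_ideal C R"
| tensor_left: "f \<in> tensor_ideal C R \<Longrightarrow> g \<in> Arr C \<Longrightarrow> g \<otimes>\<^bsub>C\<^esub> f \<in> tensor_ideal C R"
| tensor_right: "f \<in> tensor_ideal C R \<Longrightarrow> g \<in> Arr C \<Longrightarrow> f \<otimes>\<^bsub>C\<^esub> g \<in> tensor_ideal C R"

definition coset :: "('o, 'm, 'r::ring_1, 'z) moncat_scheme \<Rightarrow> 'm set \<Rightarrow> 'm \<Rightarrow> 'm set"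
  where "coset C I f = {g \<in> Hom C (Dom C f) (Cod C f). g \<ominus>\<^bsub>C\<^esub> f \<in> I}"

definition rep :: "'m set \<Rightarrow> 'm"
  where "rep F = (SOME f. f \<in> F)"

definition quotient_category ::
  "('o, 'm, 'r::ring_1) moncat \<Rightarrow> 'm set \<Rightarrow> ('o, 'm set, 'r) moncat"
  where "quotient_category C I = \<lparr>
    Arr = coset C I ` Arr C,
    Dom = (\<lambda>F. Dom C (rep F)),
    Cod = (\<lambda>F. Cod C (rep F)),
    Ide = (\<lambda>a. coset C I (Ide C a)),
    Cmp = (\<lambda>G F. coset C I (rep G \<cdot>\<^bsub>C\<^esub> rep F)),
    Unit = Unit C,
    OTensor = OTensor C,
    Tensor = (\<lambda>F G. coset C I (rep F \<otimes>\<^bsub>C\<^esub> rep G)),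
    Zero = (\<lambda>a b. coset C I (Zero C a b)),
    Plus = (\<lambda>F G. coset C I (rep F \<oplus>\<^bsub>C\<^esub> rep G)),
    Scale = (\<lambda>r F. coset C I (r \<odot>\<^bsub>C\<^esub> rep F)),
    Dual = Dual C,
    EvR = (\<lambda>a. coset C I (EvR C a)),
    EvL = (\<lambda>a. coset C I (EvL C a)),
    CoevR = (\<lambda>a. coset C I (CoevR C a)),
    CoevL = (\<lambda>a. coset C I (CoevL C a))\<rparr>"


section \<open>The category MOY\<close>

abbreviation tr_cmp (infixr "\<cdot>\<^sub>T" 70) where "g \<cdot>\<^sub>T f \<equiv> Cmp TrPD g f"
abbreviation tr_tensor (infixr "\<otimes>\<^sub>T" 80) where "f \<otimes>\<^sub>T g \<equiv> Tensor TrPD f g"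
abbreviation tr_plus (infixl "\<oplus>\<^sub>T" 60) where "f \<oplus>\<^sub>T g \<equiv> Plus TrPD f g"
abbreviation tr_scale (infixr "\<odot>\<^sub>T" 75) where "r \<odot>\<^sub>T f \<equiv> Scale TrPD r f"

definition tr_id :: "ori \<Rightarrow> lin_diagram"
  where "tr_id x = Ide TrPD [x]"
definition tr_cap :: "ori \<Rightarrow> lin_diagram"
  where "tr_cap x = graph_mor [x, flip x] [] (WCap (x, One))"
definition tr_cup :: "ori \<Rightarrow> lin_diagram"
  where "tr_cup x = graph_mor [] [x, flip x] (WCup (x, One))"
definition tr_S :: "ori \<Rightarrow> lin_diagram"
  where "tr_S x = graph_mor [x, x] [x, x] (wS x)"

text \<open>
  The case \<open>x = Up\<close> of each clause is the relation itself, the case \<open>x = Down\<close> is its dual,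
  obtained by reversing all orientations.
\<close>

inductive_set moy_relations :: "nat \<Rightarrow> (lin_diagram \<times> lin_diagram) set" for n :: nat where
  circle: "(tr_cap x \<cdot>\<^sub>T tr_cup x, qint (int n) \<odot>\<^sub>T Ide TrPD []) \<in> moy_relations n"
| digon: "(tr_S x \<cdot>\<^sub>T tr_S x, (qpow 1 + qpow (- 1)) \<odot>\<^sub>T tr_S x) \<in> moy_relations n"
| curl: "((tr_cap (flip x) \<otimes>\<^sub>T tr_id x) \<cdot>\<^sub>T (tr_id (flip x) \<otimes>\<^sub>T tr_S x) \<cdot>\<^sub>T
      (tr_cup (flip x) \<otimes>\<^sub>T tr_id x),
    qint (int n - 1) \<odot>\<^sub>T tr_id x) \<in> moy_relations n"
| square: "((tr_id x \<otimes>\<^sub>T tr_cap x \<otimes>\<^sub>T tr_id (flip x)) \<cdot>\<^sub>T (tr_S x \<otimes>\<^sub>T tr_S (flip x)) \<cdot>\<^sub>T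
      (tr_id x \<otimes>\<^sub>T tr_cup x \<otimes>\<^sub>T tr_id (flip x)),
    (tr_cup x \<cdot>\<^sub>T tr_cap x) \<oplus>\<^sub>T (qint (int n - 2) \<odot>\<^sub>T (tr_id x \<otimes>\<^sub>T tr_id (flip x))))
    \<in> moy_relations n"
| hexagon: "(((tr_S x \<otimes>\<^sub>T tr_id x) \<cdot>\<^sub>T (tr_id x \<otimes>\<^sub>T tr_S x) \<cdot>\<^sub>T (tr_S x \<otimes>\<^sub>T tr_id x))
      \<oplus>\<^sub>T (tr_id x \<otimes>\<^sub>T tr_S x),
    ((tr_id x \<otimes>\<^sub>T tr_S x) \<cdot>\<^sub>T (tr_S x \<otimes>\<^sub>T tr_id x) \<cdot>\<^sub>T (tr_id x \<otimes>\<^sub>T tr_S x))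
      \<oplus>\<^sub>T (tr_S x \<otimes>\<^sub>T tr_id x)) \<in> moy_relations n"

definition moy_ideal :: "nat \<Rightarrow> lin_diagram set"
  where "moy_ideal n = tensor_ideal TrPD (moy_relations n)"

definition MOY :: "nat \<Rightarrow> (ori list, lin_diagram set, qring) moncat"
  where "MOY n = quotient_category TrPD (moy_ideal n)"

definition moy_S :: "nat \<Rightarrow> lin_diagram set"
  where "moy_S n = coset TrPD (moy_ideal n) (tr_S Up)"

end

theory Submission
  imports Defs
begin

text \<open>
  The crossings are \<open>a \<cdot> id - b \<cdot> S\<close> with \<open>a = q\<^sup>-\<^sup>1b\<close> for one sign and \<open>a = q b\<close> for the other, so the
  moves with parallel strands are identities between linear combinations of MOY graphs: the
  curl relation gives the first move, the digon relation the second one, the hexagon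
  relation the third one, and the square relation the second move \<open>R2b\<close> in which the two
  crossings are joined by a cap and a cup.  All other oriented moves are rotations of these.
  The crossings are compatible with rotation in the sense that a strand can be pulled
  through a cap.  This turns \<open>R2b\<close> into the invertibility of the crossings of
  antiparallel strands, and the third move for strands \<open>y, z, x\<^sup>\<or>\<close> into the one for \<open>x, y, z\<close>.
  Together with the conjugation of a third move by one of its crossings, this reaches
  all orientations from the parallel one.

  That TrPD is balanced reduces to the existence of duals of the generating graphs, which are
  closed under composition and tensor product, and all axioms pass to quotients by tensor ideals.
\<close>

section \<open>Strict monoidal categories and dual pairs\<close>

text \<open>In a crossing of antiparallel strands \<open>S\<close> appears turned by 90 degrees,
  while the relations speak of upright copies of \<open>S\<close>. Hence equations are compared
  after closing a strand with a cap or a cup; a zigzag undoes the closing, so nothing is lost. The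
  prefactor \<open>q^n\<close> of \<open>S\<close> is fixed by the first move, which amounts to
  \<open>q^(n-1) [n] - q^n [n-1] = 1\<close>; in the other moves the prefactors cancel.
  \<open>R2b\<close> rests on \<open>[n] + [n-2] = (q + q^-1) [n-1]\<close>. For the third move let
  \<open>r1\<close>, \<open>r2\<close>, \<open>r3\<close> be the coefficients of the identity in the
  crossings of the strands 12, 13, 23 relative to the prefactors of \<open>S\<close>; the move comes
  down to \<open>(r2 - r1) (r2 - r3) = 0\<close>, which says that the strands can be placed at three
  heights. Balance enters the braiding part in one place: the crossing of two downward strands is
  defined as a left rotation, and one kind of cap produces the right rotation.\<close>

lemma hom_iff: "f \<in> Hom C a b \<longleftrightarrow> f \<in> Arr C \<and> Dom C f = a \<and> Cod C f = b"
  by (simp add: Hom_def)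

text \<open>
  The axioms are conditional equations in \<open>Arr\<close>, \<open>Dom\<close> and \<open>Cod\<close>, such that the simplifier
  decides typing and brings every morphism into a composite of layers
  \<open>Ide a \<otimes> f \<otimes> Ide b\<close>.  Only the exchange of two distant layers remains to be applied by hand.
\<close>

locale strict_monoidal_category =
  fixes C :: "('o, 'm, 'r) moncat" (structure)
  assumes arr_ide [simp]: "Ide C a \<in> Arr C"
    and dom_ide [simp]: "Dom C (Ide C a) = a"
    and cod_ide [simp]: "Cod C (Ide C a) = a"
    and arr_cmp [simp]: "f \<in> Arr C \<Longrightarrow> g \<in> Arr C \<Longrightarrow> Dom C g = Cod C f \<Longrightarrow> g \<cdot> f \<in> Arr C"
    and dom_cmp [simp]: "f \<in> Arr C \<Longrightarrow> g \<in> Arr C \<Longrightarrow> Dom C g = Cod C f \<Longrightarrow> Dom C (g \<cdot> f) = Dom C f"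
    and cod_cmp [simp]: "f \<in> Arr C \<Longrightarrow> g \<in> Arr C \<Longrightarrow> Dom C g = Cod C f \<Longrightarrow> Cod C (g \<cdot> f) = Cod C g"
    and ide_right [simp]: "f \<in> Arr C \<Longrightarrow> Dom C f = a \<Longrightarrow> f \<cdot> Ide C a = f"
    and ide_left [simp]: "f \<in> Arr C \<Longrightarrow> Cod C f = a \<Longrightarrow> Ide C a \<cdot> f = f"
    and assoc [simp]: "f \<in> Arr C \<Longrightarrow> g \<in> Arr C \<Longrightarrow> h \<in> Arr C \<Longrightarrow>
      Dom C g = Cod C f \<Longrightarrow> Dom C h = Cod C g \<Longrightarrow> (h \<cdot> g) \<cdot> f = h \<cdot> (g \<cdot> f)"
    and obj_assoc [simp]: "(a \<boxtimes> b) \<boxtimes> c = a \<boxtimes> (b \<boxtimes> c)"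
    and obj_unit_left [simp]: "Unit C \<boxtimes> a = a"
    and obj_unit_right [simp]: "a \<boxtimes> Unit C = a"
    and arr_tensor [simp]: "f \<in> Arr C \<Longrightarrow> g \<in> Arr C \<Longrightarrow> f \<otimes> g \<in> Arr C"
    and dom_tensor [simp]: "f \<in> Arr C \<Longrightarrow> g \<in> Arr C \<Longrightarrow> Dom C (f \<otimes> g) = Dom C f \<boxtimes> Dom C g"
    and cod_tensor [simp]: "f \<in> Arr C \<Longrightarrow> g \<in> Arr C \<Longrightarrow> Cod C (f \<otimes> g) = Cod C f \<boxtimes> Cod C g"
    and ide_tensor [simp]: "Ide C a \<otimes> Ide C b = Ide C (a \<boxtimes> b)"
    and cmp_tensor_cmp: "f \<in> Arr C \<Longrightarrow> g \<in> Arr C \<Longrightarrow> f' \<in> Arr C \<Longrightarrow> g' \<in> Arr C \<Longrightarrow>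
      Dom C g = Cod C f \<Longrightarrow> Dom C g' = Cod C f' \<Longrightarrow>
      (g \<cdot> f) \<otimes> (g' \<cdot> f') = (g \<otimes> g') \<cdot> (f \<otimes> f')"
    and mor_assoc [simp]: "f \<in> Arr C \<Longrightarrow> g \<in> Arr C \<Longrightarrow> h \<in> Arr C \<Longrightarrow> (f \<otimes> g) \<otimes> h = f \<otimes> (g \<otimes> h)"
    and mor_unit_left [simp]: "f \<in> Arr C \<Longrightarrow> Ide C (Unit C) \<otimes> f = f"
    and mor_unit_right [simp]: "f \<in> Arr C \<Longrightarrow> f \<otimes> Ide C (Unit C) = f"
begin

abbreviation I where "I \<equiv> Ide C"

lemma ide_tensor_tensor [simp]: "f \<in> Arr C \<Longrightarrow> I a \<otimes> (I b \<otimes> f) = I (a \<boxtimes> b) \<otimes> f"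
  by (simp flip: mor_assoc ide_tensor del: ide_tensor mor_assoc)

lemma whisker_left [simp]:
  "f \<in> Arr C \<Longrightarrow> g \<in> Arr C \<Longrightarrow> Dom C g = Cod C f \<Longrightarrow> I a \<otimes> (g \<cdot> f) = (I a \<otimes> g) \<cdot> (I a \<otimes> f)"
  using cmp_tensor_cmp[of "I a" "I a" f g] by simp

lemma whisker_right [simp]:
  "f \<in> Arr C \<Longrightarrow> g \<in> Arr C \<Longrightarrow> Dom C g = Cod C f \<Longrightarrow> (g \<cdot> f) \<otimes> I a = (g \<otimes> I a) \<cdot> (f \<otimes> I a)"
  using cmp_tensor_cmp[of f g "I a" "I a"] by simp

lemma tensor_split:
  assumes "f \<in> Arr C" "g \<in> Arr C" "Dom C f = a" "Cod C g = b"
  shows "f \<otimes> g = (f \<otimes> I b) \<cdot> (I a \<otimes> g)"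
  using cmp_tensor_cmp[of "I a" f g "I b"] assms by simp

lemma tensor_split':
  assumes "f \<in> Arr C" "g \<in> Arr C" "Cod C f = a" "Dom C g = b"
  shows "f \<otimes> g = (I a \<otimes> g) \<cdot> (f \<otimes> I b)"
  using cmp_tensor_cmp[of f "I a" "I b" g] assms by simp

text \<open>The letters \<open>p\<close>, \<open>m\<close>, \<open>q\<close> stand for the strands
  left of, between and right of the two layers. Most uses set some of them to the unit object, which
  simplification then removes.\<close>

lemma exchange:
  assumes "f \<in> Hom C a a'" "g \<in> Hom C b b'"
  shows "(I p \<otimes> f \<otimes> I (m \<boxtimes> b' \<boxtimes> q)) \<cdot> (I (p \<boxtimes> a \<boxtimes> m) \<otimes> g \<otimes> I q) =
    (I (p \<boxtimes> a' \<boxtimes> m) \<otimes> g \<otimes> I q) \<cdot> (I p \<otimes> f \<otimes> I (m \<boxtimes> b \<boxtimes> q))"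
proof -
  have "(f \<otimes> I (m \<boxtimes> b')) \<cdot> (I (a \<boxtimes> m) \<otimes> g) = (I (a' \<boxtimes> m) \<otimes> g) \<cdot> (f \<otimes> I (m \<boxtimes> b))"
    using tensor_split[of f "I m \<otimes> g"] tensor_split'[of f "I m \<otimes> g"] assms
    by (simp add: hom_iff)
  from arg_cong[OF this, of "\<lambda>X. I p \<otimes> X \<otimes> I q"] assms show ?thesis
    by (simp add: hom_iff)
qed

text \<open>Composites are normalised to the right, so an equation for \<open>f \<cdot> g\<close>
  does not match in the middle of a longer composite; with the tail \<open>k\<close> it
  does.\<close>

lemma cmp_tail:
  assumes "f \<cdot> g = h"
    and "f \<in> Arr C" "g \<in> Arr C" "Dom C f = Cod C g" "k \<in> Arr C" "Dom C g = Cod C k"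
  shows "f \<cdot> (g \<cdot> k) = h \<cdot> k"
  using assms by (simp flip: assoc)

text \<open>Formulated without \<open>Dual\<close>, so that the same lemmas serve both kinds of
  caps, with \<open>a\<close> an object or a dual, and nested caps as well.\<close>

definition dual_pair :: "'o \<Rightarrow> 'o \<Rightarrow> 'm \<Rightarrow> 'm \<Rightarrow> bool"
  where "dual_pair a b \<epsilon> \<eta> \<longleftrightarrow> \<epsilon> \<in> Hom C (a \<boxtimes> b) (Unit C) \<and> \<eta> \<in> Hom C (Unit C) (b \<boxtimes> a) \<and>
    (\<epsilon> \<otimes> I a) \<cdot> (I a \<otimes> \<eta>) = I a \<and> (I b \<otimes> \<epsilon>) \<cdot> (\<eta> \<otimes> I b) = I b"

text \<open>
  The map \<open>d\<close> moves the strand \<open>y\<close> across \<open>a\<close>, and \<open>e\<close> moves it across the dual \<open>b\<close> of \<open>a\<close>: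
  the strand \<open>y\<close> can be pulled through the cap \<open>\<epsilon>\<close>.
\<close>

definition slide :: "'o \<Rightarrow> 'o \<Rightarrow> 'm \<Rightarrow> 'o \<Rightarrow> 'm \<Rightarrow> 'm \<Rightarrow> bool"
  where "slide a b \<epsilon> y d e \<longleftrightarrow> (I y \<otimes> \<epsilon>) \<cdot> (d \<otimes> I b) = (\<epsilon> \<otimes> I y) \<cdot> (I a \<otimes> e)"

context
  fixes a b \<epsilon> \<eta>
  assumes dp: "dual_pair a b \<epsilon> \<eta>"
begin

lemma dp_arr [simp]:
  "\<epsilon> \<in> Arr C" "Dom C \<epsilon> = a \<boxtimes> b" "Cod C \<epsilon> = Unit C"
  "\<eta> \<in> Arr C" "Dom C \<eta> = Unit C" "Cod C \<eta> = b \<boxtimes> a"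
  using dp by (auto simp: dual_pair_def hom_iff)

lemma dp_zigzag1 [simp]: "(I p \<otimes> \<epsilon> \<otimes> I (a \<boxtimes> q)) \<cdot> (I (p \<boxtimes> a) \<otimes> \<eta> \<otimes> I q) = I (p \<boxtimes> a \<boxtimes> q)"
proof -
  have "(\<epsilon> \<otimes> I a) \<cdot> (I a \<otimes> \<eta>) = I a"
    using dp by (simp add: dual_pair_def)
  from arg_cong[OF this, of "\<lambda>X. I p \<otimes> X \<otimes> I q"] show ?thesis
    by simp
qed

lemma dp_zigzag2 [simp]: "(I (p \<boxtimes> b) \<otimes> \<epsilon> \<otimes> I q) \<cdot> (I p \<otimes> \<eta> \<otimes> I (b \<boxtimes> q)) = I (p \<boxtimes> b \<boxtimes> q)"
proof -
  have "(I b \<otimes> \<epsilon>) \<cdot> (\<eta> \<otimes> I b) = I b"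
    using dp by (simp add: dual_pair_def)
  from arg_cong[OF this, of "\<lambda>X. I p \<otimes> X \<otimes> I q"] show ?thesis
    by simp
qed

text \<open>The cup moves above \<open>f\<close> by an exchange, and a zigzag remains. Together with
  \<open>unbend_down\<close> this is the bijection between maps from \<open>p\<close> to
  \<open>q \<boxtimes> a\<close> and maps from \<open>p \<boxtimes> b\<close> to \<open>q\<close>;
  its injectivity allows equations to be checked after closing a strand.\<close>

lemma unbend_right:
  assumes "f \<in> Hom C p (q \<boxtimes> a)"
  shows "(((I q \<otimes> \<epsilon>) \<cdot> (f \<otimes> I b)) \<otimes> I a) \<cdot> (I p \<otimes> \<eta>) = f"
proof -
  have [simp]: "f \<in> Arr C" "Dom C f = p" "Cod C f = q \<boxtimes> a"
    using assms by (simp_all add: hom_iff)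
  have "(f \<otimes> I (b \<boxtimes> a)) \<cdot> (I p \<otimes> \<eta>) = (I (q \<boxtimes> a) \<otimes> \<eta>) \<cdot> f"
    using exchange[of f p "q \<boxtimes> a" \<eta> "Unit C" "b \<boxtimes> a" "Unit C" "Unit C" "Unit C"]
    by (simp add: hom_iff)
  moreover have *: "(I q \<otimes> \<epsilon> \<otimes> I a) \<cdot> (I (q \<boxtimes> a) \<otimes> \<eta>) = I (q \<boxtimes> a)"
    using dp_zigzag1[of q "Unit C"] by simp
  have "(I q \<otimes> \<epsilon> \<otimes> I a) \<cdot> ((I (q \<boxtimes> a) \<otimes> \<eta>) \<cdot> f) = f"
    using cmp_tail[OF *, where k = f] by simp
  ultimately show ?thesis by simp
qed

lemma bend_right_inject:
  assumes "f \<in> Hom C p (q \<boxtimes> a)" "g \<in> Hom C p (q \<boxtimes> a)"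
    and "(I q \<otimes> \<epsilon>) \<cdot> (f \<otimes> I b) = (I q \<otimes> \<epsilon>) \<cdot> (g \<otimes> I b)"
  shows "f = g"
  using unbend_right[OF assms(1)] unbend_right[OF assms(2)] assms(3) by argo

lemma unbend_left:
  assumes "f \<in> Hom C p (b \<boxtimes> q)"
  shows "(I b \<otimes> ((\<epsilon> \<otimes> I q) \<cdot> (I a \<otimes> f))) \<cdot> (\<eta> \<otimes> I p) = f"
proof -
  have [simp]: "f \<in> Arr C" "Dom C f = p" "Cod C f = b \<boxtimes> q"
    using assms by (simp_all add: hom_iff)
  have "(I (b \<boxtimes> a) \<otimes> f) \<cdot> (\<eta> \<otimes> I p) = (\<eta> \<otimes> I (b \<boxtimes> q)) \<cdot> f"
    using exchange[of \<eta> "Unit C" "b \<boxtimes> a" f p "b \<boxtimes> q" "Unit C" "Unit C" "Unit C"]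
    by (simp add: hom_iff)
  moreover have *: "(I b \<otimes> \<epsilon> \<otimes> I q) \<cdot> (\<eta> \<otimes> I (b \<boxtimes> q)) = I (b \<boxtimes> q)"
    using dp_zigzag2[of "Unit C" q] by simp
  have "(I b \<otimes> \<epsilon> \<otimes> I q) \<cdot> ((\<eta> \<otimes> I (b \<boxtimes> q)) \<cdot> f) = f"
    using cmp_tail[OF *, where k = f] by simp
  ultimately show ?thesis by simp
qed

lemma bend_left_inject:
  assumes "f \<in> Hom C p (b \<boxtimes> q)" "g \<in> Hom C p (b \<boxtimes> q)"
    and "(\<epsilon> \<otimes> I q) \<cdot> (I a \<otimes> f) = (\<epsilon> \<otimes> I q) \<cdot> (I a \<otimes> g)"
  shows "f = g"
  using unbend_left[OF assms(1)] unbend_left[OF assms(2)] assms(3) by argo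

lemma unbend_down:
  assumes "f \<in> Hom C (p \<boxtimes> b) q"
  shows "(I q \<otimes> \<epsilon>) \<cdot> (((f \<otimes> I a) \<cdot> (I p \<otimes> \<eta>)) \<otimes> I b) = f"
proof -
  have [simp]: "f \<in> Arr C" "Dom C f = p \<boxtimes> b" "Cod C f = q"
    using assms by (simp_all add: hom_iff)
  have *: "(I q \<otimes> \<epsilon>) \<cdot> (f \<otimes> I (a \<boxtimes> b)) = f \<cdot> (I (p \<boxtimes> b) \<otimes> \<epsilon>)"
    using exchange[of f "p \<boxtimes> b" q \<epsilon> "a \<boxtimes> b" "Unit C" "Unit C" "Unit C" "Unit C"]
    by (simp add: hom_iff)
  have "(I (p \<boxtimes> b) \<otimes> \<epsilon>) \<cdot> (I p \<otimes> \<eta> \<otimes> I b) = I (p \<boxtimes> b)"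
    using dp_zigzag2[of p "Unit C"] by simp
  with cmp_tail[OF *] show ?thesis by simp
qed

lemma bend_down_inject:
  assumes "f \<in> Hom C (p \<boxtimes> b) q" "g \<in> Hom C (p \<boxtimes> b) q"
    and "(f \<otimes> I a) \<cdot> (I p \<otimes> \<eta>) = (g \<otimes> I a) \<cdot> (I p \<otimes> \<eta>)"
  shows "f = g"
  using unbend_down[OF assms(1)] unbend_down[OF assms(2)] assms(3) by argo


text \<open>The map \<open>d\<close> is \<open>e\<close> turned by 90 degrees. Closing it with
  another cap creates a zigzag, which straightens once the two caps have exchanged their
  heights.\<close>

lemma slide_mate_left:
  assumes e: "e \<in> Hom C (y \<boxtimes> b) (b \<boxtimes> y)"
    and d: "d = (\<epsilon> \<otimes> I (y \<boxtimes> a)) \<cdot> (I a \<otimes> e \<otimes> I a) \<cdot> (I (a \<boxtimes> y) \<otimes> \<eta>)"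
  shows "slide a b \<epsilon> y d e"
proof -
  have [simp]: "e \<in> Arr C" "Dom C e = y \<boxtimes> b" "Cod C e = b \<boxtimes> y"
    using e by (simp_all add: hom_iff)
  have 1: "(I y \<otimes> \<epsilon>) \<cdot> (\<epsilon> \<otimes> I (y \<boxtimes> a \<boxtimes> b)) = (\<epsilon> \<otimes> I y) \<cdot> (I (a \<boxtimes> b \<boxtimes> y) \<otimes> \<epsilon>)"
    using exchange[of \<epsilon> "a \<boxtimes> b" "Unit C" \<epsilon> "a \<boxtimes> b" "Unit C" "Unit C" y "Unit C"]
    by (simp add: hom_iff)
  have 2: "(I (a \<boxtimes> b \<boxtimes> y) \<otimes> \<epsilon>) \<cdot> (I a \<otimes> e \<otimes> I (a \<boxtimes> b)) = (I a \<otimes> e) \<cdot> (I (a \<boxtimes> y \<boxtimes> b) \<otimes> \<epsilon>)"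
    using exchange[of e "y \<boxtimes> b" "b \<boxtimes> y" \<epsilon> "a \<boxtimes> b" "Unit C" a "Unit C" "Unit C"]
    by (simp add: hom_iff)
  have 3: "(I (a \<boxtimes> y \<boxtimes> b) \<otimes> \<epsilon>) \<cdot> (I (a \<boxtimes> y) \<otimes> \<eta> \<otimes> I b) = I (a \<boxtimes> y \<boxtimes> b)"
    using dp_zigzag2[of "a \<boxtimes> y" "Unit C"] by simp
  show ?thesis
    by (simp add: slide_def d cmp_tail[OF 1] cmp_tail[OF 2] 3)
qed

text \<open>Here \<open>e\<close> is the rotation of \<open>d\<close>. Which of the two lemmas
  applies to crossings depends on which of them is expressed through the other.\<close>

lemma slide_mate_right:
  assumes d: "d \<in> Hom C (a \<boxtimes> y) (y \<boxtimes> a)"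
    and e: "e = (I (b \<boxtimes> y) \<otimes> \<epsilon>) \<cdot> (I b \<otimes> d \<otimes> I b) \<cdot> (\<eta> \<otimes> I (y \<boxtimes> b))"
  shows "slide a b \<epsilon> y d e"
proof -
  have [simp]: "d \<in> Arr C" "Dom C d = a \<boxtimes> y" "Cod C d = y \<boxtimes> a"
    using d by (simp_all add: hom_iff)
  have 1: "(I y \<otimes> \<epsilon>) \<cdot> (\<epsilon> \<otimes> I (y \<boxtimes> a \<boxtimes> b)) = (\<epsilon> \<otimes> I y) \<cdot> (I (a \<boxtimes> b \<boxtimes> y) \<otimes> \<epsilon>)"
    using exchange[of \<epsilon> "a \<boxtimes> b" "Unit C" \<epsilon> "a \<boxtimes> b" "Unit C" "Unit C" y "Unit C"]
    by (simp add: hom_iff)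
  have 2: "(\<epsilon> \<otimes> I (y \<boxtimes> a \<boxtimes> b)) \<cdot> (I (a \<boxtimes> b) \<otimes> d \<otimes> I b) = (d \<otimes> I b) \<cdot> (\<epsilon> \<otimes> I (a \<boxtimes> y \<boxtimes> b))"
    using exchange[of \<epsilon> "a \<boxtimes> b" "Unit C" d "a \<boxtimes> y" "y \<boxtimes> a" "Unit C" "Unit C" b]
    by (simp add: hom_iff)
  have 3: "(\<epsilon> \<otimes> I (a \<boxtimes> y \<boxtimes> b)) \<cdot> (I a \<otimes> \<eta> \<otimes> I (y \<boxtimes> b)) = I (a \<boxtimes> y \<boxtimes> b)"
    using dp_zigzag1[of "Unit C" "y \<boxtimes> b"] by simp
  show ?thesis
    by (simp add: slide_def e cmp_tail[OF 1[symmetric]] cmp_tail[OF 2] 3)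
qed

text \<open>Sliding through the cap implies sliding through the cup: after closing on the left with
  \<open>\<epsilon>\<close>, each side straightens to \<open>d\<close>.\<close>

lemma slide_cup:
  assumes d: "d \<in> Hom C (a \<boxtimes> y) (y \<boxtimes> a)" and e: "e \<in> Hom C (y \<boxtimes> b) (b \<boxtimes> y)"
    and s: "slide a b \<epsilon> y d e"
  shows "(I b \<otimes> d) \<cdot> (\<eta> \<otimes> I y) = (e \<otimes> I a) \<cdot> (I y \<otimes> \<eta>)"
proof (rule bend_left_inject[of _ y "y \<boxtimes> a"])
  have [simp]: "d \<in> Arr C" "Dom C d = a \<boxtimes> y" "Cod C d = y \<boxtimes> a"
    "e \<in> Arr C" "Dom C e = y \<boxtimes> b" "Cod C e = b \<boxtimes> y"
    using d e by (simp_all add: hom_iff)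
  show "(I b \<otimes> d) \<cdot> (\<eta> \<otimes> I y) \<in> Hom C y (b \<boxtimes> y \<boxtimes> a)"
    "(e \<otimes> I a) \<cdot> (I y \<otimes> \<eta>) \<in> Hom C y (b \<boxtimes> y \<boxtimes> a)"
    by (simp_all add: hom_iff)
  have 1: "(\<epsilon> \<otimes> I (y \<boxtimes> a)) \<cdot> (I (a \<boxtimes> b) \<otimes> d) = d \<cdot> (\<epsilon> \<otimes> I (a \<boxtimes> y))"
    using exchange[of \<epsilon> "a \<boxtimes> b" "Unit C" d "a \<boxtimes> y" "y \<boxtimes> a" "Unit C" "Unit C" "Unit C"]
    by (simp add: hom_iff)
  have 2: "(\<epsilon> \<otimes> I (a \<boxtimes> y)) \<cdot> (I a \<otimes> \<eta> \<otimes> I y) = I (a \<boxtimes> y)"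
    using dp_zigzag1[of "Unit C" y] by simp
  have "(\<epsilon> \<otimes> I y) \<cdot> (I a \<otimes> e) = (I y \<otimes> \<epsilon>) \<cdot> (d \<otimes> I b)"
    using s by (simp add: slide_def)
  from arg_cong[OF this, of "\<lambda>X. X \<otimes> I a"]
  have 3: "(\<epsilon> \<otimes> I (y \<boxtimes> a)) \<cdot> (I a \<otimes> e \<otimes> I a) = (I y \<otimes> \<epsilon> \<otimes> I a) \<cdot> (d \<otimes> I (b \<boxtimes> a))"
    by simp
  have 4: "(d \<otimes> I (b \<boxtimes> a)) \<cdot> (I (a \<boxtimes> y) \<otimes> \<eta>) = (I (y \<boxtimes> a) \<otimes> \<eta>) \<cdot> d"
    using exchange[of d "a \<boxtimes> y" "y \<boxtimes> a" \<eta> "Unit C" "b \<boxtimes> a" "Unit C" "Unit C" "Unit C"]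
    by (simp add: hom_iff)
  have 5: "(I y \<otimes> \<epsilon> \<otimes> I a) \<cdot> (I (y \<boxtimes> a) \<otimes> \<eta>) = I (y \<boxtimes> a)"
    using dp_zigzag1[of y "Unit C"] by simp
  show "(\<epsilon> \<otimes> I (y \<boxtimes> a)) \<cdot> (I a \<otimes> ((I b \<otimes> d) \<cdot> (\<eta> \<otimes> I y))) =
      (\<epsilon> \<otimes> I (y \<boxtimes> a)) \<cdot> (I a \<otimes> ((e \<otimes> I a) \<cdot> (I y \<otimes> \<eta>)))"
    by (simp add: cmp_tail[OF 1] 2 cmp_tail[OF 3] 4 cmp_tail[OF 5])
qed

text \<open>This is \<open>unbend_right\<close> with \<open>p\<close> the unit. In
  \<open>curl_right\<close> it recognises a twisted cup as a multiple of the straight one.\<close>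

lemma bend_kink:
  assumes "N \<in> Hom C (Unit C) (b \<boxtimes> a)"
    and "(I b \<otimes> \<epsilon>) \<cdot> (N \<otimes> I b) = k"
  shows "N = (k \<otimes> I a) \<cdot> \<eta>"
  using unbend_right[OF assms(1)] assms(2) by simp

text \<open>
  Both sides are compared after closing the strand \<open>a\<close> with \<open>\<epsilon>\<close>; pulling \<open>y\<close> and \<open>z\<close> through
  the cap replaces \<open>a\<close>, which starts on the left, by \<open>b\<close>, which starts on the right.
\<close>

lemma reidemeister3_slide:
  assumes dy: "dy \<in> Hom C (a \<boxtimes> y) (y \<boxtimes> a)" and ey: "ey \<in> Hom C (y \<boxtimes> b) (b \<boxtimes> y)"
    and dz: "dz \<in> Hom C (a \<boxtimes> z) (z \<boxtimes> a)" and ez: "ez \<in> Hom C (z \<boxtimes> b) (b \<boxtimes> z)"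
    and c: "c \<in> Hom C (y \<boxtimes> z) (z \<boxtimes> y)"
    and sy: "slide a b \<epsilon> y dy ey" and sz: "slide a b \<epsilon> z dz ez"
    and R3: "(I b \<otimes> c) \<cdot> (ey \<otimes> I z) \<cdot> (I y \<otimes> ez) = (ez \<otimes> I y) \<cdot> (I z \<otimes> ey) \<cdot> (c \<otimes> I b)"
  shows "(c \<otimes> I a) \<cdot> (I y \<otimes> dz) \<cdot> (dy \<otimes> I z) = (I z \<otimes> dy) \<cdot> (dz \<otimes> I y) \<cdot> (I a \<otimes> c)"
proof (rule bend_right_inject[of _ "a \<boxtimes> y \<boxtimes> z" "z \<boxtimes> y"])
  have [simp]: "dy \<in> Arr C" "Dom C dy = a \<boxtimes> y" "Cod C dy = y \<boxtimes> a"
    "ey \<in> Arr C" "Dom C ey = y \<boxtimes> b" "Cod C ey = b \<boxtimes> y"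
    "dz \<in> Arr C" "Dom C dz = a \<boxtimes> z" "Cod C dz = z \<boxtimes> a"
    "ez \<in> Arr C" "Dom C ez = z \<boxtimes> b" "Cod C ez = b \<boxtimes> z"
    "c \<in> Arr C" "Dom C c = y \<boxtimes> z" "Cod C c = z \<boxtimes> y"
    using dy ey dz ez c by (simp_all add: hom_iff)
  show "(c \<otimes> I a) \<cdot> (I y \<otimes> dz) \<cdot> (dy \<otimes> I z) \<in> Hom C (a \<boxtimes> y \<boxtimes> z) ((z \<boxtimes> y) \<boxtimes> a)"
    "(I z \<otimes> dy) \<cdot> (dz \<otimes> I y) \<cdot> (I a \<otimes> c) \<in> Hom C (a \<boxtimes> y \<boxtimes> z) ((z \<boxtimes> y) \<boxtimes> a)"
    by (simp_all add: hom_iff)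
  have sy': "(I y \<otimes> \<epsilon>) \<cdot> (dy \<otimes> I b) = (\<epsilon> \<otimes> I y) \<cdot> (I a \<otimes> ey)"
    and sz': "(I z \<otimes> \<epsilon>) \<cdot> (dz \<otimes> I b) = (\<epsilon> \<otimes> I z) \<cdot> (I a \<otimes> ez)"
    using sy sz by (simp_all add: slide_def)
  have 1: "(I (z \<boxtimes> y) \<otimes> \<epsilon>) \<cdot> (c \<otimes> I (a \<boxtimes> b)) = c \<cdot> (I (y \<boxtimes> z) \<otimes> \<epsilon>)"
    using exchange[of c "y \<boxtimes> z" "z \<boxtimes> y" \<epsilon> "a \<boxtimes> b" "Unit C" "Unit C" "Unit C" "Unit C"]
    by (simp add: hom_iff)
  have 2: "(I (y \<boxtimes> z) \<otimes> \<epsilon>) \<cdot> (I y \<otimes> dz \<otimes> I b) = (I y \<otimes> \<epsilon> \<otimes> I z) \<cdot> (I (y \<boxtimes> a) \<otimes> ez)"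
    using arg_cong[OF sz', of "\<lambda>X. I y \<otimes> X"] by simp
  have 3: "(I (y \<boxtimes> a) \<otimes> ez) \<cdot> (dy \<otimes> I (z \<boxtimes> b)) = (dy \<otimes> I (b \<boxtimes> z)) \<cdot> (I (a \<boxtimes> y) \<otimes> ez)"
    using exchange[of dy "a \<boxtimes> y" "y \<boxtimes> a" ez "z \<boxtimes> b" "b \<boxtimes> z" "Unit C" "Unit C" "Unit C"]
    by (simp add: hom_iff)
  have 4: "(I y \<otimes> \<epsilon> \<otimes> I z) \<cdot> (dy \<otimes> I (b \<boxtimes> z)) = (\<epsilon> \<otimes> I (y \<boxtimes> z)) \<cdot> (I a \<otimes> ey \<otimes> I z)"
    using arg_cong[OF sy', of "\<lambda>X. X \<otimes> I z"] by simp
  have 5: "c \<cdot> (\<epsilon> \<otimes> I (y \<boxtimes> z)) = (\<epsilon> \<otimes> I (z \<boxtimes> y)) \<cdot> (I (a \<boxtimes> b) \<otimes> c)"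
    using exchange[of \<epsilon> "a \<boxtimes> b" "Unit C" c "y \<boxtimes> z" "z \<boxtimes> y" "Unit C" "Unit C" "Unit C"]
    by (simp add: hom_iff)
  have L: "(I (z \<boxtimes> y) \<otimes> \<epsilon>) \<cdot> (((c \<otimes> I a) \<cdot> (I y \<otimes> dz) \<cdot> (dy \<otimes> I z)) \<otimes> I b) =
      (\<epsilon> \<otimes> I (z \<boxtimes> y)) \<cdot> (I a \<otimes> ((I b \<otimes> c) \<cdot> (ey \<otimes> I z) \<cdot> (I y \<otimes> ez)))"
    by (simp add: cmp_tail[OF 1] cmp_tail[OF 2] 3 cmp_tail[OF 4] cmp_tail[OF 5])
  have 6: "(I (z \<boxtimes> y) \<otimes> \<epsilon>) \<cdot> (I z \<otimes> dy \<otimes> I b) = (I z \<otimes> \<epsilon> \<otimes> I y) \<cdot> (I (z \<boxtimes> a) \<otimes> ey)"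
    using arg_cong[OF sy', of "\<lambda>X. I z \<otimes> X"] by simp
  have 7: "(I (z \<boxtimes> a) \<otimes> ey) \<cdot> (dz \<otimes> I (y \<boxtimes> b)) = (dz \<otimes> I (b \<boxtimes> y)) \<cdot> (I (a \<boxtimes> z) \<otimes> ey)"
    using exchange[of dz "a \<boxtimes> z" "z \<boxtimes> a" ey "y \<boxtimes> b" "b \<boxtimes> y" "Unit C" "Unit C" "Unit C"]
    by (simp add: hom_iff)
  have 8: "(I z \<otimes> \<epsilon> \<otimes> I y) \<cdot> (dz \<otimes> I (b \<boxtimes> y)) = (\<epsilon> \<otimes> I (z \<boxtimes> y)) \<cdot> (I a \<otimes> ez \<otimes> I y)"
    using arg_cong[OF sz', of "\<lambda>X. X \<otimes> I y"] by simp
  have R: "(I (z \<boxtimes> y) \<otimes> \<epsilon>) \<cdot> (((I z \<otimes> dy) \<cdot> (dz \<otimes> I y) \<cdot> (I a \<otimes> c)) \<otimes> I b) =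
      (\<epsilon> \<otimes> I (z \<boxtimes> y)) \<cdot> (I a \<otimes> ((ez \<otimes> I y) \<cdot> (I z \<otimes> ey) \<cdot> (c \<otimes> I b)))"
    by (simp add: cmp_tail[OF 6] cmp_tail[OF 7] cmp_tail[OF 8])
  show "(I (z \<boxtimes> y) \<otimes> \<epsilon>) \<cdot> (((c \<otimes> I a) \<cdot> (I y \<otimes> dz) \<cdot> (dy \<otimes> I z)) \<otimes> I b) =
      (I (z \<boxtimes> y) \<otimes> \<epsilon>) \<cdot> (((I z \<otimes> dy) \<cdot> (dz \<otimes> I y) \<cdot> (I a \<otimes> c)) \<otimes> I b)"
    unfolding L R R3 ..
qed

end

end

section \<open>Linear monoidal categories\<close>

context linear_monoidal_category begin

lemma arr_hom: "f \<in> Arr C \<Longrightarrow> f \<in> Hom C (Dom C f) (Cod C f)"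
  by (simp add: hom_iff)

sublocale strict_monoidal_category C
proof
  fix a b c :: 'o
  show "Ide C a \<in> Arr C" "Dom C (Ide C a) = a" "Cod C (Ide C a) = a"
    using ide_hom[of a] by (simp_all add: hom_iff)
  show "(a \<boxtimes> b) \<boxtimes> c = a \<boxtimes> (b \<boxtimes> c)" "Unit C \<boxtimes> a = a" "a \<boxtimes> Unit C = a"
    by (rule otensor_assoc otensor_unit_left otensor_unit_right)+
  show "Ide C a \<otimes> Ide C b = Ide C (a \<boxtimes> b)"
    by (rule tensor_ide)
next
  fix f g h :: 'm
  assume fg: "f \<in> Arr C" "g \<in> Arr C"
  show "f \<otimes> g \<in> Arr C" "Dom C (f \<otimes> g) = Dom C f \<boxtimes> Dom C g" "Cod C (f \<otimes> g) = Cod C f \<boxtimes> Cod C g"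
    using tensor_hom[OF fg[THEN arr_hom]] by (simp_all add: hom_iff)
  show "(f \<otimes> g) \<otimes> h = f \<otimes> (g \<otimes> h)" if "h \<in> Arr C"
    by (rule tensor_assoc[OF fg[THEN arr_hom] arr_hom[OF that]])
  assume eq: "Dom C g = Cod C f"
  have g: "g \<in> Hom C (Cod C f) (Cod C g)" using fg eq by (simp add: hom_iff)
  show "g \<cdot> f \<in> Arr C" "Dom C (g \<cdot> f) = Dom C f" "Cod C (g \<cdot> f) = Cod C g"
    using cmp_hom[OF arr_hom[OF fg(1)] g] by (simp_all add: hom_iff)
  show "(h \<cdot> g) \<cdot> f = h \<cdot> (g \<cdot> f)" if "h \<in> Arr C" "Dom C h = Cod C g"
    by (rule cmp_assoc[OF arr_hom[OF fg(1)] g]) (use that in \<open>simp add: hom_iff\<close>)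
next
  fix f g f' g' :: 'm
  assume "f \<in> Arr C" "g \<in> Arr C" "f' \<in> Arr C" "g' \<in> Arr C" "Dom C g = Cod C f" "Dom C g' = Cod C f'"
  then show "(g \<cdot> f) \<otimes> (g' \<cdot> f') = (g \<otimes> g') \<cdot> (f \<otimes> f')"
    by (intro interchange[of f "Dom C f" "Cod C f" g "Cod C g" f' "Dom C f'" "Cod C f'" g' "Cod C g'"])
      (simp_all add: hom_iff)
qed (auto dest: arr_hom intro: cmp_ide_right cmp_ide_left tensor_unit_left tensor_unit_right)

lemma arr_zero [simp]: "Zero C a b \<in> Arr C" "Dom C (Zero C a b) = a" "Cod C (Zero C a b) = b"
  using zero_hom[of a b] by (simp_all add: hom_iff)

lemma arr_plus [simp]:
  assumes "f \<in> Arr C" "g \<in> Arr C" "Dom C f = Dom C g" "Cod C f = Cod C g"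
  shows "f \<oplus> g \<in> Arr C" "Dom C (f \<oplus> g) = Dom C g" "Cod C (f \<oplus> g) = Cod C g"
  using plus_hom[of f "Dom C g" "Cod C g" g] assms by (simp_all add: hom_iff)

lemma arr_scale [simp]:
  assumes "f \<in> Arr C"
  shows "r \<odot> f \<in> Arr C" "Dom C (r \<odot> f) = Dom C f" "Cod C (r \<odot> f) = Cod C f"
  using scale_hom[OF arr_hom[OF assms]] assms by (simp_all add: hom_iff)

lemma distribs:
  assumes "f \<in> Arr C" "g \<in> Arr C" "Dom C f = Dom C g" "Cod C f = Cod C g" "h \<in> Arr C"
  shows "Cod C h = Dom C g \<Longrightarrow> (f \<oplus> g) \<cdot> h = (f \<cdot> h) \<oplus> (g \<cdot> h)"
    and "Dom C h = Cod C g \<Longrightarrow> h \<cdot> (f \<oplus> g) = (h \<cdot> f) \<oplus> (h \<cdot> g)"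
    and "(f \<oplus> g) \<otimes> h = (f \<otimes> h) \<oplus> (g \<otimes> h)"
    and "h \<otimes> (f \<oplus> g) = (h \<otimes> f) \<oplus> (h \<otimes> g)"
  using assms
    cmp_plus_left[of h "Dom C h" "Dom C g" f "Cod C g" g]
    cmp_plus_right[of f "Dom C g" "Cod C g" g h "Cod C h"]
    tensor_plus_left[of f "Dom C g" "Cod C g" g h "Dom C h" "Cod C h"]
    tensor_plus_right[of h "Dom C h" "Cod C h" f "Dom C g" "Cod C g" g]
  by (simp_all add: hom_iff)

lemma scales:
  assumes "g \<in> Arr C" "h \<in> Arr C"
  shows "Cod C h = Dom C g \<Longrightarrow> (r \<odot> g) \<cdot> h = r \<odot> (g \<cdot> h)"
    and "Dom C h = Cod C g \<Longrightarrow> h \<cdot> (r \<odot> g) = r \<odot> (h \<cdot> g)"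
    and "(r \<odot> g) \<otimes> h = r \<odot> (g \<otimes> h)"
    and "h \<otimes> (r \<odot> g) = r \<odot> (h \<otimes> g)"
  using assms
    cmp_scale_left[of h "Dom C h" "Dom C g" g "Cod C g"]
    cmp_scale_right[of g "Dom C g" "Cod C g" h "Cod C h"]
    tensor_scale_left[of g "Dom C g" "Cod C g" h "Dom C h" "Cod C h"]
    tensor_scale_right[of h "Dom C h" "Cod C h" g "Dom C g" "Cod C g"]
  by (simp_all add: hom_iff)

lemma scale_scale' [simp]: "f \<in> Arr C \<Longrightarrow> r \<odot> (s \<odot> f) = (r * s) \<odot> f"
  by (rule scale_scale[OF arr_hom])

lemma scale_one' [simp]: "f \<in> Arr C \<Longrightarrow> 1 \<odot> f = f"
  by (rule scale_one[OF arr_hom])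

lemma scale_plus' [simp]:
  "f \<in> Arr C \<Longrightarrow> g \<in> Arr C \<Longrightarrow> Dom C f = Dom C g \<Longrightarrow> Cod C f = Cod C g \<Longrightarrow>
    r \<odot> (f \<oplus> g) = (r \<odot> f) \<oplus> (r \<odot> g)"
  using scale_plus[of f "Dom C g" "Cod C g" g] by (simp add: hom_iff)

lemma scale_add: "g \<in> Arr C \<Longrightarrow> (r + s) \<odot> g = (r \<odot> g) \<oplus> (s \<odot> g)"
  using plus_scale[of g "Dom C g" "Cod C g"] by (simp add: hom_iff)

lemma add_assoc:
  "f \<in> Arr C \<Longrightarrow> g \<in> Arr C \<Longrightarrow> h \<in> Arr C \<Longrightarrow> Dom C f = Dom C h \<Longrightarrow> Cod C f = Cod C h \<Longrightarrow>
    Dom C g = Dom C h \<Longrightarrow> Cod C g = Cod C h \<Longrightarrow> (f \<oplus> g) \<oplus> h = f \<oplus> (g \<oplus> h)"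
  using plus_assoc[of f "Dom C h" "Cod C h" g h] by (simp add: hom_iff)

lemma add_comm:
  "f \<in> Arr C \<Longrightarrow> g \<in> Arr C \<Longrightarrow> Dom C f = Dom C g \<Longrightarrow> Cod C f = Cod C g \<Longrightarrow> f \<oplus> g = g \<oplus> f"
  using plus_comm[of f "Dom C g" "Cod C g" g] by (simp add: hom_iff)

lemma add_zero:
  assumes "f \<in> Arr C" "Dom C f = a" "Cod C f = b"
  shows "f \<oplus> Zero C a b = f" "Zero C a b \<oplus> f = f"
  using plus_zero[of f a b] plus_comm[of f a b "Zero C a b"] assms by (simp_all add: hom_iff)

lemma scale_zero_left: "f \<in> Arr C \<Longrightarrow> 0 \<odot> f = Zero C (Dom C f) (Cod C f)"
  using minus_self[OF arr_hom, of f] scale_add[of f 1 "- 1"] by (simp add: Minus_def scales)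

lemma scale_zero_right: "r \<odot> Zero C a b = Zero C a b"
  using scale_zero_left[of "Zero C a b"] scale_scale'[of "Zero C a b" r 0]
  by simp

lemma minus_eq: "f \<ominus> g = f \<oplus> ((- 1) \<odot> g)"
  by (simp add: Minus_def)

text \<open>Linear combinations along a fixed list of morphisms: an equation between morphisms then
  follows from an equation between lists of scalars, which is left to ring arithmetic.\<close>

primrec lincomb :: "'o \<Rightarrow> 'o \<Rightarrow> ('r \<times> 'm) list \<Rightarrow> 'm" where
  "lincomb a b [] = Zero C a b"
| "lincomb a b (p # ps) = (fst p \<odot> snd p) \<oplus> lincomb a b ps"

lemma lincomb_hom [simp]:
  "set fs \<subseteq> Hom C a b \<Longrightarrow> lincomb a b (zip rs fs) \<in> Arr C \<and> Dom C (lincomb a b (zip rs fs)) = a \<and>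
    Cod C (lincomb a b (zip rs fs)) = b"
proof (induction fs arbitrary: rs)
  case (Cons f fs)
  then show ?case by (cases rs) (auto simp: hom_iff)
qed simp

lemma lincomb_add:
  "length rs = length fs \<Longrightarrow> length ss = length fs \<Longrightarrow> set fs \<subseteq> Hom C a b \<Longrightarrow>
    lincomb a b (zip rs fs) \<oplus> lincomb a b (zip ss fs) = lincomb a b (zip (map2 (+) rs ss) fs)"
proof (induction fs arbitrary: rs ss)
  case Nil
  then show ?case by (simp add: add_zero)
next
  case (Cons f fs)
  then obtain r rs' s ss' where rs: "rs = r # rs'" "ss = s # ss'"
    by (metis length_Suc_conv)
  have [simp]: "f \<in> Arr C" "Dom C f = a" "Cod C f = b" "set fs \<subseteq> Hom C a b"
    using Cons.prems by (auto simp: hom_iff)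
  let ?L = "\<lambda>rs. lincomb a b (zip rs fs)"
  have [simp]: "?L rs \<in> Arr C" "Dom C (?L rs) = a" "Cod C (?L rs) = b" for rs
    using lincomb_hom[of fs a b rs] by simp_all
  have "((r \<odot> f) \<oplus> ?L rs') \<oplus> ((s \<odot> f) \<oplus> ?L ss') = (r \<odot> f) \<oplus> ((?L rs' \<oplus> (s \<odot> f)) \<oplus> ?L ss')"
    by (simp add: add_assoc)
  also have "?L rs' \<oplus> (s \<odot> f) = (s \<odot> f) \<oplus> ?L rs'"
    by (rule add_comm) simp_all
  also have "(r \<odot> f) \<oplus> (((s \<odot> f) \<oplus> ?L rs') \<oplus> ?L ss') = ((r \<odot> f) \<oplus> (s \<odot> f)) \<oplus> (?L rs' \<oplus> ?L ss')"
    by (simp add: add_assoc)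
  also have "\<dots> = ((r + s) \<odot> f) \<oplus> ?L (map2 (+) rs' ss')"
    using Cons by (simp add: scale_add rs)
  finally show ?case by (simp add: rs)
qed

lemma lincomb_scale:
  "set fs \<subseteq> Hom C a b \<Longrightarrow> r \<odot> lincomb a b (zip rs fs) = lincomb a b (zip (map ((*) r) rs) fs)"
proof (induction fs arbitrary: rs)
  case Nil
  then show ?case by (simp add: scale_zero_right)
next
  case (Cons f fs)
  then show ?case
    using lincomb_hom[of fs a b "tl rs"]
    by (cases rs) (auto simp: hom_iff distribs scales scale_zero_right)
qed

lemma expand3:
  assumes "X \<in> Hom C a a" "Y \<in> Hom C a a" "Z \<in> Hom C a a"
  shows "((p \<odot> I a) \<oplus> (p' \<odot> X)) \<cdot> ((r \<odot> I a) \<oplus> (r' \<odot> Y)) \<cdot> ((s \<odot> I a) \<oplus> (s' \<odot> Z)) =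
    ((p * r * s) \<odot> I a) \<oplus> (((p' * r * s) \<odot> X) \<oplus> (((p * r' * s) \<odot> Y) \<oplus> 
    (((p' * r' * s) \<odot> (X \<cdot> Y)) \<oplus> (((p * r * s') \<odot> Z) \<oplus> (((p' * r * s') \<odot> (X \<cdot> Z)) \<oplus> 
    (((p * r' * s') \<odot> (Y \<cdot> Z)) \<oplus> (((p' * r' * s') \<odot> (X \<cdot> Y \<cdot> Z)))))))))"
  using assms by (simp add: hom_iff distribs scales add_assoc mult_ac)

text \<open>
  If every \<open>r\<^sub>i\<close> is \<open>q\<close> or \<open>q\<^sup>-\<^sup>1\<close> and \<open>k = q + q\<^sup>-\<^sup>1\<close>, the condition on the scalars
  excludes just the case \<open>r\<^sub>1 = r\<^sub>3 \<noteq> r\<^sub>2\<close> of strands which cannot be placed at different heights.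
\<close>

lemma hecke_braid_relation:
  fixes k r1 r2 r3 b1 b2 b3 :: 'r
  assumes A: "A \<in> Hom C a a" and B: "B \<in> Hom C a a"
    and AA: "A \<cdot> A = k \<odot> A" and BB: "B \<cdot> B = k \<odot> B"
    and hex: "(A \<cdot> B \<cdot> A) \<oplus> B = (B \<cdot> A \<cdot> B) \<oplus> A"
    and r: "r1 * r3 + k * r2 = r2 * r3 + r1 * r2 + 1"
  shows "(((r3 * b3) \<odot> I a) \<oplus> ((- b3) \<odot> A)) \<cdot> (((r2 * b2) \<odot> I a) \<oplus> ((- b2) \<odot> B)) \<cdot>
      (((r1 * b1) \<odot> I a) \<oplus> ((- b1) \<odot> A)) =
    (((r1 * b1) \<odot> I a) \<oplus> ((- b1) \<odot> B)) \<cdot> (((r2 * b2) \<odot> I a) \<oplus> ((- b2) \<odot> A)) \<cdot>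
      (((r3 * b3) \<odot> I a) \<oplus> ((- b3) \<odot> B))"
proof -
  have [simp]: "A \<in> Arr C" "Dom C A = a" "Cod C A = a" "B \<in> Arr C" "Dom C B = a" "Cod C B = a"
    using A B by (simp_all add: hom_iff)
  \<comment> \<open>The word \<open>A \<cdot> B \<cdot> A\<close> is absent because the hexagon
    relation expresses it through \<open>B \<cdot> A \<cdot> B\<close>, \<open>A\<close> and
    \<open>B\<close>.\<close>
  let ?fs = "[I a, A, B, A \<cdot> B, B \<cdot> A, B \<cdot> A \<cdot> B]"
  define L where "L = (\<lambda>rs. lincomb a a (zip rs ?fs))"
  have fs: "set ?fs \<subseteq> Hom C a a" by (simp add: hom_iff)
  have I: "I a = L [1, 0, 0, 0, 0, 0]" and A: "A = L [0, 1, 0, 0, 0, 0]" 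
    and B: "B = L [0, 0, 1, 0, 0, 0]" and AB: "A \<cdot> B = L [0, 0, 0, 1, 0, 0]"
    and BA: "B \<cdot> A = L [0, 0, 0, 0, 1, 0]" and BAB: "B \<cdot> A \<cdot> B = L [0, 0, 0, 0, 0, 1]"
    by (simp_all add: L_def scale_zero_left add_zero scales)
  have add: "L rs \<oplus> L ss = L (map2 (+) rs ss)" if "length rs = 6" "length ss = 6" for rs ss
    unfolding L_def by (rule lincomb_add[OF _ _ fs]) (use that in simp_all)
  have scale: "r \<odot> L rs = L (map ((*) r) rs)" for r rs
    unfolding L_def by (rule lincomb_scale[OF fs])
  have "B \<oplus> ((- 1) \<odot> B) = Zero C a a"
    using minus_self[OF \<open>B \<in> Hom C a a\<close>] by (simp add: minus_eq)
  then have "A \<cdot> B \<cdot> A = ((A \<cdot> B \<cdot> A) \<oplus> B) \<oplus> ((- 1) \<odot> B)"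
    by (simp add: add_assoc add_zero)
  also have "\<dots> = (L [0, 0, 0, 0, 0, 1] \<oplus> L [0, 1, 0, 0, 0, 0]) \<oplus> ((- 1) \<odot> L [0, 0, 1, 0, 0, 0])"
    unfolding hex using A B BAB by simp
  also have "\<dots> = L [0, 1, - 1, 0, 0, 1]"
    by (simp add: add scale)
  finally have ABA: "A \<cdot> B \<cdot> A = L [0, 1, - 1, 0, 0, 1]" .
  have AA': "A \<cdot> A = L [0, k, 0, 0, 0, 0]" and BB': "B \<cdot> B = L [0, 0, k, 0, 0, 0]"
    unfolding AA BB by (subst A B, simp add: scale)+
  \<comment> \<open>The coefficients of \<open>A\<close> and of \<open>B\<close> agree by this
    equation times \<open>b1 * b2 * b3\<close>; the other four agree by commutativity.\<close>
  have r': "r1 * r3 = r2 * r3 + r1 * r2 + 1 - k * r2"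
    using r by (simp add: algebra_simps)
  have r'': "r1 * r3 * x = (r2 * r3 + r1 * r2 + 1 - k * r2) * x" for x
    using r' by simp
  show ?thesis
    unfolding expand3[OF \<open>A \<in> Hom C a a\<close> \<open>B \<in> Hom C a a\<close> \<open>A \<in> Hom C a a\<close>]
      expand3[OF \<open>B \<in> Hom C a a\<close> \<open>A \<in> Hom C a a\<close> \<open>B \<in> Hom C a a\<close>]
    \<comment> \<open>Products are replaced before their factors, since rewriting \<open>A\<close>
      or \<open>B\<close> first would destroy them.\<close>
    unfolding ABA BAB AA' BB'
    unfolding AB BA
    unfolding A B I
    by (simp add: add scale) (rule arg_cong[of _ _ L], use r''[of "b1 * b2 * b3"] in \<open>simp add: algebra_simps\<close>)
qed

end

section \<open>Crossings in balanced rigid categories\<close>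

lemma (in strict_monoidal_category) whisker_eq:
  "f = g \<Longrightarrow> I p \<otimes> f \<otimes> I q = I p \<otimes> g \<otimes> I q"
  by simp

context balanced_rigid_category begin

lemma ev_arr [simp]:
  "EvR C a \<in> Arr C" "Dom C (EvR C a) = a \<boxtimes> Dual C a" "Cod C (EvR C a) = Unit C"
  "EvL C a \<in> Arr C" "Dom C (EvL C a) = Dual C a \<boxtimes> a" "Cod C (EvL C a) = Unit C"
  "CoevR C a \<in> Arr C" "Dom C (CoevR C a) = Unit C" "Cod C (CoevR C a) = a \<boxtimes> Dual C a"
  "CoevL C a \<in> Arr C" "Dom C (CoevL C a) = Unit C" "Cod C (CoevL C a) = Dual C a \<boxtimes> a"
  using evr_hom[of a] evl_hom[of a] coevr_hom[of a] coevl_hom[of a] by (simp_all add: hom_iff)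

declare dual_otensor [simp] dual_unit [simp]

lemma ldual_arr [simp]:
  assumes "f \<in> Arr C"
  shows "LDual C f \<in> Arr C" "Dom C (LDual C f) = Dual C (Cod C f)" "Cod C (LDual C f) = Dual C (Dom C f)"
  using assms by (simp_all add: LDual_def Let_def)

lemma ldual_ide: "LDual C (I a) = I (Dual C a)"
  using zigzag_left_dual[of a] by (simp add: LDual_def Let_def)

lemma ldual_lin:
  assumes "f \<in> Hom C a b" "g \<in> Hom C a b"
  shows "LDual C ((r \<odot> f) \<oplus> (s \<odot> g)) = (r \<odot> LDual C f) \<oplus> (s \<odot> LDual C g)"
  using assms by (simp add: LDual_def Let_def hom_iff distribs scales)

lemma cap_cup_arr [simp]:
  "cap C u x \<in> Arr C" "Dom C (cap C u x) = strand C u x \<boxtimes> strand C u (flip x)" "Cod C (cap C u x) = Unit C"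
  "cup C u x \<in> Arr C" "Dom C (cup C u x) = Unit C" "Cod C (cup C u x) = strand C u x \<boxtimes> strand C u (flip x)"
  by (cases x; simp)+

text \<open>The cup that straightens the cap of \<open>x\<close> begins with the dual strand, hence
  the index \<open>flip x\<close>.\<close>

lemma dual_pair_strand: "dual_pair (strand C u x) (strand C u (flip x)) (cap C u x) (cup C u (flip x))"
  using zigzag_left[of u] zigzag_right[of u] zigzag_left_dual[of u] zigzag_right_dual[of u]
  by (cases x) (simp_all add: dual_pair_def hom_iff)

lemma crossing_hom:
  assumes "\<sigma>p \<in> Hom C (u \<boxtimes> u) (u \<boxtimes> u)" "\<sigma>m \<in> Hom C (u \<boxtimes> u) (u \<boxtimes> u)"
  shows "crossing C u \<sigma>p \<sigma>m s x y \<in> Hom C (strand C u x \<boxtimes> strand C u y) (strand C u y \<boxtimes> strand C u x)"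
proof -
  have "(if b then \<sigma>p else \<sigma>m) \<in> Arr C" "Dom C (if b then \<sigma>p else \<sigma>m) = u \<boxtimes> u"
    "Cod C (if b then \<sigma>p else \<sigma>m) = u \<boxtimes> u" "(if b then \<sigma>m else \<sigma>p) \<in> Arr C"
    "Dom C (if b then \<sigma>m else \<sigma>p) = u \<boxtimes> u" "Cod C (if b then \<sigma>m else \<sigma>p) = u \<boxtimes> u" for b
    using assms by (auto simp: hom_iff)
  then show ?thesis
    by (cases x; cases y) (simp_all add: hom_iff del: if_split)
qed

text \<open>In each case one of the two crossings is the other one turned by 90 degrees, which
  accounts for the change of sign; the mate lemmas then apply.\<close>

lemma crossing_slide:
  assumes "\<sigma>p \<in> Hom C (u \<boxtimes> u) (u \<boxtimes> u)" "\<sigma>m \<in> Hom C (u \<boxtimes> u) (u \<boxtimes> u)"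
  shows "slide (strand C u x) (strand C u (flip x)) (cap C u x) (strand C u y)
    (crossing C u \<sigma>p \<sigma>m s x y) (crossing C u \<sigma>p \<sigma>m (\<not> s) y (flip x))"
proof -
  let ?c = "crossing C u \<sigma>p \<sigma>m"
  define \<tau> where "\<tau> = (if s then \<sigma>p else \<sigma>m)"
  define \<tau>' where "\<tau>' = (if s then \<sigma>m else \<sigma>p)"
  have [simp]: "\<tau> \<in> Arr C" "Dom C \<tau> = u \<boxtimes> u" "Cod C \<tau> = u \<boxtimes> u"
    "\<tau>' \<in> Arr C" "Dom C \<tau>' = u \<boxtimes> u" "Cod C \<tau>' = u \<boxtimes> u"
    using assms by (auto simp: hom_iff \<tau>_def \<tau>'_def)
  have c: "?c s Up Up = \<tau>" "?c (\<not> s) Up Up = \<tau>'"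
    "?c s Down Down = LDual C \<tau>" "?c (\<not> s) Down Down = LDual C \<tau>'"
    "?c s Up Down = (ids C u Down \<otimes> ids C u Up \<otimes> cap C u Up) \<cdot> (ids C u Down \<otimes> \<tau>' \<otimes> ids C u Down) \<cdot>
      (cup C u Down \<otimes> ids C u Up \<otimes> ids C u Down)"
    "?c s Down Up = (cap C u Down \<otimes> ids C u Up \<otimes> ids C u Down) \<cdot> (ids C u Down \<otimes> \<tau>' \<otimes> ids C u Down) \<cdot>
      (ids C u Down \<otimes> ids C u Up \<otimes> cup C u Up)"
    "?c (\<not> s) Up Down = (ids C u Down \<otimes> ids C u Up \<otimes> cap C u Up) \<cdot> (ids C u Down \<otimes> \<tau> \<otimes> ids C u Down) \<cdot>
      (cup C u Down \<otimes> ids C u Up \<otimes> ids C u Down)"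
    "?c (\<not> s) Down Up = (cap C u Down \<otimes> ids C u Up \<otimes> ids C u Down) \<cdot> (ids C u Down \<otimes> \<tau> \<otimes> ids C u Down) \<cdot>
      (ids C u Down \<otimes> ids C u Up \<otimes> cup C u Up)"
    unfolding \<tau>_def \<tau>'_def by (cases s; simp)+
  note hom = crossing_hom[OF assms] and dp = dual_pair_strand
  show ?thesis
  proof (cases x; cases y)
    assume [simp]: "x = Down" "y = Up"
    show ?thesis
      by (rule slide_mate_left[OF dp]) (use hom[of "\<not> s" Up Up] in \<open>simp_all add: c hom_iff\<close>)
  next
    assume [simp]: "x = Up" "y = Up"
    show ?thesis
      by (rule slide_mate_right[OF dp]) (use hom[of s Up Up] in \<open>simp_all add: c hom_iff\<close>)
  next
    assume [simp]: "x = Down" "y = Down"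
    show ?thesis
      by (rule slide_mate_left[OF dp])
        (use hom[of "\<not> s" Down Up] in \<open>simp_all add: c hom_iff LDual_def Let_def evl_otensor coevr_otensor
            del: crossing.simps\<close>)
  next
    assume [simp]: "x = Up" "y = Down"
    \<comment> \<open>Turning the crossing with \<open>Up\<close> and \<open>Down\<close> by means
      of \<open>EvR\<close> and \<open>CoevL\<close> yields the right dual of
      \<open>\<tau>'\<close>, whereas the crossing of two downward strands is its left dual.\<close>
    have "LDual C \<tau>' = RDual C \<tau>'"
      by (rule balanced[of _ "u \<boxtimes> u" "u \<boxtimes> u"]) (simp add: hom_iff)
    then show ?thesis
      by (intro slide_mate_right[OF dp])
        (use hom[of s Up Down] in \<open>simp_all add: c hom_iff RDual_def Let_def evr_otensor coevl_otensor
          del: crossing.simps\<close>)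
  qed
qed

end

section \<open>Reidemeister moves from the MOY relations\<close>

text \<open>
  The sign \<open>s\<close> is irrelevant in \<open>crossing C u S S s x x\<close>, which is \<open>S\<close> for \<open>x = Up\<close> and its
  dual for \<open>x = Down\<close>; for antiparallel strands, \<open>crossing C u S S\<close> is \<open>S\<close> turned by 90 degrees.
  The scalars \<open>t\<close> and \<open>ti\<close> stand for \<open>q\<^sup>n\<close> and \<open>q\<^sup>-\<^sup>n\<close>, and \<open>n0\<close>, \<open>n1\<close>, \<open>n2\<close> for the quantum
  integers of \<open>n\<close>, \<open>n - 1\<close>, \<open>n - 2\<close>.
\<close>

locale moy_category = balanced_rigid_category C
  for C :: "('o, 'm, 'r::comm_ring_1) moncat" (structure) +
  fixes u :: 'o and S :: 'm and q qi t ti n0 n1 n2 :: 'r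
  assumes objects_generated: "a \<in> generated_objects C u"
    and S_hom: "S \<in> Hom C (u \<boxtimes> u) (u \<boxtimes> u)"
    and q_inv: "q * qi = 1" and t_inv: "t * ti = 1"
    and scalar_R1: "qi * t * n0 = t * n1 + 1" "q * ti * n0 = ti * n1 + 1"
    and scalar_R2: "n0 + n2 = (q + qi) * n1"
    and circle: "cap C u x \<cdot> cup C u x = n0 \<odot> Ide C (Unit C)"
    and digon: "crossing C u S S s x x \<cdot> crossing C u S S s x x = (q + qi) \<odot> crossing C u S S s x x"
    and curl: "(cap C u (flip x) \<otimes> ids C u x) \<cdot> (ids C u (flip x) \<otimes> crossing C u S S s x x) \<cdot>
      (cup C u (flip x) \<otimes> ids C u x) = n1 \<odot> ids C u x"
    and square: "(ids C u x \<otimes> cap C u x \<otimes> ids C u (flip x)) \<cdot>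
      (crossing C u S S s x x \<otimes> crossing C u S S s (flip x) (flip x)) \<cdot>
      (ids C u x \<otimes> cup C u x \<otimes> ids C u (flip x)) =
      (cup C u x \<cdot> cap C u x) \<oplus> (n2 \<odot> (ids C u x \<otimes> ids C u (flip x)))"
    and hexagon: "((S \<otimes> Ide C u) \<cdot> (Ide C u \<otimes> S) \<cdot> (S \<otimes> Ide C u)) \<oplus> (Ide C u \<otimes> S) =
      ((Ide C u \<otimes> S) \<cdot> (S \<otimes> Ide C u) \<cdot> (Ide C u \<otimes> S)) \<oplus> (S \<otimes> Ide C u)"
begin

abbreviation X where "X x \<equiv> strand C u x"

definition Sc :: "ori \<Rightarrow> 'm" where "Sc x = crossing C u S S True x x"

lemma S_crossing: "crossing C u S S s x x = Sc x"
  by (cases x) (simp_all add: Sc_def)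

lemma Sc_arr [simp]: "Sc x \<in> Arr C" "Dom C (Sc x) = X x \<boxtimes> X x" "Cod C (Sc x) = X x \<boxtimes> X x"
  using crossing_hom[OF S_hom S_hom, of True x x] by (simp_all add: Sc_def hom_iff)

text \<open>The crossing \<open>\<sigma> s\<close> is \<open>\<beta> s\<close> times
  \<open>\<rho> s - S\<close>. The factor \<open>\<beta> s\<close> normalises the first move; it
  cancels against \<open>\<beta> (\<not> s)\<close> in the second moves and occurs equally on both
  sides of the third. The proofs of these moves use only the ratio \<open>\<rho> s\<close>.\<close>

definition \<rho> :: "bool \<Rightarrow> 'r" where "\<rho> s = (if s then qi else q)"
definition \<beta> :: "bool \<Rightarrow> 'r" where "\<beta> s = (if s then t else ti)"

definition \<sigma> :: "bool \<Rightarrow> 'm" where "\<sigma> s = ((\<rho> s * \<beta> s) \<odot> I (u \<boxtimes> u)) \<oplus> ((- \<beta> s) \<odot> S)"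

lemma \<sigma>_hom: "\<sigma> s \<in> Hom C (u \<boxtimes> u) (u \<boxtimes> u)"
  using S_hom by (simp add: \<sigma>_def hom_iff)

abbreviation cr where "cr \<equiv> crossing C u (\<sigma> True) (\<sigma> False)"

lemma cr_arr [simp]: "cr s x y \<in> Arr C" "Dom C (cr s x y) = X x \<boxtimes> X y" "Cod C (cr s x y) = X y \<boxtimes> X x"
  using crossing_hom[OF \<sigma>_hom[of True] \<sigma>_hom[of False], of s x y] by (simp_all add: hom_iff)

text \<open>Downward strands get the same scalars because taking duals is linear and preserves
  identities.\<close>

lemma cr_parallel: "cr s x x = ((\<rho> s * \<beta> s) \<odot> I (X x \<boxtimes> X x)) \<oplus> ((- \<beta> s) \<odot> Sc x)"
proof (cases x)
  case Down
  have "LDual C (\<sigma> s) = ((\<rho> s * \<beta> s) \<odot> LDual C (I (u \<boxtimes> u))) \<oplus> ((- \<beta> s) \<odot> LDual C S)"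
    unfolding \<sigma>_def by (rule ldual_lin[of _ "u \<boxtimes> u" "u \<boxtimes> u"]) (use S_hom in \<open>simp_all add: hom_iff\<close>)
  with Down show ?thesis by (cases s) (simp_all add: Sc_def ldual_ide)
qed (cases s; simp add: Sc_def \<sigma>_def)

lemma dual_pairs: "dual_pair (X x) (X (flip x)) (cap C u x) (cup C u (flip x))"
  by (rule dual_pair_strand)

lemma cr_slide: "slide (X x) (X (flip x)) (cap C u x) (X y) (cr s x y) (cr (\<not> s) y (flip x))"
  by (rule crossing_slide[OF \<sigma>_hom[of True] \<sigma>_hom[of False]])

text \<open>The relation provides only curls closed on the left. Sliding turns the right curl of
  \<open>x\<close> into a cup twisted by \<open>E\<close>, which is \<open>S\<close> turned by 90
  degrees; closing one leg of this cup and sliding again gives the left curl of the reversed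
  strand.\<close>

lemma curl_right:
  "(I (X x) \<otimes> cap C u x) \<cdot> (Sc x \<otimes> I (X (flip x))) \<cdot> (I (X x) \<otimes> cup C u x) = n1 \<odot> I (X x)"
proof -
  let ?x = "X x" and ?x' = "X (flip x)"
  define E where "E = crossing C u S S False x (flip x)"
  have [simp]: "E \<in> Arr C" "Dom C E = ?x \<boxtimes> ?x'" "Cod C E = ?x' \<boxtimes> ?x"
    using crossing_hom[OF S_hom S_hom, of False x "flip x"] by (simp_all add: E_def hom_iff)
  have 1: "(I ?x \<otimes> cap C u x) \<cdot> (Sc x \<otimes> I ?x') = (cap C u x \<otimes> I ?x) \<cdot> (I ?x \<otimes> E)"
    using crossing_slide[OF S_hom S_hom, of x x True] by (simp add: slide_def Sc_def E_def)
  have 2: "(I ?x' \<otimes> cap C u x) \<cdot> (E \<otimes> I ?x') = (cap C u x \<otimes> I ?x') \<cdot> (I ?x \<otimes> Sc (flip x))"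
    using crossing_slide[OF S_hom S_hom, of x "flip x" False] by (simp add: slide_def Sc_def E_def)
  have "E \<cdot> cup C u x = ((n1 \<odot> I ?x') \<otimes> I ?x) \<cdot> cup C u (flip x)"
    by (rule bend_kink[OF dual_pairs])
      (use curl[of "flip x"] in \<open>simp_all add: hom_iff cmp_tail[OF 2] S_crossing\<close>)
  also have "\<dots> = n1 \<odot> cup C u (flip x)"
    by (simp add: scales)
  finally have 3: "E \<cdot> cup C u x = n1 \<odot> cup C u (flip x)" .
  have "(cap C u x \<otimes> I ?x) \<cdot> (I ?x \<otimes> cup C u (flip x)) = I ?x"
    using dual_pairs by (simp add: dual_pair_def)
  moreover have "(I ?x \<otimes> E) \<cdot> (I ?x \<otimes> cup C u x) = n1 \<odot> (I ?x \<otimes> cup C u (flip x))"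
    using arg_cong[OF 3, of "\<lambda>f. I ?x \<otimes> f"] by (simp add: scales)
  ultimately show ?thesis
    by (simp add: cmp_tail[OF 1] scales)
qed

section \<open>First and second Reidemeister moves\<close>

lemma scalar_R1': "\<rho> s * \<beta> s * n0 + - \<beta> s * n1 = 1"
  using scalar_R1 by (simp add: \<rho>_def \<beta>_def)

lemma cr_R1_left:
  "(cap C u (flip x) \<otimes> I (X x)) \<cdot> (I (X (flip x)) \<otimes> cr s x x) \<cdot> (cup C u (flip x) \<otimes> I (X x)) = I (X x)"
proof -
  have "(cap C u (flip x) \<otimes> I (X x)) \<cdot> (cup C u (flip x) \<otimes> I (X x)) = n0 \<odot> I (X x)"
    using arg_cong[OF circle[of "flip x"], of "\<lambda>f. f \<otimes> I (X x)"] by (simp add: scales)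
  then show ?thesis
    using curl[of x] scalar_R1'[of s]
    by (simp add: cr_parallel S_crossing distribs scales flip: scale_add)
qed

lemma cr_R1_right:
  "(I (X x) \<otimes> cap C u x) \<cdot> (cr s x x \<otimes> I (X (flip x))) \<cdot> (I (X x) \<otimes> cup C u x) = I (X x)"
proof -
  have "(I (X x) \<otimes> cap C u x) \<cdot> (I (X x) \<otimes> cup C u x) = n0 \<odot> I (X x)"
    using arg_cong[OF circle[of x], of "\<lambda>f. I (X x) \<otimes> f"] by (simp add: scales)
  then show ?thesis
    using curl_right[of x] scalar_R1'[of s]
    by (simp add: cr_parallel distribs scales flip: scale_add)
qed

lemma scalar_inverse: "\<rho> s * \<rho> (\<not> s) = 1" "\<beta> s * \<beta> (\<not> s) = 1" "\<rho> s + \<rho> (\<not> s) = q + qi"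
  using q_inv t_inv by (auto simp: \<rho>_def \<beta>_def mult.commute add.commute)

lemma cr_R2_parallel: "cr (\<not> s) x x \<cdot> cr s x x = I (X x \<boxtimes> X x)"
proof -
  have 1: "\<rho> (\<not> s) * \<beta> (\<not> s) * (\<rho> s * \<beta> s) = (\<rho> s * \<rho> (\<not> s)) * (\<beta> s * \<beta> (\<not> s))"
    by (simp only: mult_ac)
  \<comment> \<open>The coefficient of \<open>Sc x\<close>: in the product of
    \<open>\<rho> s - S\<close> and \<open>\<rho> (\<not> s) - S\<close> the quadratic term cancels
    the linear one, since the digon factor \<open>q + qi\<close> is the sum of the two
    ratios.\<close>
  have 2: "- \<beta> (\<not> s) * (\<rho> s * \<beta> s) + (\<rho> (\<not> s) * \<beta> (\<not> s) * - \<beta> s + - \<beta> (\<not> s) * - \<beta> s * (q + qi)) = 0"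
    unfolding scalar_inverse(3)[of s, symmetric] by (simp add: algebra_simps)
  have "cr (\<not> s) x x \<cdot> cr s x x =
      ((\<rho> (\<not> s) * \<beta> (\<not> s) * (\<rho> s * \<beta> s)) \<odot> I (X x \<boxtimes> X x)) \<oplus> (((- \<beta> (\<not> s) * (\<rho> s * \<beta> s)) \<odot> Sc x) \<oplus>
      (((\<rho> (\<not> s) * \<beta> (\<not> s) * - \<beta> s) \<odot> Sc x) \<oplus> ((- \<beta> (\<not> s) * - \<beta> s * (q + qi)) \<odot> Sc x)))"
    using digon[of True x] by (simp add: cr_parallel S_crossing distribs scales add_assoc mult_ac)
  also have "\<dots> = 1 \<odot> I (X x \<boxtimes> X x) \<oplus> 0 \<odot> Sc x"
    unfolding scale_add[OF Sc_arr(1), symmetric] 2 1 scalar_inverse by simp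
  finally show ?thesis
    by (simp add: scale_zero_left add_zero)
qed

text \<open>Shaped after the sum in \<open>cr_R2b\<close>: four multiples of the identity cancel
  around the cup-cap term \<open>k\<close>.\<close>

lemma add_cancel:
  assumes "f \<in> Arr C" "k \<in> Arr C" "Dom C k = Dom C f" "Cod C k = Cod C f" "r1 + r2 + r3 + r4 = 0"
  shows "(r1 \<odot> f) \<oplus> ((r2 \<odot> f) \<oplus> ((r3 \<odot> f) \<oplus> (k \<oplus> (r4 \<odot> f)))) = k"
proof -
  have "k \<oplus> (r4 \<odot> f) = (r4 \<odot> f) \<oplus> k"
    by (rule add_comm) (use assms in simp_all)
  then have "(r1 \<odot> f) \<oplus> ((r2 \<odot> f) \<oplus> ((r3 \<odot> f) \<oplus> (k \<oplus> (r4 \<odot> f)))) = ((r1 + r2 + r3 + r4) \<odot> f) \<oplus> k"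
    using assms(1-4) by (simp add: scale_add add_assoc)
  then show ?thesis
    using assms by (simp add: scale_zero_left add_zero)
qed

text \<open>The four terms close up to a circle, a right curl, a left curl and the square. The
  cup-cap term of the square has coefficient 1, and the multiples of the identity add up to
  \<open>n0 - (q + qi) * n1 + n2 = 0\<close>.\<close>

lemma cr_R2b:
  "(I (X x) \<otimes> cap C u x \<otimes> I (X (flip x))) \<cdot> (cr s x x \<otimes> cr (\<not> s) (flip x) (flip x)) \<cdot>
    (I (X x) \<otimes> cup C u x \<otimes> I (X (flip x))) = cup C u x \<cdot> cap C u x"
proof -
  let ?x = "X x" and ?x' = "X (flip x)" and ?p = "\<rho> s * \<beta> s" and ?p' = "\<rho> (\<not> s) * \<beta> (\<not> s)"
  let ?P = "I ?x \<otimes> cap C u x \<otimes> I ?x'" and ?Q = "I ?x \<otimes> cup C u x \<otimes> I ?x'"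
  have 1: "?P \<cdot> ?Q = n0 \<odot> I (?x \<boxtimes> ?x')"
    using whisker_eq[OF circle[of x], of ?x ?x'] by (simp add: scales)
  have 2: "?P \<cdot> (Sc x \<otimes> I (?x' \<boxtimes> ?x')) \<cdot> ?Q = n1 \<odot> I (?x \<boxtimes> ?x')"
    using arg_cong[OF curl_right[of x], of "\<lambda>f. f \<otimes> I ?x'"] by (simp add: scales)
  have 3: "?P \<cdot> (I (?x \<boxtimes> ?x) \<otimes> Sc (flip x)) \<cdot> ?Q = n1 \<odot> I (?x \<boxtimes> ?x')"
    using arg_cong[OF curl[of "flip x"], of "\<lambda>f. I ?x \<otimes> f"] by (simp add: scales S_crossing)
  have 4: "?P \<cdot> (Sc x \<otimes> Sc (flip x)) \<cdot> ?Q = (cup C u x \<cdot> cap C u x) \<oplus> (n2 \<odot> I (?x \<boxtimes> ?x'))"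
    using square[of x] by (simp add: S_crossing)
  have pp: "?p * ?p' = 1" "\<beta> s * \<beta> (\<not> s) = 1"
  proof -
    have "?p * ?p' = (\<rho> s * \<rho> (\<not> s)) * (\<beta> s * \<beta> (\<not> s))" by (simp only: mult_ac)
    then show "?p * ?p' = 1" "\<beta> s * \<beta> (\<not> s) = 1" by (simp_all add: scalar_inverse)
  qed
  have "?P \<cdot> (cr s x x \<otimes> cr (\<not> s) (flip x) (flip x)) \<cdot> ?Q =
      ((?p * ?p' * n0) \<odot> I (?x \<boxtimes> ?x')) \<oplus> (((- \<beta> s * ?p' * n1) \<odot> I (?x \<boxtimes> ?x')) \<oplus>
      (((?p * - \<beta> (\<not> s) * n1) \<odot> I (?x \<boxtimes> ?x')) \<oplus>
      (((\<beta> s * \<beta> (\<not> s)) \<odot> (cup C u x \<cdot> cap C u x)) \<oplus> ((\<beta> s * \<beta> (\<not> s) * n2) \<odot> I (?x \<boxtimes> ?x')))))"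
    using 1 2 3 4 by (simp add: cr_parallel distribs scales add_assoc mult_ac)
  also have "\<dots> = cup C u x \<cdot> cap C u x"
  proof -
    have "- \<beta> s * ?p' * n1 = - (\<beta> s * \<beta> (\<not> s)) * (\<rho> (\<not> s) * n1)"
      "?p * - \<beta> (\<not> s) * n1 = - (\<beta> s * \<beta> (\<not> s)) * (\<rho> s * n1)"
      by (simp_all only: mult_ac minus_mult_left[symmetric] minus_mult_right[symmetric])
    moreover have "n0 + n2 = (\<rho> s + \<rho> (\<not> s)) * n1"
      using scalar_R2 by (simp only: scalar_inverse)
    ultimately have "?p * ?p' * n0 + - \<beta> s * ?p' * n1 + ?p * - \<beta> (\<not> s) * n1 + \<beta> s * \<beta> (\<not> s) * n2 = 0"
      by (simp only: pp) (simp add: algebra_simps)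
    then show ?thesis
      by (subst add_cancel[symmetric]) (simp_all add: pp)
  qed
  finally show ?thesis .
qed

text \<open>Sliding through the cap and through the cup of \<open>R2b\<close> turns its left-hand
  side into \<open>?K\<close> closed with a cap on the left and a cup on the right. The right-hand
  side is the identity closed in the same way, and both closings are injective.\<close>

lemma cr_R2_antiparallel: "cr (\<not> s) x (flip x) \<cdot> cr s (flip x) x = I (X (flip x) \<boxtimes> X x)"
proof -
  let ?x = "X x" and ?x' = "X (flip x)" and ?K = "cr (\<not> s) x (flip x) \<cdot> cr s (flip x) x"
  have 1: "(I ?x \<otimes> cap C u x \<otimes> I ?x') \<cdot> (cr s x x \<otimes> I (?x' \<boxtimes> ?x')) =
      (cap C u x \<otimes> I (?x \<boxtimes> ?x')) \<cdot> (I ?x \<otimes> cr (\<not> s) x (flip x) \<otimes> I ?x')"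
    using arg_cong[OF cr_slide[of x x s, unfolded slide_def], of "\<lambda>f. f \<otimes> I ?x'"] by simp
  have "(I ?x \<otimes> cr (\<not> s) (flip x) (flip x)) \<cdot> (cup C u x \<otimes> I ?x') = (cr s (flip x) x \<otimes> I ?x') \<cdot> (I ?x' \<otimes> cup C u x)"
    using dual_pairs[of "flip x"] cr_slide[of "flip x" "flip x" "\<not> s"] 
    by (intro slide_cup[of "?x'" ?x "cap C u (flip x)"]) (simp_all add: hom_iff)
  from arg_cong[OF this, of "\<lambda>f. I ?x \<otimes> f"]
  have 2: "(I (?x \<boxtimes> ?x) \<otimes> cr (\<not> s) (flip x) (flip x)) \<cdot> (I ?x \<otimes> cup C u x \<otimes> I ?x') =
      (I ?x \<otimes> cr s (flip x) x \<otimes> I ?x') \<cdot> (I (?x \<boxtimes> ?x') \<otimes> cup C u x)"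
    by simp
  have 3: "cr s x x \<otimes> cr (\<not> s) (flip x) (flip x) =
      (cr s x x \<otimes> I (?x' \<boxtimes> ?x')) \<cdot> (I (?x \<boxtimes> ?x) \<otimes> cr (\<not> s) (flip x) (flip x))"
    by (rule tensor_split) simp_all
  have 4: "(cap C u x \<otimes> I (?x \<boxtimes> ?x')) \<cdot> (I ?x \<otimes> ((?K \<otimes> I ?x') \<cdot> (I ?x' \<otimes> cup C u x))) = cup C u x \<cdot> cap C u x"
    using cr_R2b[of x s] by (simp add: 3 cmp_tail[OF 1] 2 cmp_tail[OF 2])
  have 5: "(cap C u x \<otimes> I (?x \<boxtimes> ?x')) \<cdot> (I ?x \<otimes> (I ?x' \<otimes> cup C u x)) = cup C u x \<cdot> cap C u x"
    using exchange[of "cap C u x" "?x \<boxtimes> ?x'" "Unit C" "cup C u x" "Unit C" "?x \<boxtimes> ?x'" "Unit C" "Unit C" "Unit C"]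
    by (simp add: hom_iff)
  have "(?K \<otimes> I ?x') \<cdot> (I ?x' \<otimes> cup C u x) = I ?x' \<otimes> cup C u x"
    by (rule bend_left_inject[OF dual_pairs[of x], of _ "?x'" "?x \<boxtimes> ?x'"])
      (use 4 5 in \<open>simp_all add: hom_iff\<close>)
  then show ?thesis
    using dual_pairs[of "flip x"]
    by - (rule bend_down_inject[of "?x'" ?x "cap C u (flip x)" "cup C u x" _ "?x'" "?x' \<boxtimes> ?x"],
      simp_all add: hom_iff)
qed

lemma cr_R2: "cr (\<not> s) y x \<cdot> cr s x y = I (X x \<boxtimes> X y)"
  using cr_R2_parallel[of s x] cr_R2_antiparallel[of s "flip x"]
  by (cases x; cases y) simp_all

section \<open>Third Reidemeister move\<close>

definition R3 :: "bool \<Rightarrow> bool \<Rightarrow> bool \<Rightarrow> ori \<Rightarrow> ori \<Rightarrow> ori \<Rightarrow> bool" where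
  "R3 s12 s13 s23 x y z \<longleftrightarrow>
    (cr s23 y z \<otimes> I (X x)) \<cdot> (I (X y) \<otimes> cr s13 x z) \<cdot> (cr s12 x y \<otimes> I (X z)) =
    (I (X z) \<otimes> cr s12 x y) \<cdot> (cr s13 x z \<otimes> I (X y)) \<cdot> (I (X x) \<otimes> cr s23 y z)"

lemma R3_parallel:
  assumes "s12 = s23 \<longrightarrow> s13 = s12"
  shows "R3 s12 s13 s23 Up Up Up"
proof -
  have [simp]: "S \<in> Arr C" "Dom C S = u \<boxtimes> u" "Cod C S = u \<boxtimes> u"
    using S_hom by (simp_all add: hom_iff)
  have S: "Sc Up = S" by (simp add: Sc_def)
  have SS: "S \<cdot> S = (q + qi) \<odot> S" using digon[of True Up] by simp
  have 1: "cr s Up Up \<otimes> I u = ((\<rho> s * \<beta> s) \<odot> I (u \<boxtimes> u \<boxtimes> u)) \<oplus> ((- \<beta> s) \<odot> (S \<otimes> I u))" for s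
    unfolding cr_parallel by (simp add: S distribs scales)
  have 2: "I u \<otimes> cr s Up Up = ((\<rho> s * \<beta> s) \<odot> I (u \<boxtimes> u \<boxtimes> u)) \<oplus> ((- \<beta> s) \<odot> (I u \<otimes> S))" for s
    unfolding cr_parallel by (simp add: S distribs scales)
  show ?thesis
    unfolding R3_def strand.simps 1 2
  proof (rule hecke_braid_relation[where k = "q + qi"])
    show "S \<otimes> I u \<in> Hom C (u \<boxtimes> u \<boxtimes> u) (u \<boxtimes> u \<boxtimes> u)" "I u \<otimes> S \<in> Hom C (u \<boxtimes> u \<boxtimes> u) (u \<boxtimes> u \<boxtimes> u)"
      by (simp_all add: hom_iff)
    show "(S \<otimes> I u) \<cdot> (S \<otimes> I u) = (q + qi) \<odot> (S \<otimes> I u)"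
      using arg_cong[OF SS, of "\<lambda>f. f \<otimes> I u"] by (simp add: scales)
    show "(I u \<otimes> S) \<cdot> (I u \<otimes> S) = (q + qi) \<odot> (I u \<otimes> S)"
      using arg_cong[OF SS, of "\<lambda>f. I u \<otimes> f"] by (simp add: scales)
    \<comment> \<open>Since \<open>q + qi\<close> is \<open>\<rho> s13\<close> plus its inverse, the
      equation says that the product of \<open>\<rho> s13 - \<rho> s12\<close> and
      \<open>\<rho> s13 - \<rho> s23\<close> vanishes. It does, because \<open>s13\<close> agrees
      with \<open>s12\<close> or with \<open>s23\<close>.\<close>
    show "\<rho> s12 * \<rho> s23 + (q + qi) * \<rho> s13 = \<rho> s13 * \<rho> s23 + \<rho> s12 * \<rho> s13 + 1"
      using assms q_inv by (cases s12; cases s13; cases s23) (simp_all add: \<rho>_def algebra_simps)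
  qed (rule hexagon)
qed

text \<open>The strand \<open>x\<close> leaves on the left and reappears reversed on the right. Its
  two crossings are turned by 90 degrees and change sign; the crossing of \<open>y\<close> and
  \<open>z\<close> stays as it is.\<close>

lemma R3_rotate:
  assumes "R3 s23 (\<not> s12) (\<not> s13) y z (flip x)"
  shows "R3 s12 s13 s23 x y z"
  unfolding R3_def
  by (rule reidemeister3_slide[OF dual_pairs[of x], where ey = "cr (\<not> s12) y (flip x)" and ez = "cr (\<not> s13) z (flip x)"])
    (use assms cr_slide[of x] in \<open>simp_all add: hom_iff R3_def\<close>)

text \<open>
  Composition with the inverse of the crossing of \<open>y\<close> and \<open>z\<close> on both sides.  It is
  needed for the orientations in which the middle strand differs from the other two:
  they are not reached by \<open>R3_rotate\<close> from parallel strands.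
\<close>

lemma R3_swap:
  assumes "R3 s12 s13 s23 x y z"
  shows "R3 s13 s12 (\<not> s23) x z y"
proof -
  let ?x = "X x" and ?y = "X y" and ?z = "X z"
  have 1: "(cr (\<not> s23) z y \<otimes> I ?x) \<cdot> (cr s23 y z \<otimes> I ?x) = I (?y \<boxtimes> ?z \<boxtimes> ?x)"
    using arg_cong[OF cr_R2[of s23 z y], of "\<lambda>f. f \<otimes> I ?x"] by simp
  have 2: "(I ?x \<otimes> cr s23 y z) \<cdot> (I ?x \<otimes> cr (\<not> s23) z y) = I (?x \<boxtimes> ?z \<boxtimes> ?y)"
    using arg_cong[OF cr_R2[of "\<not> s23" y z], of "\<lambda>f. I ?x \<otimes> f"] by simp
  have "(cr (\<not> s23) z y \<otimes> I ?x) \<cdot> ((cr s23 y z \<otimes> I ?x) \<cdot> (I ?y \<otimes> cr s13 x z) \<cdot> (cr s12 x y \<otimes> I ?z)) \<cdot> (I ?x \<otimes> cr (\<not> s23) z y) =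
    (cr (\<not> s23) z y \<otimes> I ?x) \<cdot> ((I ?z \<otimes> cr s12 x y) \<cdot> (cr s13 x z \<otimes> I ?y) \<cdot> (I ?x \<otimes> cr s23 y z)) \<cdot> (I ?x \<otimes> cr (\<not> s23) z y)"
    using assms by (simp only: R3_def)
  then show ?thesis
    by (simp add: R3_def cmp_tail[OF 1] 2)
qed

lemma cr_R3:
  assumes "s12 = s23 \<longrightarrow> s13 = s12"
  shows "R3 s12 s13 s23 x y z"
proof -
  have UUU: "R3 a b c Up Up Up" if "a = c \<longrightarrow> b = a" for a b c
    using R3_parallel[OF that] .
  \<comment> \<open>The height condition is invariant under the change of signs in
    \<open>R3_rotate\<close>, and likewise for \<open>R3_swap\<close> below.\<close>
  have rotate: "R3 a b c (flip x) y z"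
    if R: "\<And>a b c. (a = c \<longrightarrow> b = a) \<Longrightarrow> R3 a b c y z x" and abc: "a = c \<longrightarrow> b = a" for a b c x y z
  proof (rule R3_rotate)
    show "R3 c (\<not> a) (\<not> b) y z (flip (flip x))"
      unfolding flip_flip by (rule R) (use abc in blast)
  qed
  have swap: "R3 a b c x y z"
    if "\<And>a b c. a = c \<longrightarrow> b = a \<Longrightarrow> R3 a b c x z y" "a = c \<longrightarrow> b = a" for a b c x y z
  proof -
    have "b = (\<not> c) \<longrightarrow> a = b" using that(2) by blast
    from R3_swap[OF that(1)[OF this]] show ?thesis by simp
  qed
  \<comment> \<open>Rotation moves the last orientation, reversed, to the front. The orbit of three
    parallel strands has six elements; the two alternating orientations form an orbit of their own,
    reached by \<open>swap\<close>.\<close>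
  have DUU: "R3 a b c Down Up Up" if "a = c \<longrightarrow> b = a" for a b c
    using rotate[of Up Up Up, OF R3_parallel that] by simp
  have DDU: "R3 a b c Down Down Up" if "a = c \<longrightarrow> b = a" for a b c
    using rotate[of Down Up Up, OF DUU that] by simp
  have DDD: "R3 a b c Down Down Down" if "a = c \<longrightarrow> b = a" for a b c
    using rotate[of Down Down Up, OF DDU that] by simp
  have UDD: "R3 a b c Up Down Down" if "a = c \<longrightarrow> b = a" for a b c
    using rotate[of Down Down Down, OF DDD that] by simp
  have UUD: "R3 a b c Up Up Down" if "a = c \<longrightarrow> b = a" for a b c
    using rotate[of Up Down Down, OF UDD that] by simp
  have UDU: "R3 a b c Up Down Up" if "a = c \<longrightarrow> b = a" for a b c
    using swap[of Up Up Down, OF UUD that] by simp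
  have DUD: "R3 a b c Down Up Down" if "a = c \<longrightarrow> b = a" for a b c
    using swap[of Down Down Up, OF DDU that] by simp
  show ?thesis
    using R3_parallel[OF assms] DUU[OF assms] DDU[OF assms] DDD[OF assms] UDD[OF assms]
      UUD[OF assms] UDU[OF assms] DUD[OF assms]
    by (cases x; cases y; cases z) simp_all
qed

theorem rigid_braided_untwisted_crossings:
  "rigid_braided_untwisted C u (((qi * t) \<odot> I (u \<boxtimes> u)) \<ominus> (t \<odot> S)) (((q * ti) \<odot> I (u \<boxtimes> u)) \<ominus> (ti \<odot> S))"
proof -
  have [simp]: "S \<in> Arr C" "Dom C S = u \<boxtimes> u" "Cod C S = u \<boxtimes> u"
    using S_hom by (simp_all add: hom_iff)
  have \<sigma>: "((qi * t) \<odot> I (u \<boxtimes> u)) \<ominus> (t \<odot> S) = \<sigma> True" "((q * ti) \<odot> I (u \<boxtimes> u)) \<ominus> (ti \<odot> S) = \<sigma> False"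
    by (simp_all add: \<sigma>_def \<rho>_def \<beta>_def minus_eq)
  show ?thesis
    unfolding \<sigma>
  proof
    show "a \<in> generated_objects C u" for a by (rule objects_generated)
    show "\<sigma> True \<in> Hom C (u \<boxtimes> u) (u \<boxtimes> u)" "\<sigma> False \<in> Hom C (u \<boxtimes> u) (u \<boxtimes> u)" by (rule \<sigma>_hom)+
  qed (use cr_R1_left cr_R1_right cr_R2 cr_R2b cr_R3 in \<open>simp_all add: R3_def\<close>)
qed

end

section \<open>Dual morphisms in pivotal categories\<close>

context strict_monoidal_category begin

lemma unbend_up:
  assumes dp: "dual_pair a b \<epsilon> \<eta>" and f: "f \<in> Hom C (a \<boxtimes> p) q"
  shows "(\<epsilon> \<otimes> I q) \<cdot> (I a \<otimes> ((I b \<otimes> f) \<cdot> (\<eta> \<otimes> I p))) = f"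
proof -
  note [simp] = dp_arr[OF dp]
  have [simp]: "f \<in> Arr C" "Dom C f = a \<boxtimes> p" "Cod C f = q"
    using f by (simp_all add: hom_iff)
  have *: "(\<epsilon> \<otimes> I q) \<cdot> (I (a \<boxtimes> b) \<otimes> f) = f \<cdot> (\<epsilon> \<otimes> I (a \<boxtimes> p))"
    using exchange[of \<epsilon> "a \<boxtimes> b" "Unit C" f "a \<boxtimes> p" q "Unit C" "Unit C" "Unit C"]
    by (simp add: hom_iff)
  have "(\<epsilon> \<otimes> I (a \<boxtimes> p)) \<cdot> (I a \<otimes> \<eta> \<otimes> I p) = I (a \<boxtimes> p)"
    using dp_zigzag1[OF dp, of "Unit C" p] by simp
  with cmp_tail[OF *] show ?thesis by simp
qed

text \<open>In both zigzags of the nested caps an exchange separates the cap of the second pair from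
  the cup of the first; each pair then straightens on its own.\<close>

lemma dual_pair_tensor:
  assumes 1: "dual_pair a b \<epsilon> \<eta>" and 2: "dual_pair a' b' \<epsilon>' \<eta>'"
  shows "dual_pair (a \<boxtimes> a') (b' \<boxtimes> b) (\<epsilon> \<cdot> (I a \<otimes> \<epsilon>' \<otimes> I b)) ((I b' \<otimes> \<eta> \<otimes> I a') \<cdot> \<eta>')"
proof -
  note [simp] = dp_arr[OF 1] dp_arr[OF 2]
  have a: "(I a \<otimes> \<epsilon>' \<otimes> I (b \<boxtimes> a \<boxtimes> a')) \<cdot> (I (a \<boxtimes> a' \<boxtimes> b') \<otimes> \<eta> \<otimes> I a') = (I a \<otimes> \<eta> \<otimes> I a') \<cdot> (I a \<otimes> \<epsilon>' \<otimes> I a')"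
    using exchange[of \<epsilon>' "a' \<boxtimes> b'" "Unit C" \<eta> "Unit C" "b \<boxtimes> a" a "Unit C" a'] by (simp add: hom_iff)
  have b: "(\<epsilon> \<otimes> I (a \<boxtimes> a')) \<cdot> (I a \<otimes> \<eta> \<otimes> I a') = I (a \<boxtimes> a')"
    using dp_zigzag1[OF 1, of "Unit C" a'] by simp
  have c: "(I a \<otimes> \<epsilon>' \<otimes> I a') \<cdot> (I (a \<boxtimes> a') \<otimes> \<eta>') = I (a \<boxtimes> a')"
    using dp_zigzag1[OF 2, of a "Unit C"] by simp
  have d: "(I (b' \<boxtimes> b \<boxtimes> a) \<otimes> \<epsilon>' \<otimes> I b) \<cdot> (I b' \<otimes> \<eta> \<otimes> I (a' \<boxtimes> b' \<boxtimes> b)) = (I b' \<otimes> \<eta> \<otimes> I b) \<cdot> (I b' \<otimes> \<epsilon>' \<otimes> I b)"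
    using exchange[of \<eta> "Unit C" "b \<boxtimes> a" \<epsilon>' "a' \<boxtimes> b'" "Unit C" b' "Unit C" b] by (simp add: hom_iff)
  have e: "(I (b' \<boxtimes> b) \<otimes> \<epsilon>) \<cdot> (I b' \<otimes> \<eta> \<otimes> I b) = I (b' \<boxtimes> b)"
    using dp_zigzag2[OF 1, of b' "Unit C"] by simp
  have f: "(I b' \<otimes> \<epsilon>' \<otimes> I b) \<cdot> (\<eta>' \<otimes> I (b' \<boxtimes> b)) = I (b' \<boxtimes> b)"
    using dp_zigzag2[OF 2, of "Unit C" b] by simp
  let ?\<epsilon> = "\<epsilon> \<cdot> (I a \<otimes> \<epsilon>' \<otimes> I b)" and ?\<eta> = "(I b' \<otimes> \<eta> \<otimes> I a') \<cdot> \<eta>'"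
  have "(?\<epsilon> \<otimes> I (a \<boxtimes> a')) \<cdot> (I (a \<boxtimes> a') \<otimes> ?\<eta>) = I (a \<boxtimes> a')"
    by (simp add: cmp_tail[OF a] b cmp_tail[OF b] c)
  moreover have "(I (b' \<boxtimes> b) \<otimes> ?\<epsilon>) \<cdot> (?\<eta> \<otimes> I (b' \<boxtimes> b)) = I (b' \<boxtimes> b)"
    by (simp add: cmp_tail[OF d] e cmp_tail[OF e] f)
  moreover have "?\<epsilon> \<in> Hom C ((a \<boxtimes> a') \<boxtimes> (b' \<boxtimes> b)) (Unit C)" "?\<eta> \<in> Hom C (Unit C) ((b' \<boxtimes> b) \<boxtimes> (a \<boxtimes> a'))"
    by (simp_all add: hom_iff)
  ultimately show ?thesis
    by (simp add: dual_pair_def)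
qed

lemma dual_pair_unit: "dual_pair (Unit C) (Unit C) (I (Unit C)) (I (Unit C))"
  by (simp add: dual_pair_def hom_iff)

end

text \<open>Equality of left and right duals of morphisms is not among the axioms: for diagrams it
  is the statement to be proved, and it is proved for graphs by way of
  \<open>isdual\<close>.\<close>

locale pivotal_category = strict_monoidal_category +
  assumes dual_tensor [simp]: "Dual C (a \<boxtimes> b) = Dual C b \<boxtimes> Dual C a"
    and dual_dual [simp]: "Dual C (Dual C a) = a"
    and evr_pair: "dual_pair a (Dual C a) (EvR C a) (CoevL C a)"
    and evl_pair: "dual_pair (Dual C a) a (EvL C a) (CoevR C a)"
    and evr_dual: "EvR C (Dual C a) = EvL C a"
    and evr_tensor: "EvR C (a \<boxtimes> b) = EvR C a \<cdot> (I a \<otimes> EvR C b \<otimes> I (Dual C a))"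
    and evl_tensor: "EvL C (a \<boxtimes> b) = EvL C b \<cdot> (I (Dual C b) \<otimes> EvL C a \<otimes> I b)"
begin

lemma evl_dual: "EvL C (Dual C a) = EvR C a"
  using evr_dual[of "Dual C a"] by simp

lemmas ev_arr [simp] = dp_arr[OF evr_pair] dp_arr[OF evl_pair]

text \<open>Both clauses say that \<open>f\<close> can be pulled around a cap, where it becomes
  \<open>f'\<close>. This is equivalent to \<open>f'\<close> being both the left and the right dual
  of \<open>f\<close>, but passes to composites and tensor products by pulling one factor after the
  other.\<close>

definition isdual :: "'a \<Rightarrow> 'a \<Rightarrow> 'b \<Rightarrow> 'b \<Rightarrow> bool" where
  "isdual a b f f' \<longleftrightarrow> f \<in> Hom C a b \<and> f' \<in> Hom C (Dual C b) (Dual C a) \<and>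
    EvL C b \<cdot> (I (Dual C b) \<otimes> f) = EvL C a \<cdot> (f' \<otimes> I a) \<and>
    EvR C b \<cdot> (f \<otimes> I (Dual C b)) = EvR C a \<cdot> (I a \<otimes> f')"

lemma isdual_sym: "isdual a b f f' \<Longrightarrow> isdual (Dual C b) (Dual C a) f' f"
  by (auto simp: isdual_def evl_dual evr_dual)

lemma isdual_ide: "isdual a a (I a) (I (Dual C a))"
  by (simp add: isdual_def hom_iff)

lemma isdual_cmp:
  assumes 1: "isdual a b f f'" and 2: "isdual b c g g'"
  shows "isdual a c (g \<cdot> f) (f' \<cdot> g')"
proof -
  let ?a = "Dual C a" and ?b = "Dual C b" and ?c = "Dual C c"
  have [simp]: "f \<in> Arr C" "Dom C f = a" "Cod C f = b" "f' \<in> Arr C" "Dom C f' = ?b" "Cod C f' = ?a"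
    "g \<in> Arr C" "Dom C g = b" "Cod C g = c" "g' \<in> Arr C" "Dom C g' = ?c" "Cod C g' = ?b"
    and f: "EvL C b \<cdot> (I ?b \<otimes> f) = EvL C a \<cdot> (f' \<otimes> I a)" "EvR C b \<cdot> (f \<otimes> I ?b) = EvR C a \<cdot> (I a \<otimes> f')"
    and g: "EvL C c \<cdot> (I ?c \<otimes> g) = EvL C b \<cdot> (g' \<otimes> I b)" "EvR C c \<cdot> (g \<otimes> I ?c) = EvR C b \<cdot> (I b \<otimes> g')"
    using 1 2 by (auto simp: isdual_def hom_iff)
  have 3: "(g' \<otimes> I b) \<cdot> (I ?c \<otimes> f) = (I ?b \<otimes> f) \<cdot> (g' \<otimes> I a)"
    using tensor_split[of g' f] tensor_split'[of g' f] by simp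
  have 4: "(I b \<otimes> g') \<cdot> (f \<otimes> I ?c) = (f \<otimes> I ?b) \<cdot> (I a \<otimes> g')"
    using tensor_split[of f g'] tensor_split'[of f g'] by simp
  show ?thesis
    by (simp add: isdual_def hom_iff cmp_tail[OF g(1)] cmp_tail[OF g(2)] 3 4 cmp_tail[OF f(1)] cmp_tail[OF f(2)])
qed

lemma isdual_tensor:
  assumes 1: "isdual a b f f'" and 2: "isdual c d g g'"
  shows "isdual (a \<boxtimes> c) (b \<boxtimes> d) (f \<otimes> g) (g' \<otimes> f')"
proof -
  let ?a = "Dual C a" and ?b = "Dual C b" and ?c = "Dual C c" and ?d = "Dual C d"
  have [simp]: "f \<in> Arr C" "Dom C f = a" "Cod C f = b" "f' \<in> Arr C" "Dom C f' = ?b" "Cod C f' = ?a"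
    "g \<in> Arr C" "Dom C g = c" "Cod C g = d" "g' \<in> Arr C" "Dom C g' = ?d" "Cod C g' = ?c"
    and f: "EvL C b \<cdot> (I ?b \<otimes> f) = EvL C a \<cdot> (f' \<otimes> I a)" "EvR C b \<cdot> (f \<otimes> I ?b) = EvR C a \<cdot> (I a \<otimes> f')"
    and g: "EvL C d \<cdot> (I ?d \<otimes> g) = EvL C c \<cdot> (g' \<otimes> I c)" "EvR C d \<cdot> (g \<otimes> I ?d) = EvR C c \<cdot> (I c \<otimes> g')"
    using 1 2 by (auto simp: isdual_def hom_iff)
  \<comment> \<open>The inner of the nested caps belongs to \<open>f\<close> for \<open>EvL\<close>
    and to \<open>g\<close> for \<open>EvR\<close>; hence both splittings of
    \<open>g' \<otimes> f'\<close>.\<close>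
  have fg: "f \<otimes> g = (f \<otimes> I d) \<cdot> (I a \<otimes> g)" and gf: "g' \<otimes> f' = (g' \<otimes> I ?a) \<cdot> (I ?d \<otimes> f')"
    "g' \<otimes> f' = (I ?c \<otimes> f') \<cdot> (g' \<otimes> I ?b)"
    by (rule tensor_split tensor_split', simp_all)+
  have L1: "(I ?d \<otimes> EvL C b \<otimes> I d) \<cdot> (I (?d \<boxtimes> ?b) \<otimes> f \<otimes> I d) = (I ?d \<otimes> EvL C a \<otimes> I d) \<cdot> (I ?d \<otimes> f' \<otimes> I (a \<boxtimes> d))"
    using arg_cong[OF f(1), of "\<lambda>X. I ?d \<otimes> X \<otimes> I d"] by simp
  have L2: "(I ?d \<otimes> f' \<otimes> I (a \<boxtimes> d)) \<cdot> (I (?d \<boxtimes> ?b \<boxtimes> a) \<otimes> g) = (I (?d \<boxtimes> ?a \<boxtimes> a) \<otimes> g) \<cdot> (I ?d \<otimes> f' \<otimes> I (a \<boxtimes> c))"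
    using exchange[of f' ?b ?a g c d ?d a "Unit C"] by (simp add: hom_iff)
  have L3: "(I ?d \<otimes> EvL C a \<otimes> I d) \<cdot> (I (?d \<boxtimes> ?a \<boxtimes> a) \<otimes> g) = (I ?d \<otimes> g) \<cdot> (I ?d \<otimes> EvL C a \<otimes> I c)"
    using exchange[of "EvL C a" "?a \<boxtimes> a" "Unit C" g c d ?d "Unit C" "Unit C"] by (simp add: hom_iff)
  have L4: "(g' \<otimes> I c) \<cdot> (I ?d \<otimes> EvL C a \<otimes> I c) = (I ?c \<otimes> EvL C a \<otimes> I c) \<cdot> (g' \<otimes> I (?a \<boxtimes> a \<boxtimes> c))"
    using exchange[of g' ?d ?c "EvL C a" "?a \<boxtimes> a" "Unit C" "Unit C" "Unit C" c] by (simp add: hom_iff)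
  have L: "EvL C (b \<boxtimes> d) \<cdot> (I (Dual C (b \<boxtimes> d)) \<otimes> (f \<otimes> g)) = EvL C (a \<boxtimes> c) \<cdot> ((g' \<otimes> f') \<otimes> I (a \<boxtimes> c))"
    unfolding fg gf(1) by (simp add: evl_tensor cmp_tail[OF L1] L2 cmp_tail[OF L3] cmp_tail[OF g(1)] cmp_tail[OF L4])
  have R1: "(I b \<otimes> EvR C d \<otimes> I ?b) \<cdot> (f \<otimes> I (d \<boxtimes> ?d \<boxtimes> ?b)) = (f \<otimes> I ?b) \<cdot> (I a \<otimes> EvR C d \<otimes> I ?b)"
    using exchange[of f a b "EvR C d" "d \<boxtimes> ?d" "Unit C" "Unit C" "Unit C" ?b] by (simp add: hom_iff)
  have R2: "(I a \<otimes> EvR C d \<otimes> I ?b) \<cdot> (I a \<otimes> g \<otimes> I (?d \<boxtimes> ?b)) = (I a \<otimes> EvR C c \<otimes> I ?b) \<cdot> (I (a \<boxtimes> c) \<otimes> g' \<otimes> I ?b)"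
    using arg_cong[OF g(2), of "\<lambda>X. I a \<otimes> X \<otimes> I ?b"] by simp
  have R3: "(I a \<otimes> f') \<cdot> (I a \<otimes> EvR C c \<otimes> I ?b) = (I a \<otimes> EvR C c \<otimes> I ?a) \<cdot> (I (a \<boxtimes> c \<boxtimes> ?c) \<otimes> f')"
    using exchange[of "EvR C c" "c \<boxtimes> ?c" "Unit C" f' ?b ?a a "Unit C" "Unit C"] by (simp add: hom_iff)
  have R: "EvR C (b \<boxtimes> d) \<cdot> ((f \<otimes> g) \<otimes> I (Dual C (b \<boxtimes> d))) = EvR C (a \<boxtimes> c) \<cdot> (I (a \<boxtimes> c) \<otimes> (g' \<otimes> f'))"
    unfolding fg gf(2) by (simp add: evr_tensor cmp_tail[OF R1] R2 cmp_tail[OF f(2)] cmp_tail[OF R3])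
  show ?thesis
    using L R by (simp add: isdual_def hom_iff)
qed

lemma isdual_unique:
  assumes "isdual a b f f'"
  shows "LDual C f = f'" "RDual C f = f'"
proof -
  let ?a = "Dual C a" and ?b = "Dual C b"
  have [simp]: "f \<in> Arr C" "Dom C f = a" "Cod C f = b" "f' \<in> Arr C" "Dom C f' = ?b" "Cod C f' = ?a"
    and f: "EvL C b \<cdot> (I ?b \<otimes> f) = EvL C a \<cdot> (f' \<otimes> I a)" "EvR C b \<cdot> (f \<otimes> I ?b) = EvR C a \<cdot> (I a \<otimes> f')"
    using assms by (auto simp: isdual_def hom_iff)
  have 1: "(EvL C b \<otimes> I ?a) \<cdot> (I ?b \<otimes> f \<otimes> I ?a) = (EvL C a \<otimes> I ?a) \<cdot> (f' \<otimes> I (a \<boxtimes> ?a))"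
    using arg_cong[OF f(1), of "\<lambda>X. X \<otimes> I ?a"] by simp
  show "LDual C f = f'"
    using unbend_right[OF evl_pair, of f' ?b "Unit C" a]
    by (simp add: LDual_def Let_def cmp_tail[OF 1] hom_iff)
  have 2: "(I ?a \<otimes> EvR C b) \<cdot> (I ?a \<otimes> f \<otimes> I ?b) = (I ?a \<otimes> EvR C a) \<cdot> (I (?a \<boxtimes> a) \<otimes> f')"
    using arg_cong[OF f(2), of "\<lambda>X. I ?a \<otimes> X"] by simp
  show "RDual C f = f'"
    using unbend_left[OF evr_pair, of f' ?b a "Unit C"]
    by (simp add: RDual_def Let_def cmp_tail[OF 2] hom_iff)
qed

text \<open>Meant for the vertices: plane isotopy specifies them by their two rotations, not by
  pulling them around caps.\<close>

lemma isdualI: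
  assumes f: "f \<in> Hom C a b" and "LDual C f = f'" "RDual C f = f'"
  shows "isdual a b f f'"
proof -
  have [simp]: "f \<in> Arr C" "Dom C f = a" "Cod C f = b"
    using f by (simp_all add: hom_iff)
  have L: "f' = (EvL C b \<otimes> I (Dual C a)) \<cdot> (I (Dual C b) \<otimes> f \<otimes> I (Dual C a)) \<cdot> (I (Dual C b) \<otimes> CoevR C a)"
    using assms(2) by (simp add: LDual_def Let_def)
  have R: "f' = (I (Dual C a) \<otimes> EvR C b) \<cdot> (I (Dual C a) \<otimes> f \<otimes> I (Dual C b)) \<cdot> (CoevL C a \<otimes> I (Dual C b))"
    using assms(3) by (simp add: RDual_def Let_def)
  have f' [simp]: "f' \<in> Arr C" "Dom C f' = Dual C b" "Cod C f' = Dual C a"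
    by (simp_all add: L)
  have "((EvL C b \<cdot> (I (Dual C b) \<otimes> f)) \<otimes> I (Dual C a)) \<cdot> (I (Dual C b) \<otimes> CoevR C a) = f'"
    unfolding L by simp
  then have 1: "EvL C b \<cdot> (I (Dual C b) \<otimes> f) = EvL C a \<cdot> (f' \<otimes> I a)"
    using unbend_down[OF evl_pair, of "EvL C b \<cdot> (I (Dual C b) \<otimes> f)" "Dual C b" a "Unit C"]
    by (simp only: hom_iff) simp
  have "(I (Dual C a) \<otimes> (EvR C b \<cdot> (f \<otimes> I (Dual C b)))) \<cdot> (CoevL C a \<otimes> I (Dual C b)) = f'"
    unfolding R by simp
  then have 2: "EvR C b \<cdot> (f \<otimes> I (Dual C b)) = EvR C a \<cdot> (I a \<otimes> f')"
    using unbend_up[OF evr_pair, of "EvR C b \<cdot> (f \<otimes> I (Dual C b))" a "Dual C b" "Unit C"]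
    by (simp only: hom_iff) simp
  show ?thesis
    using 1 2 by (simp add: isdual_def hom_iff)
qed

end

section \<open>Quotients by tensor ideals\<close>

locale tensor_ideal_quotient = balanced_rigid_category C
  for C :: "('o, 'm, 'r::comm_ring_1) moncat" (structure) +
  fixes R :: "('m \<times> 'm) set"
  assumes relations_parallel: "(f, g) \<in> R \<Longrightarrow>
    f \<in> Arr C \<and> g \<in> Arr C \<and> Dom C f = Dom C g \<and> Cod C f = Cod C g"
begin

abbreviation J where "J \<equiv> tensor_ideal C R"
abbreviation Q where "Q \<equiv> quotient_category C J"
abbreviation cls where "cls \<equiv> coset C J"

section \<open>Congruence modulo the tensor ideal\<close>

definition rel :: "'m \<Rightarrow> 'm \<Rightarrow> bool" where
  "rel f g \<longleftrightarrow> f \<in> Arr C \<and> g \<in> Arr C \<and> Dom C f = Dom C g \<and> Cod C f = Cod C g \<and> f \<ominus> g \<in> J"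

lemma rel_refl: "f \<in> Arr C \<Longrightarrow> rel f f"
  using minus_self[OF arr_hom, of f] tensor_ideal.zero[of C "Dom C f" "Cod C f" R]
  by (simp add: rel_def)

lemma rel_sym: 
  assumes "rel f g" shows "rel g f"
proof -
  have fg [simp]: "f \<in> Arr C" "g \<in> Arr C" "Dom C f = Dom C g" "Cod C f = Cod C g" and J: "f \<ominus> g \<in> J"
    using assms by (auto simp: rel_def)
  have "g \<ominus> f = (- 1) \<odot> (f \<ominus> g)"
    using add_comm[of g "(- 1) \<odot> f"] by (simp add: minus_eq)
  with tensor_ideal.scale[OF J, of "- 1"] show ?thesis
    by (simp add: rel_def)
qed

lemma rel_trans:
  assumes "rel f g" "rel g h" shows "rel f h"
proof -
  have [simp]: "f \<in> Arr C" "g \<in> Arr C" "h \<in> Arr C" "Dom C f = Dom C h" "Cod C f = Cod C h"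
    "Dom C g = Dom C h" "Cod C g = Cod C h" and J: "f \<ominus> g \<in> J" "g \<ominus> h \<in> J"
    using assms by (auto simp: rel_def)
  have "((- 1) \<odot> g) \<oplus> g = Zero C (Dom C h) (Cod C h)"
    using add_comm[of "(- 1) \<odot> g" g] minus_self[OF arr_hom, of g] by (simp add: minus_eq)
  then have "((- 1) \<odot> g) \<oplus> (g \<oplus> ((- 1) \<odot> h)) = (- 1) \<odot> h"
    by (simp add: add_zero flip: add_assoc)
  then have "(f \<ominus> g) \<oplus> (g \<ominus> h) = f \<ominus> h"
    by (simp add: minus_eq add_assoc)
  with tensor_ideal.plus[OF J] show ?thesis
    by (simp add: rel_def minus_eq)
qed

lemma coset_eq: "f \<in> Arr C \<Longrightarrow> cls f = {g. rel g f}"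
  by (auto simp: coset_def rel_def hom_iff)

lemma coset_eq_iff:
  assumes "f \<in> Arr C" "g \<in> Arr C"
  shows "cls f = cls g \<longleftrightarrow> rel f g"
  unfolding coset_eq[OF assms(1)] coset_eq[OF assms(2)] set_eq_iff mem_Collect_eq
  using rel_refl[OF assms(1)] by (blast intro: rel_trans rel_sym)

lemma rel_coset_eq: "rel f g \<Longrightarrow> cls f = cls g"
  using coset_eq_iff by (auto simp: rel_def)

lemma rel_rep: "f \<in> Arr C \<Longrightarrow> rel (rep (cls f)) f"
  unfolding rep_def using rel_refl[of f] someI[of "\<lambda>g. g \<in> cls f" f] by (simp add: coset_eq)

lemma rep_simps:
  assumes "f \<in> Arr C"
  shows "rep (cls f) \<in> Arr C" "Dom C (rep (cls f)) = Dom C f" "Cod C (rep (cls f)) = Cod C f"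
  using rel_rep[OF assms] by (auto simp: rel_def)

lemma rel_cmp:
  assumes "rel f f'" "rel g g'" "Dom C g = Cod C f" shows "rel (g \<cdot> f) (g' \<cdot> f')"
proof (rule rel_trans)
  have [simp]: "f \<in> Arr C" "f' \<in> Arr C" "g \<in> Arr C" "g' \<in> Arr C" "Dom C f = Dom C f'" "Dom C g = Cod C f'"
    "Dom C g' = Cod C f'" "Cod C f = Cod C f'" "Cod C g = Cod C g'" and J: "f \<ominus> f' \<in> J" "g \<ominus> g' \<in> J"
    using assms by (auto simp: rel_def)
  have "(g \<ominus> g') \<cdot> f = (g \<cdot> f) \<ominus> (g' \<cdot> f)" by (simp add: minus_eq distribs scales)
  with tensor_ideal.cmp_right[OF J(2), of f] show "rel (g \<cdot> f) (g' \<cdot> f)"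
    by (simp add: rel_def minus_eq)
  have "g' \<cdot> (f \<ominus> f') = (g' \<cdot> f) \<ominus> (g' \<cdot> f')" by (simp add: minus_eq distribs scales)
  with tensor_ideal.cmp_left[OF J(1), of g'] show "rel (g' \<cdot> f) (g' \<cdot> f')"
    by (simp add: rel_def minus_eq)
qed

lemma rel_tensor:
  assumes "rel f f'" "rel g g'" shows "rel (f \<otimes> g) (f' \<otimes> g')"
proof (rule rel_trans)
  have [simp]: "f \<in> Arr C" "f' \<in> Arr C" "g \<in> Arr C" "g' \<in> Arr C" "Dom C f = Dom C f'" "Dom C g = Dom C g'"
    "Cod C f = Cod C f'" "Cod C g = Cod C g'" and J: "f \<ominus> f' \<in> J" "g \<ominus> g' \<in> J"
    using assms by (auto simp: rel_def)
  have "(f \<ominus> f') \<otimes> g = (f \<otimes> g) \<ominus> (f' \<otimes> g)" by (simp add: minus_eq distribs scales)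
  with tensor_ideal.tensor_right[OF J(1), of g] show "rel (f \<otimes> g) (f' \<otimes> g)"
    by (simp add: rel_def minus_eq)
  have "f' \<otimes> (g \<ominus> g') = (f' \<otimes> g) \<ominus> (f' \<otimes> g')" by (simp add: minus_eq distribs scales)
  with tensor_ideal.tensor_left[OF J(2), of f'] show "rel (f' \<otimes> g) (f' \<otimes> g')"
    by (simp add: rel_def minus_eq)
qed

lemma rel_plus:
  assumes "rel f f'" "rel g g'" "Dom C f = Dom C g" "Cod C f = Cod C g" shows "rel (f \<oplus> g) (f' \<oplus> g')"
proof -
  have [simp]: "f \<in> Arr C" "f' \<in> Arr C" "g \<in> Arr C" "g' \<in> Arr C" "Dom C f = Dom C g'" "Dom C g = Dom C g'"
    "Cod C f = Cod C g'" "Cod C g = Cod C g'" "Dom C f' = Dom C g'" "Cod C f' = Cod C g'"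
    and J: "f \<ominus> f' \<in> J" "g \<ominus> g' \<in> J"
    using assms by (auto simp: rel_def)
  have "((- 1) \<odot> f') \<oplus> (g \<oplus> ((- 1) \<odot> g')) = g \<oplus> (((- 1) \<odot> f') \<oplus> ((- 1) \<odot> g'))"
    using add_comm[of g "(- 1) \<odot> f'"] by (simp flip: add_assoc)
  then have "(f \<ominus> f') \<oplus> (g \<ominus> g') = (f \<oplus> g) \<ominus> (f' \<oplus> g')"
    by (simp add: minus_eq add_assoc)
  with tensor_ideal.plus[OF J] show ?thesis
    by (simp add: rel_def minus_eq)
qed

lemma rel_scale:
  assumes "rel f f'" shows "rel (r \<odot> f) (r \<odot> f')"
proof -
  have [simp]: "f \<in> Arr C" "f' \<in> Arr C" "Dom C f = Dom C f'" "Cod C f = Cod C f'" and J: "f \<ominus> f' \<in> J"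
    using assms by (auto simp: rel_def)
  have "r \<odot> (f \<ominus> f') = (r \<odot> f) \<ominus> (r \<odot> f')" by (simp add: minus_eq)
  with tensor_ideal.scale[OF J] show ?thesis
    by (simp add: rel_def minus_eq)
qed

section \<open>Operations of the quotient on classes\<close>

lemma Q_simps [simp]:
  "Ide Q a = cls (I a)" "Unit Q = Unit C" "OTensor Q = OTensor C" "Zero Q a b = cls (Zero C a b)"
  "Dual Q = Dual C" "EvR Q a = cls (EvR C a)" "EvL Q a = cls (EvL C a)"
  "CoevR Q a = cls (CoevR C a)" "CoevL Q a = cls (CoevL C a)"
  by (simp_all add: quotient_category_def)

lemma Q_cls [simp]:
  assumes "f \<in> Arr C"
  shows "cls f \<in> Arr Q" "Dom Q (cls f) = Dom C f" "Cod Q (cls f) = Cod C f" "r \<odot>\<^bsub>Q\<^esub> cls f = cls (r \<odot> f)"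
  using assms by (auto simp: quotient_category_def rep_simps intro!: rel_coset_eq rel_scale rel_rep)

lemma Q_tensor [simp]: "f \<in> Arr C \<Longrightarrow> g \<in> Arr C \<Longrightarrow> cls f \<otimes>\<^bsub>Q\<^esub> cls g = cls (f \<otimes> g)"
  by (auto simp: quotient_category_def intro!: rel_coset_eq rel_tensor rel_rep)

lemma Q_cmp [simp]:
  "f \<in> Arr C \<Longrightarrow> g \<in> Arr C \<Longrightarrow> Dom C g = Cod C f \<Longrightarrow> cls g \<cdot>\<^bsub>Q\<^esub> cls f = cls (g \<cdot> f)"
  by (auto simp: quotient_category_def rep_simps intro!: rel_coset_eq rel_cmp rel_rep)

lemma Q_plus [simp]:
  "f \<in> Arr C \<Longrightarrow> g \<in> Arr C \<Longrightarrow> Dom C f = Dom C g \<Longrightarrow> Cod C f = Cod C g \<Longrightarrow> cls f \<oplus>\<^bsub>Q\<^esub> cls g = cls (f \<oplus> g)"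
  by (auto simp: quotient_category_def rep_simps intro!: rel_coset_eq rel_plus rel_rep)

lemma Q_minus [simp]:
  "f \<in> Arr C \<Longrightarrow> g \<in> Arr C \<Longrightarrow> Dom C f = Dom C g \<Longrightarrow> Cod C f = Cod C g \<Longrightarrow> cls f \<ominus>\<^bsub>Q\<^esub> cls g = cls (f \<ominus> g)"
  by (simp add: Minus_def)

lemma Q_hom: "F \<in> Hom Q a b \<longleftrightarrow> (\<exists>f. F = cls f \<and> f \<in> Arr C \<and> Dom C f = a \<and> Cod C f = b)"
proof -
  have "F \<in> Arr Q \<longleftrightarrow> (\<exists>f. F = cls f \<and> f \<in> Arr C)"
    by (auto simp: quotient_category_def)
  then show ?thesis
    by (auto simp: hom_iff)
qed

lemma Q_homE:
  assumes "F \<in> Hom Q a b"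
  obtains f where "F = cls f" "f \<in> Arr C" "Dom C f = a" "Cod C f = b"
  using assms by (auto simp: Q_hom)

lemma cls_hom [simp]: "f \<in> Arr C \<Longrightarrow> Dom C f = a \<Longrightarrow> Cod C f = b \<Longrightarrow> cls f \<in> Hom Q a b"
  by (simp add: hom_iff)

lemma Q_ldual [simp]: "f \<in> Arr C \<Longrightarrow> LDual Q (cls f) = cls (LDual C f)"
  by (simp add: LDual_def Let_def)

lemma Q_rdual [simp]: "f \<in> Arr C \<Longrightarrow> RDual Q (cls f) = cls (RDual C f)"
  by (simp add: RDual_def Let_def)

text \<open>Every morphism of the quotient is a class and all operations commute with taking
  classes, so each axiom becomes the class of the same axiom in \<open>C\<close>.\<close>

lemma quotient_linear_monoidal: "linear_monoidal_category Q"
proof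
  show "F \<oplus>\<^bsub>Q\<^esub> G = G \<oplus>\<^bsub>Q\<^esub> F" if FG: "F \<in> Hom Q a b" "G \<in> Hom Q a b" for F G a b
  proof -
    obtain f where "F = cls f" "f \<in> Arr C" "Dom C f = a" "Cod C f = b" using FG(1) by (rule Q_homE)
    moreover obtain g where "G = cls g" "g \<in> Arr C" "Dom C g = a" "Cod C g = b" using FG(2) by (rule Q_homE)
    ultimately show ?thesis using add_comm[of f g] by simp
  qed
  show "F \<ominus>\<^bsub>Q\<^esub> F = Zero Q a b" if F: "F \<in> Hom Q a b" for F a b
    using F by (rule Q_homE) (use minus_self[OF arr_hom] in simp)
qed (((elim Q_homE)?, simp add: cmp_tensor_cmp distribs scales scale_add add_assoc add_zero)+)

lemma quotient_balanced_rigid: "balanced_rigid_category Q"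
proof -
  interpret Q: linear_monoidal_category Q by (rule quotient_linear_monoidal)
  show ?thesis
  proof
    show "EvR Q a \<in> Hom Q (a \<boxtimes>\<^bsub>Q\<^esub> Dual Q a) (Unit Q)" "EvL Q a \<in> Hom Q (Dual Q a \<boxtimes>\<^bsub>Q\<^esub> a) (Unit Q)"
      "CoevR Q a \<in> Hom Q (Unit Q) (a \<boxtimes>\<^bsub>Q\<^esub> Dual Q a)" "CoevL Q a \<in> Hom Q (Unit Q) (Dual Q a \<boxtimes>\<^bsub>Q\<^esub> a)" for a
      by simp_all
    show "LDual Q F = RDual Q F" if "F \<in> Hom Q a b" for F a b
      using that balanced[OF arr_hom] by (auto simp: Q_hom)
  qed (simp_all add: zigzag_left zigzag_right zigzag_left_dual zigzag_right_dual
      evr_unit evl_unit coevr_unit coevl_unit evr_otensor evl_otensor coevr_otensor coevl_otensor)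
qed

lemma relation_holds: "(f, g) \<in> R \<Longrightarrow> cls f = cls g"
  using relations_parallel[of f g] tensor_ideal.gen[of f g R C]
  by (intro rel_coset_eq) (auto simp: rel_def)

lemma Q_strand [simp]: "strand Q u x = strand C u x"
  by (cases x) simp_all

lemma Q_cap [simp]: "cap Q u x = cls (cap C u x)" "cup Q u x = cls (cup C u x)"
  by (cases x; simp)+

end

section \<open>The pivotal category of diagrams\<close>

abbreviation "did es \<equiv> abs_diagram (WId es)"
abbreviation "dcap e \<equiv> abs_diagram (WCap e)"
abbreviation "dcup e \<equiv> abs_diagram (WCup e)"

text \<open>
  All words are admitted, also those which compose words with different boundaries: of the laws of a
  strict monoidal category, only the interchange law needs matching boundaries.  The linear
  structure is a dummy.
\<close>

definition DIA :: "(edge list, diagram, unit) moncat"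
  where "DIA = \<lparr>
    Arr = UNIV,
    Dom = dsrc,
    Cod = dtgt,
    Ide = (\<lambda>a. abs_diagram (WId a)),
    Cmp = dcomp,
    Unit = [],
    OTensor = (@),
    Tensor = dtens,
    Zero = (\<lambda>a b. abs_diagram (WId a)),
    Plus = (\<lambda>f g. f),
    Scale = (\<lambda>r f. f),
    Dual = dual_edges,
    EvR = (\<lambda>a. abs_diagram (wevr a)),
    EvL = (\<lambda>a. abs_diagram (wevl a)),
    CoevR = (\<lambda>a. abs_diagram (wcoevr a)),
    CoevL = (\<lambda>a. abs_diagram (wcoevl a))\<rparr>"

lemma DIA_simps:
  "Arr DIA = UNIV" "Dom DIA = dsrc" "Cod DIA = dtgt" "Ide DIA a = did a" "Cmp DIA = dcomp" "Unit DIA = []"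
  "OTensor DIA = (@)" "Tensor DIA = dtens" "Dual DIA = dual_edges" "EvR DIA a = abs_diagram (wevr a)"
  "EvL DIA a = abs_diagram (wevl a)" "CoevR DIA a = abs_diagram (wcoevr a)" "CoevL DIA a = abs_diagram (wcoevl a)"
  by (simp_all add: DIA_def)

lemma abs_ops:
  "dcomp (abs_diagram g) (abs_diagram f) = abs_diagram (WComp g f)"
  "dtens (abs_diagram g) (abs_diagram f) = abs_diagram (WTens g f)"
  "dsrc (abs_diagram f) = wsrc f" "dtgt (abs_diagram f) = wtgt f"
  by (simp_all add: dcomp.abs_eq dtens.abs_eq dsrc.abs_eq dtgt.abs_eq)

lemma abs_eq: "abs_diagram f = abs_diagram g \<longleftrightarrow> isotopic f g"
  by (rule diagram.abs_eq_iff)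

lemma dsrc_dtgt [simp]:
  "dsrc (dcomp g f) = dsrc f" "dtgt (dcomp g f) = dtgt g"
  "dsrc (dtens f g) = dsrc f @ dsrc g" "dtgt (dtens f g) = dtgt f @ dtgt g"
  by (transfer; simp)+

lemma dsrc_dtgt_abs [simp]: "dsrc (abs_diagram f) = wsrc f" "dtgt (abs_diagram f) = wtgt f"
  by (simp_all add: abs_ops)

lemma diagram_laws:
  "dsrc g = dtgt f \<Longrightarrow> dsrc g' = dtgt f' \<Longrightarrow> dtens (dcomp g f) (dcomp g' f') = dcomp (dtens g g') (dtens f f')"
  "dcomp (dcomp h g) f = dcomp h (dcomp g f)"
  "dsrc f = a \<Longrightarrow> dcomp f (did a) = f"
  "dtgt f = a \<Longrightarrow> dcomp (did a) f = f"
  "dtens (dtens f g) h = dtens f (dtens g h)"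
  "dtens (did []) f = f"
  "dtens f (did []) = f"
  "dtens (did a) (did b) = did (a @ b)"
         apply (transfer, rule isotopic.interchange, simp, simp)
        apply (transfer, rule isotopic.comp_assoc)
       apply (transfer, use isotopic.comp_id_right in blast)
      apply (transfer, use isotopic.comp_id_left in blast)
     apply (transfer, rule isotopic.tens_assoc)
    apply (transfer, rule isotopic.tens_unit_left)
   apply (transfer, rule isotopic.tens_unit_right)
  apply (simp only: abs_ops abs_eq, rule isotopic.tens_id)
  done

interpretation DIA: strict_monoidal_category DIA
  by unfold_locales
    (simp_all only: DIA_simps UNIV_I dsrc_dtgt_abs dsrc_dtgt wsrc.simps wtgt.simps append_assoc
      append_Nil append_Nil2 diagram_laws)

abbreviation dia_cmp (infixr "\<bullet>" 70) where "g \<bullet> f \<equiv> Cmp DIA g f"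
abbreviation dia_tensor (infixr "\<otimes>\<^sub>D" 80) where "f \<otimes>\<^sub>D g \<equiv> Tensor DIA f g"
abbreviation dia_otensor (infixr "\<boxtimes>\<^sub>D" 80) where "a \<boxtimes>\<^sub>D b \<equiv> OTensor DIA a b"

lemma arr_DIA [simp]: "f \<in> Arr DIA"
  by (simp add: DIA_simps)

text \<open>Induction on lists in the vocabulary of the monoidal category, so that the normalisation
  rules for \<open>Unit\<close> and \<open>OTensor\<close> apply in place of those for
  lists.\<close>

lemma edges_induct [case_names Unit edge]:
  assumes "P (Unit DIA)" "\<And>e es. P es \<Longrightarrow> P ([e] \<boxtimes>\<^sub>D es)"
  shows "P es"
  using assms by (induction es) (simp_all add: DIA_simps)

lemma dual_DIA:
  "Dual DIA (Unit DIA) = Unit DIA" "Dual DIA [e] = [flip_edge e]"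
  "Dual DIA (a \<boxtimes>\<^sub>D b) = Dual DIA b \<boxtimes>\<^sub>D Dual DIA a" "Dual DIA (Dual DIA a) = a"
  by (simp_all add: DIA_simps dual_edges_def rev_map o_def)

lemma cap_cup_DIA [simp]:
  "Dom DIA (dcap e) = [e] \<boxtimes>\<^sub>D [flip_edge e]" "Cod DIA (dcap e) = Unit DIA"
  "Dom DIA (dcup e) = Unit DIA" "Cod DIA (dcup e) = [e] \<boxtimes>\<^sub>D [flip_edge e]"
  by (simp_all add: DIA_simps)

lemma nested_Unit:
  "EvR DIA (Unit DIA) = DIA.I (Unit DIA)" "EvL DIA (Unit DIA) = DIA.I (Unit DIA)"
  "CoevR DIA (Unit DIA) = DIA.I (Unit DIA)" "CoevL DIA (Unit DIA) = DIA.I (Unit DIA)"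
  by (simp_all add: DIA_simps)

lemma nested_edge:
  "EvR DIA ([e] \<boxtimes>\<^sub>D es) = dcap e \<bullet> (DIA.I [e] \<otimes>\<^sub>D EvR DIA es \<otimes>\<^sub>D DIA.I [flip_edge e])"
  "EvL DIA ([e] \<boxtimes>\<^sub>D es) = EvL DIA es \<bullet> (DIA.I (Dual DIA es) \<otimes>\<^sub>D dcap (flip_edge e) \<otimes>\<^sub>D DIA.I es)"
  "CoevR DIA ([e] \<boxtimes>\<^sub>D es) = (DIA.I [e] \<otimes>\<^sub>D CoevR DIA es \<otimes>\<^sub>D DIA.I [flip_edge e]) \<bullet> dcup e"
  "CoevL DIA ([e] \<boxtimes>\<^sub>D es) = (DIA.I (Dual DIA es) \<otimes>\<^sub>D dcup (flip_edge e) \<otimes>\<^sub>D DIA.I es) \<bullet> CoevL DIA es"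
  by (simp_all add: DIA_simps abs_ops)

lemma dual_pair_edge: "DIA.dual_pair [e] [flip_edge e] (dcap e) (dcup (flip_edge e))"
proof -
  have "(dcap e \<otimes>\<^sub>D DIA.I [e]) \<bullet> (DIA.I [e] \<otimes>\<^sub>D dcup (flip_edge e)) = DIA.I [e]"
    unfolding DIA_simps abs_ops abs_eq by (rule isotopic.zigzag_right)
  moreover have "(DIA.I [flip_edge e] \<otimes>\<^sub>D dcap e) \<bullet> (dcup (flip_edge e) \<otimes>\<^sub>D DIA.I [flip_edge e]) = DIA.I [flip_edge e]"
    unfolding DIA_simps abs_ops abs_eq using isotopic.zigzag_left[of "flip_edge e"] by simp
  ultimately show ?thesis
    by (simp add: DIA.dual_pair_def hom_iff)
qed

lemma dual_pair_evr: "DIA.dual_pair a (Dual DIA a) (EvR DIA a) (CoevL DIA a)"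
proof (induction a rule: edges_induct)
  case Unit
  show ?case unfolding dual_DIA nested_Unit by (rule DIA.dual_pair_unit)
next
  case (edge e es)
  show ?case unfolding dual_DIA nested_edge by (rule DIA.dual_pair_tensor[OF dual_pair_edge edge])
qed

lemma dual_pair_evl: "DIA.dual_pair (Dual DIA a) a (EvL DIA a) (CoevR DIA a)"
proof (induction a rule: edges_induct)
  case Unit
  show ?case unfolding dual_DIA nested_Unit by (rule DIA.dual_pair_unit)
next
  case (edge e es)
  show ?case unfolding dual_DIA nested_edge
    using DIA.dual_pair_tensor[OF edge dual_pair_edge[of "flip_edge e"]] by simp
qed

lemmas nested_arr [simp] = DIA.dp_arr[OF dual_pair_evr] DIA.dp_arr[OF dual_pair_evl]

lemma evr_tensor_DIA: "EvR DIA (a \<boxtimes>\<^sub>D b) = EvR DIA a \<bullet> (DIA.I a \<otimes>\<^sub>D EvR DIA b \<otimes>\<^sub>D DIA.I (Dual DIA a))"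
  by (induction a rule: edges_induct) (simp_all add: dual_DIA nested_Unit nested_edge)

lemma evl_tensor_DIA: "EvL DIA (a \<boxtimes>\<^sub>D b) = EvL DIA b \<bullet> (DIA.I (Dual DIA b) \<otimes>\<^sub>D EvL DIA a \<otimes>\<^sub>D DIA.I b)"
  by (induction a rule: edges_induct) (simp_all add: dual_DIA nested_Unit nested_edge)

lemma coevr_tensor_DIA: "CoevR DIA (a \<boxtimes>\<^sub>D b) = (DIA.I a \<otimes>\<^sub>D CoevR DIA b \<otimes>\<^sub>D DIA.I (Dual DIA a)) \<bullet> CoevR DIA a"
  by (induction a rule: edges_induct) (simp_all add: dual_DIA nested_Unit nested_edge)

lemma coevl_tensor_DIA: "CoevL DIA (a \<boxtimes>\<^sub>D b) = (DIA.I (Dual DIA b) \<otimes>\<^sub>D CoevL DIA a \<otimes>\<^sub>D DIA.I b) \<bullet> CoevL DIA b"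
  by (induction a rule: edges_induct) (simp_all add: dual_DIA nested_Unit nested_edge)

lemma single_edge:
  "EvR DIA [e] = dcap e" "EvL DIA [e] = dcap (flip_edge e)"
  "CoevR DIA [e] = dcup e" "CoevL DIA [e] = dcup (flip_edge e)"
  using nested_edge[of e "Unit DIA"] by (simp_all add: nested_Unit dual_DIA)

lemma evr_dual_DIA: "EvR DIA (Dual DIA a) = EvL DIA a"
  by (induction a rule: edges_induct)
    (simp_all add: dual_DIA nested_Unit nested_edge evr_tensor_DIA single_edge)

interpretation DIA: pivotal_category DIA
  by unfold_locales
    (fact dual_DIA dual_pair_evr dual_pair_evl evr_dual_DIA evr_tensor_DIA evl_tensor_DIA)+

lemma ldual_DIA: "LDual DIA (abs_diagram f) = abs_diagram (wldual f)"
  "RDual DIA (abs_diagram f) = abs_diagram (wrdual f)"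
  by (simp_all add: LDual_def RDual_def Let_def DIA_simps abs_ops wldual_def wrdual_def)

text \<open>The two rotation rules of plane isotopy are exactly the hypotheses of
  \<open>isdualI\<close> here; symmetry then gives the dual of the fork.\<close>

lemma isdual_join: "DIA.isdual [(x, One), (x, One)] [(x, Two)] (abs_diagram (Join x)) (abs_diagram (Fork (flip x)))"
  by (rule DIA.isdualI)
    (auto simp: hom_iff ldual_DIA abs_eq DIA_simps(2,3) intro: isotopic.rotate_left isotopic.rotate_right)

lemma isdual_fork: "DIA.isdual [(x, Two)] [(x, One), (x, One)] (abs_diagram (Fork x)) (abs_diagram (Join (flip x)))"
  using DIA.isdual_sym[OF isdual_join[of "flip x"]] by (simp add: DIA_simps dual_edges_def)

lemma isdual_S: "DIA.isdual [(x, One), (x, One)] [(x, One), (x, One)] (abs_diagram (wS x)) (abs_diagram (wS (flip x)))"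
  using DIA.isdual_cmp[OF isdual_join isdual_fork] by (simp add: DIA_simps abs_ops wS_def)

lemma isdual_cap: "DIA.isdual ([e] \<boxtimes>\<^sub>D [flip_edge e]) (Unit DIA) (dcap e) (dcup e)"
proof -
  have 1: "(DIA.I [e] \<otimes>\<^sub>D dcap (flip_edge e) \<otimes>\<^sub>D DIA.I [flip_edge e]) \<bullet> (dcup e \<otimes>\<^sub>D DIA.I ([e] \<boxtimes>\<^sub>D [flip_edge e])) =
      DIA.I ([e] \<boxtimes>\<^sub>D [flip_edge e])"
    using DIA.dp_zigzag2[OF dual_pair_edge[of "flip_edge e"], of "Unit DIA" "[flip_edge e]"] by simp
  have 2: "(DIA.I [e] \<otimes>\<^sub>D dcap (flip_edge e) \<otimes>\<^sub>D DIA.I [flip_edge e]) \<bullet> (DIA.I ([e] \<boxtimes>\<^sub>D [flip_edge e]) \<otimes>\<^sub>D dcup e) =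
      DIA.I ([e] \<boxtimes>\<^sub>D [flip_edge e])"
    using DIA.dp_zigzag1[OF dual_pair_edge[of "flip_edge e"], of "[e]" "Unit DIA"] by simp
  show ?thesis
    by (simp add: DIA.isdual_def hom_iff dual_DIA nested_Unit evr_tensor_DIA evl_tensor_DIA single_edge 1 2)
qed

lemma isdual_cup: "DIA.isdual (Unit DIA) ([e] \<boxtimes>\<^sub>D [flip_edge e]) (dcup e) (dcap e)"
  using DIA.isdual_sym[OF isdual_cap[of e]] by (simp add: dual_DIA)

text \<open>Existence suffices, since \<open>isdual_unique\<close> identifies any such
  \<open>d'\<close> with both duals. The matching boundaries required in \<open>graphs.comp\<close>
  make \<open>isdual_cmp\<close> applicable.\<close>

lemma graphs_isdual: "d \<in> graphs \<Longrightarrow> \<exists>d'. DIA.isdual (dsrc d) (dtgt d) d d'"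
proof (induction rule: graphs.induct)
  case (ident a)
  show ?case using DIA.isdual_ide[of "strands a"] by (auto simp: DIA_simps)
next
  case (cap x)
  show ?case using isdual_cap[of "(x, One)"] by (auto simp: DIA_simps)
next
  case (cup x)
  show ?case using isdual_cup[of "(x, One)"] by (auto simp: DIA_simps)
next
  case (S x)
  show ?case using isdual_S[of x] by (auto simp: wS_def)
next
  case (comp f g)
  then show ?case using DIA.isdual_cmp by (fastforce simp: DIA_simps)
next
  case (tens f g)
  then show ?case using DIA.isdual_tensor by (fastforce simp: DIA_simps)
qed

lemma graphs_balanced: "d \<in> graphs \<Longrightarrow> LDual DIA d = RDual DIA d"
  using graphs_isdual DIA.isdual_unique by metis

section \<open>The category TrPD\<close>

text \<open>The supports of sums and multiples may shrink by cancellation; a common larger index set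
  allows termwise comparison.\<close>

lemma bilinear_ext_superset:
  assumes "finite A" "Poly_Mapping.keys x \<subseteq> A" "finite B" "Poly_Mapping.keys y \<subseteq> B"
  shows "bilinear_ext h x y = (\<Sum>d\<in>A. \<Sum>e\<in>B.
    Poly_Mapping.single (h d e) (Poly_Mapping.lookup x d * Poly_Mapping.lookup y e))"
proof -
  have "(\<Sum>e\<in>B. Poly_Mapping.single (h d e) (Poly_Mapping.lookup x d * Poly_Mapping.lookup y e)) =
    (\<Sum>e\<in>Poly_Mapping.keys y. Poly_Mapping.single (h d e) (Poly_Mapping.lookup x d * Poly_Mapping.lookup y e))" for d
    by (rule sum.mono_neutral_right) (use assms in \<open>auto simp: in_keys_iff\<close>)
  then show ?thesis
    unfolding bilinear_ext_def
    by (simp, intro sum.mono_neutral_left) (use assms in \<open>auto simp: in_keys_iff\<close>)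
qed

lemma bilinear_ext_add:
  "bilinear_ext h (x + x') y = bilinear_ext h x y + bilinear_ext h x' y"
  "bilinear_ext h x (y + y') = bilinear_ext h x y + bilinear_ext h x y'"
proof -
  let ?A = "Poly_Mapping.keys x \<union> Poly_Mapping.keys x'" and ?B = "Poly_Mapping.keys y \<union> Poly_Mapping.keys y'"
  have "Poly_Mapping.keys (x + x') \<subseteq> ?A" "Poly_Mapping.keys (y + y') \<subseteq> ?B"
    by (rule keys_add)+
  then have *: "bilinear_ext h u v = (\<Sum>d\<in>?A. \<Sum>e\<in>?B.
      Poly_Mapping.single (h d e) (Poly_Mapping.lookup u d * Poly_Mapping.lookup v e))"
    if "u \<in> {x, x', x + x'}" "v \<in> {y, y', y + y'}" for u v
    using that by (intro bilinear_ext_superset) auto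
  show "bilinear_ext h (x + x') y = bilinear_ext h x y + bilinear_ext h x' y"
    "bilinear_ext h x (y + y') = bilinear_ext h x y + bilinear_ext h x y'"
    by (simp_all add: * lookup_add distrib_right distrib_left single_add sum.distrib)
qed

lemma bilinear_ext_zero [simp]: "bilinear_ext h 0 y = 0" "bilinear_ext h x 0 = 0"
  by (simp_all add: bilinear_ext_def)

lemma bilinear_ext_single [simp]:
  "bilinear_ext h (Poly_Mapping.single d r) (Poly_Mapping.single e s) = Poly_Mapping.single (h d e) (r * s)"
  by (subst bilinear_ext_superset[of "{d}" _ "{e}"]) simp_all

lemma bilinear_ext_sum_left: "bilinear_ext h (\<Sum>i\<in>A. f i) y = (\<Sum>i\<in>A. bilinear_ext h (f i) y)"
  by (induction A rule: infinite_finite_induct) (simp_all add: bilinear_ext_add)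

lemma bilinear_ext_sum_right: "bilinear_ext h x (\<Sum>i\<in>A. f i) = (\<Sum>i\<in>A. bilinear_ext h x (f i))"
  by (induction A rule: infinite_finite_induct) (simp_all add: bilinear_ext_add)

lemma poly_mapping_expansion:
  "x = (\<Sum>d\<in>Poly_Mapping.keys x. Poly_Mapping.single d (Poly_Mapping.lookup x d))"
  by (rule poly_mapping_eqI) (auto simp: lookup_sum lookup_single when_def in_keys_iff)

lemma bilinear_ext_single_left:
  "bilinear_ext h (Poly_Mapping.single d 1) y =
    (\<Sum>e\<in>Poly_Mapping.keys y. Poly_Mapping.single (h d e) (Poly_Mapping.lookup y e))"
  by (subst bilinear_ext_superset[of "{d}" _ "Poly_Mapping.keys y"]) simp_all

lemma bilinear_ext_single_right:
  "bilinear_ext h x (Poly_Mapping.single e 1) =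
    (\<Sum>d\<in>Poly_Mapping.keys x. Poly_Mapping.single (h d e) (Poly_Mapping.lookup x d))"
  by (subst bilinear_ext_superset[of "Poly_Mapping.keys x" _ "{e}"]) simp_all

lemma bilinear_ext_left_unit:
  assumes "\<And>e. e \<in> Poly_Mapping.keys y \<Longrightarrow> h d e = e"
  shows "bilinear_ext h (Poly_Mapping.single d 1) y = y"
  unfolding bilinear_ext_single_left by (subst (3) poly_mapping_expansion) (simp add: assms)

lemma bilinear_ext_right_unit:
  assumes "\<And>d. d \<in> Poly_Mapping.keys x \<Longrightarrow> h d e = d"
  shows "bilinear_ext h x (Poly_Mapping.single e 1) = x"
  unfolding bilinear_ext_single_right by (subst (3) poly_mapping_expansion) (simp add: assms)

lemma bilinear_ext_assoc:
  assumes "\<And>c d e. h (h' c d) e = k c (k' d e)"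
  shows "bilinear_ext h (bilinear_ext h' x y) z = bilinear_ext k x (bilinear_ext k' y z)"
proof -
  \<comment> \<open>Expanding \<open>h'\<close> gives sums over \<open>x\<close> and
    \<open>y\<close>, expanding \<open>k'\<close> sums over \<open>y\<close> and \<open>z\<close>;
    the remaining arguments \<open>z\<close> and \<open>x\<close> are expanded by hand.\<close>
  have "bilinear_ext h (bilinear_ext h' x y) (\<Sum>d\<in>Poly_Mapping.keys z. Poly_Mapping.single d (Poly_Mapping.lookup z d)) =
    bilinear_ext k (\<Sum>d\<in>Poly_Mapping.keys x. Poly_Mapping.single d (Poly_Mapping.lookup x d)) (bilinear_ext k' y z)"
    unfolding bilinear_ext_def[of h'] bilinear_ext_def[of k'] bilinear_ext_sum_left
    unfolding bilinear_ext_sum_right bilinear_ext_single assms mult.assoc ..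
  then show ?thesis
    by (simp flip: poly_mapping_expansion)
qed

text \<open>The hypothesis is restricted to the supports because the interchange law of diagrams
  requires matching boundaries.\<close>

lemma bilinear_ext_interchange:
  assumes "\<And>g f g' f'. g \<in> Poly_Mapping.keys w \<Longrightarrow> f \<in> Poly_Mapping.keys x \<Longrightarrow> g' \<in> Poly_Mapping.keys y \<Longrightarrow>
    f' \<in> Poly_Mapping.keys z \<Longrightarrow> k (h g f) (h g' f') = h (k g g') (k f f')"
  shows "bilinear_ext k (bilinear_ext h w x) (bilinear_ext h y z) =
    bilinear_ext h (bilinear_ext k w y) (bilinear_ext k x z)"
proof -
  let ?l = Poly_Mapping.lookup and ?s = Poly_Mapping.single
  have "bilinear_ext k (bilinear_ext h w x) (bilinear_ext h y z) =
    (\<Sum>g\<in>Poly_Mapping.keys w. \<Sum>f\<in>Poly_Mapping.keys x. \<Sum>g'\<in>Poly_Mapping.keys y. \<Sum>f'\<in>Poly_Mapping.keys z.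
      ?s (k (h g f) (h g' f')) (?l w g * ?l x f * (?l y g' * ?l z f')))"
    unfolding bilinear_ext_def[of h] bilinear_ext_sum_left
    unfolding bilinear_ext_sum_right bilinear_ext_single ..
  also have "\<dots> = (\<Sum>g\<in>Poly_Mapping.keys w. \<Sum>g'\<in>Poly_Mapping.keys y. \<Sum>f\<in>Poly_Mapping.keys x. \<Sum>f'\<in>Poly_Mapping.keys z.
      ?s (k (h g f) (h g' f')) (?l w g * ?l x f * (?l y g' * ?l z f')))"
    by (rule sum.cong[OF HOL.refl], rule sum.swap)
  also have "\<dots> = (\<Sum>g\<in>Poly_Mapping.keys w. \<Sum>g'\<in>Poly_Mapping.keys y. \<Sum>f\<in>Poly_Mapping.keys x. \<Sum>f'\<in>Poly_Mapping.keys z.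
      ?s (h (k g g') (k f f')) (?l w g * ?l y g' * (?l x f * ?l z f')))"
    by (intro sum.cong HOL.refl) (simp add: assms mult_ac)
  also have "\<dots> = bilinear_ext h (bilinear_ext k w y) (bilinear_ext k x z)"
    unfolding bilinear_ext_def[of k] bilinear_ext_sum_left
    unfolding bilinear_ext_sum_right bilinear_ext_single ..
  finally show ?thesis .
qed

lemma keys_bilinear_ext:
  assumes "d \<in> Poly_Mapping.keys (bilinear_ext h x y)"
  obtains e f where "e \<in> Poly_Mapping.keys x" "f \<in> Poly_Mapping.keys y" "d = h e f"
proof -
  have "d \<in> (\<Union>e\<in>Poly_Mapping.keys x. Poly_Mapping.keys (\<Sum>f\<in>Poly_Mapping.keys y.
      Poly_Mapping.single (h e f) (Poly_Mapping.lookup x e * Poly_Mapping.lookup y f)))"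
    using assms keys_sum unfolding bilinear_ext_def by fast
  then obtain e where e: "e \<in> Poly_Mapping.keys x" "d \<in> Poly_Mapping.keys (\<Sum>f\<in>Poly_Mapping.keys y.
      Poly_Mapping.single (h e f) (Poly_Mapping.lookup x e * Poly_Mapping.lookup y f))" by blast
  then have "d \<in> (\<Union>f\<in>Poly_Mapping.keys y. Poly_Mapping.keys
      (Poly_Mapping.single (h e f) (Poly_Mapping.lookup x e * Poly_Mapping.lookup y f)))"
    using keys_sum by fast
  then show ?thesis using e that by (auto split: if_splits)
qed

section \<open>Scalar multiples of linear combinations of diagrams\<close>

abbreviation scale_map where "scale_map r \<equiv> Poly_Mapping.map ((*) r)"

lemma lookup_scale_map: "Poly_Mapping.lookup (scale_map r x) d = r * Poly_Mapping.lookup (x :: _ \<Rightarrow>\<^sub>0 'r::comm_ring_1) d"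
  by (simp add: Poly_Mapping.map.rep_eq when_def)

lemma keys_scale_map: "Poly_Mapping.keys (scale_map r x) \<subseteq> Poly_Mapping.keys (x :: _ \<Rightarrow>\<^sub>0 'r::comm_ring_1)"
  by (auto simp: in_keys_iff lookup_scale_map)

lemma scale_map_laws:
  fixes x y :: "'a \<Rightarrow>\<^sub>0 'r::comm_ring_1"
  shows "scale_map r (x + y) = scale_map r x + scale_map r y"
    "scale_map (r + s) x = scale_map r x + scale_map s x"
    "scale_map r (scale_map s x) = scale_map (r * s) x"
    "scale_map 1 x = x" "scale_map r 0 = (0 :: 'a \<Rightarrow>\<^sub>0 'r)" "x + scale_map (- 1) x = 0"
  by (rule poly_mapping_eqI, simp add: lookup_scale_map lookup_add algebra_simps)+

lemma scale_map_sum: "scale_map r (\<Sum>i\<in>A. f i) = (\<Sum>i\<in>A. scale_map r (f i :: 'a \<Rightarrow>\<^sub>0 'r::comm_ring_1))"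
  by (induction A rule: infinite_finite_induct) (simp_all add: scale_map_laws)

lemma bilinear_ext_scale:
  "bilinear_ext h (scale_map r x) y = scale_map r (bilinear_ext h x y)"
  "bilinear_ext h x (scale_map r y) = scale_map r (bilinear_ext h x y)"
proof -
  note * = bilinear_ext_superset[of "Poly_Mapping.keys x" _ "Poly_Mapping.keys y"]
  show "bilinear_ext h (scale_map r x) y = scale_map r (bilinear_ext h x y)"
    "bilinear_ext h x (scale_map r y) = scale_map r (bilinear_ext h x y)"
    by (subst (1 2) *; simp add: keys_scale_map scale_map_sum lookup_scale_map mult_ac)+
qed

lemma TrPD_simps:
  "Arr TrPD = {f. \<forall>d \<in> Poly_Mapping.keys (coeffs f).
      d \<in> graphs \<and> dsrc d = strands (lsrc f) \<and> dtgt d = strands (ltgt f)}"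
  "Dom TrPD = lsrc" "Cod TrPD = ltgt" "Ide TrPD a = graph_mor a a (WId (strands a))"
  "Cmp TrPD g f = LinDiagram (lsrc f) (ltgt g) (bilinear_ext dcomp (coeffs g) (coeffs f))"
  "Unit TrPD = []" "OTensor TrPD = (@)"
  "Tensor TrPD f g = LinDiagram (lsrc f @ lsrc g) (ltgt f @ ltgt g) (bilinear_ext dtens (coeffs f) (coeffs g))"
  "Zero TrPD a b = LinDiagram a b 0"
  "Plus TrPD f g = LinDiagram (lsrc f) (ltgt f) (coeffs f + coeffs g)"
  "Scale TrPD r f = LinDiagram (lsrc f) (ltgt f) (scale_map r (coeffs f))"
  "Dual TrPD = dual_ori"
  "EvR TrPD a = graph_mor (a @ dual_ori a) [] (wevr (strands a))"
  "EvL TrPD a = graph_mor (dual_ori a @ a) [] (wevl (strands a))"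
  "CoevR TrPD a = graph_mor [] (a @ dual_ori a) (wcoevr (strands a))"
  "CoevL TrPD a = graph_mor [] (dual_ori a @ a) (wcoevl (strands a))"
  by (simp_all add: TrPD_def)

section \<open>Morphisms of TrPD with given boundary\<close>

lemma strands_append [simp]: "strands (a @ b) = strands a @ strands b"
  by (simp add: strands_def)

lemma dual_edges_strands [simp]: "dual_edges (strands a) = strands (dual_ori a)"
  by (simp add: strands_def dual_edges_def dual_ori_def rev_map)

definition typed :: "ori list \<Rightarrow> ori list \<Rightarrow> (diagram \<Rightarrow>\<^sub>0 qring) \<Rightarrow> bool" where
  "typed a b p \<longleftrightarrow> (\<forall>d\<in>Poly_Mapping.keys p. d \<in> graphs \<and> dsrc d = strands a \<and> dtgt d = strands b)"

lemma typedD: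
  assumes "typed a b p" "d \<in> Poly_Mapping.keys p"
  shows "d \<in> graphs" "dsrc d = strands a" "dtgt d = strands b"
  using assms by (auto simp: typed_def)

lemma TrPD_hom: "f \<in> Hom TrPD a b \<longleftrightarrow> (\<exists>p. f = LinDiagram a b p \<and> typed a b p)"
  by (cases f) (auto simp: hom_iff TrPD_simps typed_def)

lemma typed_cmp:
  assumes "typed a b p" "typed b c r"
  shows "typed a c (bilinear_ext dcomp r p)"
  unfolding typed_def
proof
  fix d assume "d \<in> Poly_Mapping.keys (bilinear_ext dcomp r p)"
  then obtain g f where gf: "g \<in> Poly_Mapping.keys r" "f \<in> Poly_Mapping.keys p" and d: "d = dcomp g f"
    by (rule keys_bilinear_ext)
  note g = typedD[OF assms(2) gf(1)] and f = typedD[OF assms(1) gf(2)]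
  show "d \<in> graphs \<and> dsrc d = strands a \<and> dtgt d = strands c"
    using graphs.comp[OF f(1) g(1)] f g by (simp add: d)
qed

lemma typed_tensor:
  assumes "typed a b p" "typed c d r"
  shows "typed (a @ c) (b @ d) (bilinear_ext dtens p r)"
  unfolding typed_def
proof
  fix e assume "e \<in> Poly_Mapping.keys (bilinear_ext dtens p r)"
  then obtain f g where fg: "f \<in> Poly_Mapping.keys p" "g \<in> Poly_Mapping.keys r" and e: "e = dtens f g"
    by (rule keys_bilinear_ext)
  note f = typedD[OF assms(1) fg(1)] and g = typedD[OF assms(2) fg(2)]
  show "e \<in> graphs \<and> dsrc e = strands (a @ c) \<and> dtgt e = strands (b @ d)"
    using graphs.tens[OF f(1) g(1)] f g by (simp add: e)
qed

lemma typed_plus: "typed a b p \<Longrightarrow> typed a b r \<Longrightarrow> typed a b (p + r)"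
  using keys_add[of p r] unfolding typed_def by blast

lemma typed_scale: "typed a b p \<Longrightarrow> typed a b (scale_map r p)"
  using keys_scale_map[of r p] unfolding typed_def by blast

lemma typed_single: "d \<in> graphs \<Longrightarrow> dsrc d = strands a \<Longrightarrow> dtgt d = strands b \<Longrightarrow> typed a b (Poly_Mapping.single d r)"
  by (simp add: typed_def)

lemma TrPD_homE:
  assumes "f \<in> Hom TrPD a b"
  obtains p where "f = LinDiagram a b p" "typed a b p"
  using assms by (auto simp: TrPD_hom)

lemma LinDiagram_hom [simp]: "LinDiagram a b p \<in> Hom TrPD a' b' \<longleftrightarrow> a' = a \<and> b' = b \<and> typed a b p"
  by (auto simp: TrPD_hom)

lemma typed_zero [simp]: "typed a b 0"
  by (simp add: typed_def)

lemma typed_ide [simp]: "typed a a (Poly_Mapping.single (did (strands a)) r)"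
  by (intro typed_single graphs.ident) simp_all

lemma bilinear_ext_ide:
  "typed a b p \<Longrightarrow> bilinear_ext dcomp p (Poly_Mapping.single (did (strands a)) 1) = p"
  "typed a b p \<Longrightarrow> bilinear_ext dcomp (Poly_Mapping.single (did (strands b)) 1) p = p"
  "bilinear_ext dtens p (Poly_Mapping.single (did []) 1) = p"
  "bilinear_ext dtens (Poly_Mapping.single (did []) 1) p = p"
  by (intro bilinear_ext_right_unit bilinear_ext_left_unit diagram_laws; simp add: typedD)+

lemma bilinear_ext_cmp_tensor:
  assumes "typed a b p" "typed b c r" "typed a' b' p'" "typed b' c' r'"
  shows "bilinear_ext dtens (bilinear_ext dcomp r p) (bilinear_ext dcomp r' p') =
    bilinear_ext dcomp (bilinear_ext dtens r r') (bilinear_ext dtens p p')"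
  by (rule bilinear_ext_interchange, rule diagram_laws)
    (use assms in \<open>simp_all add: typedD(2,3)\<close>)

lemma TrPD_linear_monoidal: "linear_monoidal_category TrPD"
  by unfold_locales
    (((elim TrPD_homE)?, hypsubst?, simp add: TrPD_simps graph_mor_def Minus_def strands_def[of "[]"]
      bilinear_ext_add bilinear_ext_scale scale_map_laws bilinear_ext_assoc diagram_laws bilinear_ext_ide
      typed_cmp typed_tensor typed_plus typed_scale bilinear_ext_cmp_tensor add.assoc add.commute)+)

lemma nested_graphs:
  "abs_diagram (wevr (strands a)) \<in> graphs" "abs_diagram (wevl (strands a)) \<in> graphs"
  "abs_diagram (wcoevr (strands a)) \<in> graphs" "abs_diagram (wcoevl (strands a)) \<in> graphs"
proof (induction a)
  case Nil
  case 1 show ?case using graphs.ident[of "[]"] by (simp add: strands_def)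
  case 2 show ?case using graphs.ident[of "[]"] by (simp add: strands_def)
  case 3 show ?case using graphs.ident[of "[]"] by (simp add: strands_def)
  case 4 show ?case using graphs.ident[of "[]"] by (simp add: strands_def)
next
  case (Cons x a)
  have x: "strands (x # a) = (x, One) # strands a" and ids: "did [(y, One)] \<in> graphs" for y
    using graphs.ident[of "[y]"] by (simp_all add: strands_def)
  note rules = graphs.comp graphs.tens graphs.ident graphs.cap graphs.cup ids
  case 1 show ?case using Cons by (auto simp: x simp flip: abs_ops(1,2) intro!: rules)
  case 2 show ?case using Cons by (auto simp: x simp flip: abs_ops(1,2) intro!: rules)
  case 3 show ?case using Cons by (auto simp: x simp flip: abs_ops(1,2) intro!: rules)
  case 4 show ?case using Cons by (auto simp: x simp flip: abs_ops(1,2) intro!: rules)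
qed

lemma strands_Nil [simp]: "strands [] = []"
  by (simp add: strands_def)

lemma dual_ori_laws [simp]: "dual_ori [] = []" "dual_ori (a @ b) = dual_ori b @ dual_ori a" "dual_ori [x] = [flip x]"
  by (simp_all add: dual_ori_def)

text \<open>Duals in TrPD are the linear extensions of duals of diagrams, so balance carries over
  from graphs. Writing the coefficients as a sum of single diagrams makes bilinearity
  applicable.\<close>

lemma ldual_TrPD:
  assumes "typed a b p"
  shows "LDual TrPD (LinDiagram a b p) = LinDiagram (dual_ori b) (dual_ori a)
      (\<Sum>d\<in>Poly_Mapping.keys p. Poly_Mapping.single (LDual DIA d) (Poly_Mapping.lookup p d))"
    and "RDual TrPD (LinDiagram a b p) = LinDiagram (dual_ori b) (dual_ori a)
      (\<Sum>d\<in>Poly_Mapping.keys p. Poly_Mapping.single (RDual DIA d) (Poly_Mapping.lookup p d))"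
proof -
  let ?f = "LinDiagram a b (\<Sum>d\<in>Poly_Mapping.keys p. Poly_Mapping.single d (Poly_Mapping.lookup p d))"
  have "LDual TrPD ?f = LinDiagram (dual_ori b) (dual_ori a)
      (\<Sum>d\<in>Poly_Mapping.keys p. Poly_Mapping.single (LDual DIA d) (Poly_Mapping.lookup p d))"
    using assms by (simp add: LDual_def Let_def TrPD_simps graph_mor_def DIA_simps typedD
        bilinear_ext_sum_left bilinear_ext_sum_right cong: sum.cong)
  then show "LDual TrPD (LinDiagram a b p) = LinDiagram (dual_ori b) (dual_ori a)
      (\<Sum>d\<in>Poly_Mapping.keys p. Poly_Mapping.single (LDual DIA d) (Poly_Mapping.lookup p d))"
    by (simp flip: poly_mapping_expansion)
  have "RDual TrPD ?f = LinDiagram (dual_ori b) (dual_ori a)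
      (\<Sum>d\<in>Poly_Mapping.keys p. Poly_Mapping.single (RDual DIA d) (Poly_Mapping.lookup p d))"
    using assms by (simp add: RDual_def Let_def TrPD_simps graph_mor_def DIA_simps typedD
        bilinear_ext_sum_left bilinear_ext_sum_right cong: sum.cong)
  then show "RDual TrPD (LinDiagram a b p) = LinDiagram (dual_ori b) (dual_ori a)
      (\<Sum>d\<in>Poly_Mapping.keys p. Poly_Mapping.single (RDual DIA d) (Poly_Mapping.lookup p d))"
    by (simp flip: poly_mapping_expansion)
qed

lemma TrPD_balanced:
  assumes "f \<in> Hom TrPD a b"
  shows "LDual TrPD f = RDual TrPD f"
  using assms by (rule TrPD_homE) (auto simp: ldual_TrPD graphs_balanced typedD intro!: sum.cong)

lemma zigzags_DIA:
  "dcomp (dtens (abs_diagram (wevr a)) (did a)) (dtens (did a) (abs_diagram (wcoevl a))) = did a"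
  "dcomp (dtens (did (dual_edges a)) (abs_diagram (wevr a))) (dtens (abs_diagram (wcoevl a)) (did (dual_edges a))) =
    did (dual_edges a)"
  "dcomp (dtens (abs_diagram (wevl a)) (did (dual_edges a))) (dtens (did (dual_edges a)) (abs_diagram (wcoevr a))) =
    did (dual_edges a)"
  "dcomp (dtens (did a) (abs_diagram (wevl a))) (dtens (abs_diagram (wcoevr a)) (did a)) = did a"
  using dual_pair_evr[of a] dual_pair_evl[of a] by (simp_all add: DIA.dual_pair_def DIA_simps)

lemma TrPD_balanced_rigid: "balanced_rigid_category TrPD"
proof -
  interpret linear_monoidal_category TrPD by (rule TrPD_linear_monoidal)
  show ?thesis
  proof
    show "LDual TrPD f = RDual TrPD f" if "f \<in> Hom TrPD a b" for f a b
      using that by (rule TrPD_balanced)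
  qed (use zigzags_DIA[of "strands _"] evr_tensor_DIA[of "strands _" "strands _"] evl_tensor_DIA[of "strands _" "strands _"]
      coevr_tensor_DIA[of "strands _" "strands _"] coevl_tensor_DIA[of "strands _" "strands _"]
     in \<open>auto simp: TrPD_simps graph_mor_def DIA_simps intro!: typed_single nested_graphs\<close>)
qed

section \<open>The category MOY\<close>

lemma qvar_nonzero: "qvar \<noteq> 0" "qvar - inverse qvar \<noteq> 0"
proof -
  show 0: "qvar \<noteq> 0"
    by (simp add: Zero_fract_def eq_fract)
  have "qvar * qvar \<noteq> 1"
    by (simp add: One_fract_def eq_fract one_pCons)
  then show "qvar - inverse qvar \<noteq> 0"
    using 0 by (metis eq_iff_diff_eq_0 right_inverse)
qed

lemma qpow_add: "qpow (i + j) = qpow i * qpow j"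
  by transfer (rule power_int_add, simp add: qvar_nonzero)

lemma qpow_0: "qpow 0 = 1"
  by transfer simp

text \<open>With \<open>y\<close> for \<open>x powi k\<close> both become rational identities in two
  unknowns. The first normalises the first move, the second makes \<open>R2b\<close> work.\<close>

lemma quantum_integer_identities:
  fixes x :: "'a::field"
  assumes x: "x \<noteq> 0" and D: "x - inverse x \<noteq> 0"
  defines "b \<equiv> \<lambda>j. (x powi j - x powi (- j)) / (x - inverse x)"
  shows "x powi (k - 1) * b k = x powi k * b (k - 1) + 1"
    and "b k + b (k - 2) = (x powi 1 + x powi (- 1)) * b (k - 1)"
proof -
  define y where "y = x powi k"
  have y: "y \<noteq> 0" using x by (simp add: y_def)
  have p: "x powi k = y" "x powi (k - 1) = y / x" "x powi (k - 2) = y / (x * x)"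
    "x powi (- k) = 1 / y" "x powi (- (k - 1)) = x / y" "x powi (- (k - 2)) = x * x / y"
    "x powi 1 = x" "x powi (- 1) = 1 / x"
    using x by (simp_all add: y_def power_int_diff power_int_minus field_simps power2_eq_square)
  have D': "x * x \<noteq> 1" using x D by (simp add: field_simps)
  have 1: "x - inverse x = (x * x - 1) / x" using x by (simp add: field_simps)
  have 2: "b j = (x powi j - x powi (- j)) * x / (x * x - 1)" for j
    using x by (simp add: b_def 1)
  show "x powi (k - 1) * b k = x powi k * b (k - 1) + 1"
    unfolding 2 p using x y D' by (simp add: divide_simps)
  show "b k + b (k - 2) = (x powi 1 + x powi (- 1)) * b (k - 1)"
    unfolding 2 p using x y D' by (simp add: divide_simps) algebra
qed

lemma qint_R1: "qpow (k - 1) * qint k = qpow k * qint (k - 1) + 1"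
  by transfer (rule quantum_integer_identities[OF qvar_nonzero])

lemma qint_uminus: "qint (- k) = - qint k"
  by transfer (simp add: minus_divide_left)

text \<open>This is \<open>qint_R1\<close> at \<open>1 - k\<close>, rewritten with
  \<open>qint\<close> being odd.\<close>

lemma qint_R1': "qpow (1 - k) * qint k = qpow (- k) * qint (k - 1) + 1"
  using qint_R1[of "1 - k"] qint_uminus[of k] qint_uminus[of "k - 1"] by (simp add: algebra_simps)

lemma qint_R2: "qint k + qint (k - 2) = (qpow 1 + qpow (- 1)) * qint (k - 1)"
  by transfer (rule quantum_integer_identities[OF qvar_nonzero])

lemma strand_TrPD [simp]: "strand TrPD [Up] x = [x]"
  by (cases x) (simp_all add: TrPD_simps)

text \<open>The nested cap over a single edge carries identity layers, so as a word it differs from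
  \<open>WCap\<close>; the two agree up to isotopy.\<close>

lemma tr_cap_eq: "tr_cap x = cap TrPD [Up] x"
  using single_edge(1)[of "(Up, One)"] single_edge(2)[of "(Up, One)"]
  by (cases x) (simp_all add: tr_cap_def TrPD_simps graph_mor_def strands_def DIA_simps)

lemma tr_cup_eq: "tr_cup x = cup TrPD [Up] x"
  using single_edge(3)[of "(Up, One)"] single_edge(4)[of "(Up, One)"]
  by (cases x) (simp_all add: tr_cup_def TrPD_simps graph_mor_def strands_def DIA_simps)

lemma tr_S_hom: "tr_S x \<in> Hom TrPD [x, x] [x, x]"
  by (auto simp: tr_S_def graph_mor_def strands_def wS_def intro!: typed_single)
    (metis graphs.S wS_def)

text \<open>It makes the \<open>Down\<close> cases of the relations statements about
  \<open>crossing\<close> with two downward strands, which is defined by a left dual.\<close>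

lemma ldual_tr_S: "LDual TrPD (tr_S Up) = tr_S Down"
proof -
  have "LDual DIA (abs_diagram (wS Up)) = abs_diagram (wS Down)"
    using DIA.isdual_unique(1)[OF isdual_S[of Up]] by simp
  moreover have "typed [Up, Up] [Up, Up] (Poly_Mapping.single (abs_diagram (wS Up)) 1)"
    using tr_S_hom[of Up] by (simp add: tr_S_def graph_mor_def)
  ultimately show ?thesis
    by (simp add: tr_S_def graph_mor_def ldual_TrPD dual_ori_def)
qed

lemma generated_TrPD: "(\<And>a b. OTensor C a b = a @ b) \<Longrightarrow> Unit C = [] \<Longrightarrow> Dual C [Up] = [Down] \<Longrightarrow>
    a \<in> generated_objects C [Up]"
proof (induction a)
  case Nil
  then show ?case using generated_objects.unit[of C "[Up]"] by simp
next
  case (Cons x a)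
  have "[x] \<in> generated_objects C [Up]"
    using generated_objects.gen[of "[Up]" C] generated_objects.gen_dual[of C "[Up]"] Cons.prems
    by (cases x) simp_all
  from generated_objects.otensor[OF this, of a] Cons show ?case by simp
qed

theorem proposition3p2p1:
  fixes n :: nat
  assumes "n \<ge> 2"
  shows "rigid_braided_untwisted (MOY n) [Up]
    ((qpow (int n - 1) \<odot>\<^bsub>MOY n\<^esub> Ide (MOY n) [Up, Up])
      \<ominus>\<^bsub>MOY n\<^esub> (qpow (int n) \<odot>\<^bsub>MOY n\<^esub> moy_S n))
    ((qpow (1 - int n) \<odot>\<^bsub>MOY n\<^esub> Ide (MOY n) [Up, Up])
      \<ominus>\<^bsub>MOY n\<^esub> (qpow (- int n) \<odot>\<^bsub>MOY n\<^esub> moy_S n))"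
proof -
  interpret T: balanced_rigid_category TrPD by (rule TrPD_balanced_rigid)
  have [simp]: "tr_S x \<in> Arr TrPD" "Dom TrPD (tr_S x) = [x, x]" "Cod TrPD (tr_S x) = [x, x]" for x
    using tr_S_hom[of x] by (auto simp: hom_iff)
  have [simp]: "OTensor TrPD a b = a @ b" "Unit TrPD = []" for a b
    by (simp_all add: TrPD_simps)
  note defs = tr_cap_eq tr_cup_eq tr_id_def
  have [simp]: "cap TrPD [Up] x \<in> Arr TrPD" "Dom TrPD (cap TrPD [Up] x) = [x, flip x]" "Cod TrPD (cap TrPD [Up] x) = []"
    "cup TrPD [Up] x \<in> Arr TrPD" "Dom TrPD (cup TrPD [Up] x) = []" "Cod TrPD (cup TrPD [Up] x) = [x, flip x]" for x
    using T.cap_cup_arr[of "[Up]" x] by simp_all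
  interpret Q: tensor_ideal_quotient TrPD "moy_relations n"
  proof
    fix f g assume "(f, g) \<in> moy_relations n"
    then show "f \<in> Arr TrPD \<and> g \<in> Arr TrPD \<and> Dom TrPD f = Dom TrPD g \<and> Cod TrPD f = Cod TrPD g"
      by cases (simp_all add: defs)
  qed
  have MOY: "MOY n = Q.Q" "moy_S n = Q.cls (tr_S Up)"
    by (simp_all add: MOY_def moy_S_def moy_ideal_def)
  interpret MB: balanced_rigid_category Q.Q by (rule Q.quotient_balanced_rigid)
  have S: "crossing Q.Q [Up] (Q.cls (tr_S Up)) (Q.cls (tr_S Up)) s x x = Q.cls (tr_S x)" for s x
    by (cases x) (simp_all add: ldual_tr_S)
  have m: "moy_category Q.Q [Up] (Q.cls (tr_S Up)) (qpow 1) (qpow (- 1)) (qpow (int n)) (qpow (- int n))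
      (qint (int n)) (qint (int n - 1)) (qint (int n - 2))"
  proof
    show "a \<in> generated_objects Q.Q [Up]" for a
      by (rule generated_TrPD) (simp_all add: TrPD_simps)
    fix x s
    show "qpow 1 * qpow (- 1) = 1" "qpow (int n) * qpow (- int n) = 1"
      by (simp_all add: qpow_0 flip: qpow_add)
    show "qpow (- 1) * qpow (int n) * qint (int n) = qpow (int n) * qint (int n - 1) + 1"
      "qpow 1 * qpow (- int n) * qint (int n) = qpow (- int n) * qint (int n - 1) + 1"
      using qint_R1[of "int n"] qint_R1'[of "int n"] by (simp_all flip: qpow_add)
    show "qint (int n) + qint (int n - 2) = (qpow 1 + qpow (- 1)) * qint (int n - 1)"
      by (rule qint_R2)
    show "Q.cls (tr_S Up) \<in> Hom Q.Q ([Up] \<boxtimes>\<^bsub>Q.Q\<^esub> [Up]) ([Up] \<boxtimes>\<^bsub>Q.Q\<^esub> [Up])"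
      by simp
    show "cap Q.Q [Up] x \<cdot>\<^bsub>Q.Q\<^esub> cup Q.Q [Up] x = qint (int n) \<odot>\<^bsub>Q.Q\<^esub> Ide Q.Q (Unit Q.Q)"
      using Q.relation_holds[OF moy_relations.circle[of x n]] by (simp add: defs)
    show "crossing Q.Q [Up] (Q.cls (tr_S Up)) (Q.cls (tr_S Up)) s x x \<cdot>\<^bsub>Q.Q\<^esub>
        crossing Q.Q [Up] (Q.cls (tr_S Up)) (Q.cls (tr_S Up)) s x x =
        (qpow 1 + qpow (- 1)) \<odot>\<^bsub>Q.Q\<^esub> crossing Q.Q [Up] (Q.cls (tr_S Up)) (Q.cls (tr_S Up)) s x x"
      unfolding S using Q.relation_holds[OF moy_relations.digon[of x n]] by simp
    show "(cap Q.Q [Up] (flip x) \<otimes>\<^bsub>Q.Q\<^esub> ids Q.Q [Up] x) \<cdot>\<^bsub>Q.Q\<^esub>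
        (ids Q.Q [Up] (flip x) \<otimes>\<^bsub>Q.Q\<^esub> crossing Q.Q [Up] (Q.cls (tr_S Up)) (Q.cls (tr_S Up)) s x x) \<cdot>\<^bsub>Q.Q\<^esub>
        (cup Q.Q [Up] (flip x) \<otimes>\<^bsub>Q.Q\<^esub> ids Q.Q [Up] x) = qint (int n - 1) \<odot>\<^bsub>Q.Q\<^esub> ids Q.Q [Up] x"
      unfolding S using Q.relation_holds[OF moy_relations.curl[of x n]] by (simp add: defs)
    show "(ids Q.Q [Up] x \<otimes>\<^bsub>Q.Q\<^esub> cap Q.Q [Up] x \<otimes>\<^bsub>Q.Q\<^esub> ids Q.Q [Up] (flip x)) \<cdot>\<^bsub>Q.Q\<^esub>
        (crossing Q.Q [Up] (Q.cls (tr_S Up)) (Q.cls (tr_S Up)) s x x \<otimes>\<^bsub>Q.Q\<^esub>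
          crossing Q.Q [Up] (Q.cls (tr_S Up)) (Q.cls (tr_S Up)) s (flip x) (flip x)) \<cdot>\<^bsub>Q.Q\<^esub>
        (ids Q.Q [Up] x \<otimes>\<^bsub>Q.Q\<^esub> cup Q.Q [Up] x \<otimes>\<^bsub>Q.Q\<^esub> ids Q.Q [Up] (flip x)) =
        (cup Q.Q [Up] x \<cdot>\<^bsub>Q.Q\<^esub> cap Q.Q [Up] x) \<oplus>\<^bsub>Q.Q\<^esub>
        (qint (int n - 2) \<odot>\<^bsub>Q.Q\<^esub> (ids Q.Q [Up] x \<otimes>\<^bsub>Q.Q\<^esub> ids Q.Q [Up] (flip x)))"
      unfolding S using Q.relation_holds[OF moy_relations.square[of x n]] by (simp add: defs)
    show "((Q.cls (tr_S Up) \<otimes>\<^bsub>Q.Q\<^esub> Ide Q.Q [Up]) \<cdot>\<^bsub>Q.Q\<^esub> (Ide Q.Q [Up] \<otimes>\<^bsub>Q.Q\<^esub> Q.cls (tr_S Up)) \<cdot>\<^bsub>Q.Q\<^esub>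
          (Q.cls (tr_S Up) \<otimes>\<^bsub>Q.Q\<^esub> Ide Q.Q [Up])) \<oplus>\<^bsub>Q.Q\<^esub> (Ide Q.Q [Up] \<otimes>\<^bsub>Q.Q\<^esub> Q.cls (tr_S Up)) =
        ((Ide Q.Q [Up] \<otimes>\<^bsub>Q.Q\<^esub> Q.cls (tr_S Up)) \<cdot>\<^bsub>Q.Q\<^esub> (Q.cls (tr_S Up) \<otimes>\<^bsub>Q.Q\<^esub> Ide Q.Q [Up]) \<cdot>\<^bsub>Q.Q\<^esub>
          (Ide Q.Q [Up] \<otimes>\<^bsub>Q.Q\<^esub> Q.cls (tr_S Up))) \<oplus>\<^bsub>Q.Q\<^esub> (Q.cls (tr_S Up) \<otimes>\<^bsub>Q.Q\<^esub> Ide Q.Q [Up])"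
      using Q.relation_holds[OF moy_relations.hexagon[of Up n]] by (simp add: defs)
  qed
  \<comment> \<open>The coefficients \<open>qi * t\<close> and \<open>q * ti\<close> of the identity
    merge into the powers \<open>n - 1\<close> and \<open>1 - n\<close> of the variable.\<close>
  show ?thesis
    using moy_category.rigid_braided_untwisted_crossings[OF m]
    by (simp add: MOY flip: qpow_add)
qed

end
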